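(* Let $d\ge 1$ and let $f\in C_0(\mathbb R^d)$. Suppose that $f$ and its partial derivatives $D^\eta f$, for all $\eta\in\{0,1\}^d$ with $\eta\ne\mathbf 1$, are locally absolutely continuous on $(\mathbb R\setminus\{0\})^d$ in each variable. Let $f\in L_{p_{\mathbf 0}}(\mathbb R^d)$ with $1\le p_{\mathbf 0}<\infty$, and for each $\eta\in\{0,1\}^d$, $\eta\neq\mathbf 0$, let $D^\eta f\in L_{p_\eta}(\mathbb R^d)$ with $1<p_\eta<\infty$. If $$\sum_{\eta\in\{0,1\}^d}\frac{1}{p_\eta}>2^{d-1}\qquad\text{and}\qquad \sum_{\eta\in\{0,1\}^d,\ \eta\neq\mathbf 0}\frac{1}{p_\eta}\le 2^{d-1},$$ then $f\in A(\mathbb R^d)$.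
   Context: $A(\mathbb R^d)$ is the set of functions $f$ on $\mathbb R^d$ representable as $f(y)=\int_{\mathbb R^d} g(x)e^{i(x,y)}\,dx$ for some $g\in L_1(\mathbb R^d)$. $C_0(\mathbb R^d)$ is the set of continuous functions on $\mathbb R^d$ tending to $0$ as $|x|\to\infty$. $\eta=(\eta_1,\dots,\eta_d)$ denotes a vector with entries $0$ or $1$ only; $\mathbf 0=(0,\dots,0)$, $\mathbf 1=(1,\dots,1)$. $D^\eta f=\left(\prod_{j:\,\eta_j=1}\frac{\partial}{\partial x_j}\right)f$, with $D^{\mathbf 0}f=f$. "Locally absolutely continuous on $(\mathbb R\setminus\{0\})^d$ in each variable" means absolutely continuous in each variable on compact intervals of $\mathbb R\setminus\{0\}$, the other variables being fixed in $\mathbb R\setminus\{0\}$. *)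

theory Defs
  imports "HOL-Analysis.Analysis"
begin

text \<open>
  Functions on \<open>\<real>\<^sup>d\<close> are complex valued, with domain \<^typ>\<open>real ^ 'n\<close> and \<open>d = CARD('n)\<close>.
  A 0/1 vector \<open>\<eta>\<close> is represented by its support, a subset of \<^typ>\<open>'n\<close>; thus the zero vector is
  \<open>{}\<close> and the all-ones vector is \<open>UNIV\<close>.
\<close>

definition C0 :: "(real ^ 'n \<Rightarrow> complex) set" where
  "C0 = {f. continuous_on UNIV f \<and> (f \<longlongrightarrow> 0) at_infinity}"

definition Lp :: "real \<Rightarrow> (real ^ 'n \<Rightarrow> complex) set" where
  "Lp p = {f. f \<in> borel_measurable lebesgue \<and> integrable lebesgue (\<lambda>x. norm (f x) powr p)}"

definition Wiener_algebra :: "(real ^ 'n \<Rightarrow> complex) set" where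
  "Wiener_algebra = {f. \<exists>g. integrable lebesgue g \<and>
     (\<forall>y. f y = (LINT x|lebesgue. g x * exp (\<i> * complex_of_real (x \<bullet> y))))}"

definition upd_coord :: "real ^ 'n \<Rightarrow> 'n \<Rightarrow> real \<Rightarrow> real ^ 'n" where
  "upd_coord x j t = (\<chi> i. if i = j then t else x $ i)"

definition off_axes :: "(real ^ 'n) set" where
  "off_axes = {x. \<forall>j. x $ j \<noteq> 0}"

text \<open>
  \<open>\<D> division_of t\<close> says that \<open>\<D>\<close> is a finite family of non-overlapping non-empty compact intervals
  with union \<open>t\<close>, so the condition below is the usual \<open>\<epsilon>\<close>-\<open>\<delta>\<close> one over finite families of
  non-overlapping subintervals \<open>[Inf k, Sup k]\<close> of \<open>S\<close>.
\<close>
definition absolutely_continuous_on :: "real set \<Rightarrow> (real \<Rightarrow> complex) \<Rightarrow> bool" where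
  "absolutely_continuous_on S h \<longleftrightarrow>
     (\<forall>\<epsilon>>0. \<exists>\<delta>>0. \<forall>\<D> t. \<D> division_of t \<and> t \<subseteq> S \<and> (\<Sum>k\<in>\<D>. Sup k - Inf k) < \<delta>
        \<longrightarrow> (\<Sum>k\<in>\<D>. norm (h (Sup k) - h (Inf k))) < \<epsilon>)"

definition locally_ac_each_variable :: "(real ^ 'n \<Rightarrow> complex) \<Rightarrow> bool" where
  "locally_ac_each_variable F \<longleftrightarrow>
     (\<forall>j. \<forall>x\<in>off_axes. \<forall>a b. 0 \<notin> {a..b} \<longrightarrow>
        absolutely_continuous_on {a..b} (\<lambda>t. F (upd_coord x j t)))"

definition has_partial_derivative_at ::
    "(real ^ 'n \<Rightarrow> complex) \<Rightarrow> 'n \<Rightarrow> complex \<Rightarrow> real ^ 'n \<Rightarrow> bool" where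
  "has_partial_derivative_at F j v x \<longleftrightarrow>
     ((\<lambda>t. F (upd_coord x j t)) has_vector_derivative v) (at (x $ j))"

text \<open>
  \<open>D \<eta>\<close> is the mixed derivative of \<open>f\<close>, once in every variable of \<open>\<eta>\<close>.  The derivatives with
  \<open>\<eta> \<noteq> UNIV\<close> are themselves required to be locally absolutely continuous in the main result, so they
  are pointwise derivatives at every point off the coordinate hyperplanes, whereas the top one is
  the derivative of a locally absolutely continuous function and exists only almost everywhere.
  Each \<open>D \<eta>\<close> need only arise by some order of differentiation: commutation of partial
  derivatives is not presupposed.  On the coordinate hyperplanes (a null set) \<open>D \<eta>\<close> is arbitrary
  for \<open>\<eta> \<noteq> {}\<close>.
\<close>
definition mixed_partial_derivatives ::
    "(real ^ 'n \<Rightarrow> complex) \<Rightarrow> ('n set \<Rightarrow> real ^ 'n \<Rightarrow> complex) \<Rightarrow> bool" where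
  "mixed_partial_derivatives f D \<longleftrightarrow>
     D {} = f \<and>
     (\<forall>\<eta>. \<eta> \<noteq> {} \<and> \<eta> \<noteq> UNIV \<longrightarrow>
        (\<exists>j\<in>\<eta>. \<forall>x\<in>off_axes. has_partial_derivative_at (D (\<eta> - {j})) j (D \<eta> x) x)) \<and>
     (\<exists>j. AE x in lebesgue. has_partial_derivative_at (D (UNIV - {j})) j (D UNIV x) x)"

end

theory Submission
  imports Defs "HOL-Probability.Probability"
begin

text \<open>
  Let \<open>\<Delta>\<^sub>h f x = (\<Sum>T. (-1) ^ card T * f (x - h\<^sub>T))\<close> be the mixed difference of \<open>f\<close> with steps
  \<open>h = (h\<^sub>j)\<close>, where \<open>h\<^sub>T\<close> has the entries of \<open>h\<close> in \<open>T\<close> and \<open>0\<close> elsewhere.  The proof has two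
  halves, joined by the size of \<open>\<Delta>\<^sub>h f\<close> in \<open>L\<^sub>2\<close>.

  The first half is Bernstein's theorem on absolute convergence, \<open>Bernstein_criterion\<close>: \<open>f\<close> is in the
  Wiener algebra as soon as the \<open>L\<^sub>2\<close> norms of the \<open>\<Delta>\<^sub>h f\<close> with \<open>h\<^sub>j = 2 powr s\<^sub>j\<close>, each divided by
  \<open>\<Prod>j. sqrt h\<^sub>j\<close>, are bounded by a product of geometric factors that is summable over the integer
  vectors \<open>s\<close>.  The averages of \<open>f\<close> over boxes with dyadic sides tend to \<open>f\<close> when all sides shrink
  and, because \<open>f\<close> vanishes at infinity, to \<open>0\<close> when some side grows.  Telescoping them in every
  variable writes \<open>f\<close> as a sum of convolutions of \<open>\<Delta>\<^sub>h f\<close> with normalised indicators of boxes.  By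
  Plancherel and Cauchy-Schwarz a convolution of two \<open>L\<^sub>2\<close> functions is the Fourier transform of an
  \<open>L\<^sub>1\<close> function whose norm is at most a constant times the product of the \<open>L\<^sub>2\<close> norms
  (\<open>Wiener_norm_le_convolution_L2\<close>), and the terms can be added in \<open>L\<^sub>1\<close>.

  The second half, \<open>mixed_diff_L2_le\<close>, bounds \<open>\<Delta>\<^sub>h f\<close> in \<open>L\<^sub>2\<close>.  The difference of \<open>f\<close> in the variables
  of \<open>S\<close> is the integral of \<open>D S\<close> over a box (\<open>mixed_difference_integral\<close>), so up to constants
  \<open>\<Delta>\<^sub>h f\<close> is at most \<open>\<Prod>j\<in>S. h\<^sub>j\<close> in the norm of exponent \<open>p S\<close>, for every \<open>S\<close>; it is also bounded by
  \<open>1\<close> and by \<open>(\<Prod>j. h\<^sub>j) powr (1 - 1 / p UNIV)\<close> uniformly.  Interpolating the norms of exponents \<open>p S\<close>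
  with equal weights \<open>2 ^ - d\<close> gives the power \<open>1/2\<close> of every \<open>h\<^sub>j\<close>, in an \<open>L\<^sub>q\<close> norm where \<open>1/q\<close> is the
  mean of the \<open>1 / p S\<close>.  This mean exceeds \<open>1/2\<close>: that is the hypothesis on the sum.  Hence the weights
  may be tilted a little, towards a larger power of those \<open>h\<^sub>j\<close> that are at most \<open>1\<close> and a smaller
  power of the others, and \<open>1/q\<close> still exceeds \<open>1/2\<close>.  A combination of the uniform bounds and the
  norm of exponent \<open>p UNIV\<close> has the power \<open>1/2\<close> of every \<open>h\<^sub>j\<close> at some \<open>1/q < 1/2\<close>, since
  \<open>p UNIV > 1\<close>.  A further interpolation with it brings \<open>1/q\<close> to \<open>1/2\<close> exactly and keeps part of the gain
  (\<open>interpolation_exponents\<close>).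

  The delicate point is that nothing is assumed about the derivatives on the coordinate hyperplanes,
  across which \<open>D S\<close> could jump.  Only \<open>f\<close> is continuous there.  It suffices: the difference of \<open>f\<close> in
  the other variables is continuous, so its increments over short intervals that contain a coordinate
  \<open>0\<close> are small, just as the integrals that represent them (\<open>mixed_difference_step\<close>).
\<close>

section \<open>Lebesgue measure on \<open>\<real>\<^sup>n\<close> as a product measure\<close>

lemma measurable_vec_of_fun [measurable]:
  fixes M :: "'n::finite \<Rightarrow> real measure"
  assumes "\<And>i. sets (M i) = sets borel"
  shows "(\<lambda>w. \<chi> i. w i) \<in> borel_measurable (Pi\<^sub>M (UNIV::'n set) M)"
proof -
  have "(\<lambda>w. w i) \<in> borel_measurable (Pi\<^sub>M (UNIV::'n set) M)" for i
    using measurable_component_singleton[of i UNIV M] assms measurable_cong_sets by blast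
  then have "\<forall>b\<in>Basis. (\<lambda>w. (\<chi> i. w i) \<bullet> b) \<in> borel_measurable (Pi\<^sub>M (UNIV::'n set) M)"
    by (auto simp: Basis_vec_def inner_axis)
  then show ?thesis
    using borel_measurable_euclidean_space[of "\<lambda>w::'n \<Rightarrow> real. \<chi> i. w i" "Pi\<^sub>M UNIV M"] by blast
qed

text \<open>
  The product measure lives on functions from the index type, the vectors of \<^typ>\<open>real ^ 'n\<close> are
  a type of their own.  Boxes generate the Borel sets, so a measure that multiplies on boxes is the
  image of the product measure.  This is used for Lebesgue measure and for its restriction to a box.
\<close>

lemma distr_PiM_vec_eqI:
  fixes N :: "(real ^ 'n) measure" and M :: "'n \<Rightarrow> real measure"
  assumes sf: "\<And>i. sigma_finite_measure (M i)" and sets_M: "\<And>i. sets (M i) = sets borel"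
    and sets_N: "sets N = sets borel"
    and box: "\<And>l u. (\<And>i. l $ i \<le> u $ i) \<Longrightarrow> emeasure N (box l u) = (\<Prod>i\<in>UNIV. emeasure (M i) {l $ i<..<u $ i})"
    and fin: "\<And>l u. emeasure N (box l u) \<noteq> \<infinity>"
  shows "N = distr (Pi\<^sub>M UNIV M) borel (\<lambda>w. \<chi> i. w i)"
proof (rule measure_eqI_generator_eq)
  interpret product_sigma_finite M using sf by (rule product_sigma_finite.intro)
  let ?E = "range (\<lambda>(a, b). box a b::(real^'n) set)"
  show "Int_stable ?E"
    by (auto simp: Int_stable_def box_Int_box)
  show "?E \<subseteq> Pow UNIV" "sets N = sigma_sets UNIV ?E"
      "sets (distr (Pi\<^sub>M UNIV M) borel (\<lambda>w. \<chi> i. w i)) = sigma_sets UNIV ?E"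
    by (simp_all add: borel_eq_box sets_N)
  let ?A = "\<lambda>n::nat. box (- (real n *\<^sub>R One)) (real n *\<^sub>R One) :: (real^'n) set"
  show "range ?A \<subseteq> ?E" "(\<Union>i. ?A i) = UNIV"
    unfolding UN_box_eq_UNIV by auto
  show "emeasure N (?A i) \<noteq> \<infinity>" for i by (rule fin)
  fix X assume "X \<in> ?E"
  then obtain l u where X: "X = box l u" by auto
  show "emeasure N X = emeasure (distr (Pi\<^sub>M UNIV M) borel (\<lambda>w. \<chi> i. w i)) X"
  proof (cases "\<forall>i. l $ i \<le> u $ i")
    case True
    have [simp]: "space (M i) = UNIV" for i using sets_eq_imp_space_eq[OF sets_M[of i]] by simp
    have "(\<lambda>w. \<chi> i. w i) -` box l u \<inter> space (Pi\<^sub>M UNIV M) = Pi\<^sub>E UNIV (\<lambda>i. {l$i<..<u$i})"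
      by (auto simp: mem_box_cart space_PiM PiE_iff)
    then have "emeasure (distr (Pi\<^sub>M UNIV M) borel (\<lambda>w. \<chi> i. w i)) X
        = (\<Prod>i\<in>UNIV. emeasure (M i) {l $ i<..<u $ i})"
      using sets_M by (simp add: emeasure_distr X emeasure_PiM measurable_vec_of_fun)
    with True box X show ?thesis by simp
  next
    case False
    then have "X = {}" using X by (auto simp: mem_box_cart not_le) (meson less_trans less_asym)
    then show ?thesis by simp
  qed
qed

lemma lborel_vec_eq_distr:
  "(lborel :: (real ^ 'n) measure) = distr (Pi\<^sub>M UNIV (\<lambda>_. lborel)) borel (\<lambda>w. \<chi> i. w i)"
proof (rule distr_PiM_vec_eqI)
  fix l u :: "real ^ 'n" assume le: "\<And>i. l $ i \<le> u $ i"
  then have "emeasure lborel (box l u) = ennreal (\<Prod>b\<in>Basis. (u - l) \<bullet> b)"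
    by (subst emeasure_lborel_box) (auto simp: Basis_vec_def inner_axis)
  also have "(\<Prod>b\<in>Basis. (u - l) \<bullet> b) = (\<Prod>i\<in>UNIV. u $ i - l $ i)"
    by (rule prod.reindex_cong[of "\<lambda>i. axis i 1"]) (auto simp: Basis_vec_def inner_axis inj_on_def axis_eq_axis)
  also have "ennreal \<dots> = (\<Prod>i\<in>UNIV. ennreal (u $ i - l $ i))"
    using le by (simp add: prod_ennreal)
  finally show "emeasure lborel (box l u) = (\<Prod>i\<in>UNIV. emeasure lborel {l $ i<..<u $ i})"
    using le by simp
qed (auto simp: emeasure_lborel_box_eq intro: lborel.sigma_finite_measure_axioms)

lemma
  fixes g :: "'n::finite \<Rightarrow> real \<Rightarrow> 'b :: {real_normed_field,banach,second_countable_topology}"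
  assumes g: "\<And>i. integrable lborel (g i)"
  shows integrable_prod_vec: "integrable lborel (\<lambda>x::real^'n. \<Prod>i\<in>UNIV. g i (x $ i))"
    and integral_prod_vec: "(LBINT x. (\<Prod>i\<in>UNIV. g i ((x::real^'n) $ i))) = (\<Prod>i\<in>UNIV. integral\<^sup>L lborel (g i))"
proof -
  interpret product_sigma_finite "\<lambda>_::'n. lborel::real measure" ..
  have m[measurable]: "g i \<in> borel_measurable borel" for i
    using borel_measurable_integrable[OF g[of i]] by simp
  have m2[measurable]: "(\<lambda>x::real^'n. \<Prod>i\<in>UNIV. g i (x $ i)) \<in> borel_measurable borel"
    by measurable
  have m3: "(\<lambda>w. \<chi> i. w i) \<in> borel_measurable (Pi\<^sub>M (UNIV::'n::finite set) (\<lambda>_. lborel::real measure))"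
    by (rule measurable_vec_of_fun) simp
  show "integrable lborel (\<lambda>x::real^'n. \<Prod>i\<in>UNIV. g i (x $ i))"
    by (subst lborel_vec_eq_distr, subst integrable_distr_eq[OF m3 m2])
       (auto intro!: product_integrable_prod g)
  show "(LBINT x. (\<Prod>i\<in>UNIV. g i ((x::real^'n) $ i))) = (\<Prod>i\<in>UNIV. integral\<^sup>L lborel (g i))"
    by (subst lborel_vec_eq_distr, subst integral_distr[OF m3 m2])
       (auto intro!: product_integral_prod g)
qed

text \<open>
  Translations and reflections are treated together, as \<open>x \<mapsto> c + e x\<close> with \<open>e = 1\<close> or \<open>e = -1\<close>.
\<close>

lemma lborel_distr_isometry:
  fixes c :: "'a::euclidean_space"
  assumes "\<bar>e\<bar> = 1" shows "distr lborel borel (\<lambda>x. c + e *\<^sub>R x) = lborel"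
  using assms by (subst (2) lborel_affine[of e c]) (auto simp: density_1)

lemma
  fixes f :: "'a::euclidean_space \<Rightarrow> 'b::{banach, second_countable_topology}"
  assumes e: "\<bar>e\<bar> = 1"
  shows lborel_integrable_isometry_iff: "integrable lborel (\<lambda>x. f (c + e *\<^sub>R x)) \<longleftrightarrow> integrable lborel f"
    and lborel_integral_isometry: "(LBINT x. f (c + e *\<^sub>R x)) = integral\<^sup>L lborel f"
proof -
  have *: "integrable lborel (\<lambda>x. f (c + e *\<^sub>R x))" if "integrable lborel f" for f :: "'a \<Rightarrow> 'b" and c
  proof -
    have "integrable (distr lborel borel (\<lambda>x. c + e *\<^sub>R x)) f"
      using that by (simp add: lborel_distr_isometry[OF e])
    then show ?thesis by (subst (asm) integrable_distr_eq) (use that in auto)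
  qed
  have "e * e = 1" using e by (metis abs_mult_self_eq mult_1)
  then have inv: "c + e *\<^sub>R (- (e *\<^sub>R c) + e *\<^sub>R x) = x" for x
    by (simp add: scaleR_right_diff_distrib)
  show iff: "integrable lborel (\<lambda>x. f (c + e *\<^sub>R x)) \<longleftrightarrow> integrable lborel f"
    using *[of f c] *[of "\<lambda>x. f (c + e *\<^sub>R x)" "- (e *\<^sub>R c)"] by (auto simp only: inv)
  show "(LBINT x. f (c + e *\<^sub>R x)) = integral\<^sup>L lborel f"
  proof (cases "integrable lborel f")
    case True
    have "integral\<^sup>L lborel f = integral\<^sup>L (distr lborel borel (\<lambda>x. c + e *\<^sub>R x)) f"
      by (simp add: lborel_distr_isometry[OF e])
    then show ?thesis by (subst (asm) integral_distr) (use True in auto)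
  next
    case False
    then show ?thesis using iff by (simp add: not_integrable_integral_eq)
  qed
qed

lemma nn_integral_lborel_isometry:
  fixes f :: "'a::euclidean_space \<Rightarrow> ennreal"
  assumes e: "\<bar>e\<bar> = 1" and [measurable]: "f \<in> borel_measurable borel"
  shows "(\<integral>\<^sup>+x. f (c + e *\<^sub>R x) \<partial>lborel) = integral\<^sup>N lborel f"
proof -
  have "integral\<^sup>N lborel f = integral\<^sup>N (distr lborel borel (\<lambda>x. c + e *\<^sub>R x)) f"
    by (simp add: lborel_distr_isometry[OF e])
  then show ?thesis by (subst (asm) nn_integral_distr) auto
qed

lemma lborel_integrable_translate_iff:
  fixes f :: "'a::euclidean_space \<Rightarrow> 'b::{banach, second_countable_topology}"
  shows "integrable lborel (\<lambda>x. f (x + c)) \<longleftrightarrow> integrable lborel f"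
  using lborel_integrable_isometry_iff[of 1 f c] by (simp add: add.commute)

lemma lborel_integrable_reflect_iff:
  fixes f :: "'a::euclidean_space \<Rightarrow> 'b::{banach, second_countable_topology}"
  shows "integrable lborel (\<lambda>x. f (c - x)) \<longleftrightarrow> integrable lborel f"
  using lborel_integrable_isometry_iff[of "-1" f c] by simp

lemma lborel_integral_translate:
  fixes f :: "'a::euclidean_space \<Rightarrow> 'b::{banach, second_countable_topology}"
  shows "(LBINT x. f (x + c)) = integral\<^sup>L lborel f"
  using lborel_integral_isometry[of 1 f c] by (simp add: add.commute)

lemma lborel_integral_reflect:
  fixes f :: "'a::euclidean_space \<Rightarrow> 'b::{banach, second_countable_topology}"
  shows "(LBINT x. f (c - x)) = integral\<^sup>L lborel f"
  using lborel_integral_isometry[of "-1" f c] by simp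

lemma nn_integral_lborel_translate:
  fixes f :: "'a::euclidean_space \<Rightarrow> ennreal"
  assumes "f \<in> borel_measurable borel"
  shows "(\<integral>\<^sup>+x. f (x + c) \<partial>lborel) = integral\<^sup>N lborel f"
  using nn_integral_lborel_isometry[of 1 f c] assms by (simp add: add.commute)

lemma nn_integral_lborel_reflect:
  fixes f :: "'a::euclidean_space \<Rightarrow> ennreal"
  assumes "f \<in> borel_measurable borel"
  shows "(\<integral>\<^sup>+x. f (c - x) \<partial>lborel) = integral\<^sup>N lborel f"
  using nn_integral_lborel_isometry[of "-1" f c] assms by simp

lemma integral_lborel_diag:
  fixes F :: "real ^ 'n \<Rightarrow> 'b::{banach, second_countable_topology}" and h :: "'n \<Rightarrow> real"
  assumes [measurable]: "F \<in> borel_measurable borel" and h: "\<And>j. h j > 0"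
  shows "integral\<^sup>L lborel F = (\<Prod>j\<in>UNIV. h j) *\<^sub>R (LBINT s. F (\<chi> j. h j * s $ j))"
proof -
  define c :: "real ^ 'n \<Rightarrow> real" where "c b = (\<chi> j. h j) \<bullet> b" for b
  have c: "c b \<noteq> 0" if "b \<in> Basis" for b
    using that h by (auto simp: c_def Basis_vec_def inner_axis less_imp_neq[symmetric])
  define T where "T x = (0::real^'n) + (\<Sum>b\<in>Basis. (c b * (x \<bullet> b)) *\<^sub>R b)" for x
  have T: "T x = (\<chi> j. h j * x $ j)" for x
  proof (rule vec_eq_iff[THEN iffD2], rule allI)
    fix j
    have "T x $ j = T x \<bullet> axis j 1" by (simp add: inner_axis)
    also have "\<dots> = c (axis j 1) * (x \<bullet> axis j 1)"
      unfolding T_def by (simp add: inner_sum_left_Basis)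
    finally show "T x $ j = (\<chi> j. h j * x $ j) $ j" by (simp add: c_def inner_axis)
  qed
  have prod: "(\<Prod>b\<in>Basis. \<bar>c b\<bar>) = (\<Prod>j\<in>UNIV. h j)"
    by (rule prod.reindex_cong[of "\<lambda>i. axis i 1"])
       (auto simp: Basis_vec_def inner_axis inj_on_def axis_eq_axis c_def h less_imp_le)
  have eq: "lborel = density (distr lborel borel T) (\<lambda>_. ennreal (\<Prod>j\<in>UNIV. h j))"
    using lborel_affine_euclidean[of c 0, OF c] unfolding prod T_def[abs_def, symmetric] by simp
  have H: "(\<Prod>j\<in>UNIV. h j) > 0" using h by (intro prod_pos) auto
  have [measurable]: "T \<in> borel \<rightarrow>\<^sub>M borel" unfolding T_def[abs_def] by measurable
  have "integral\<^sup>L lborel F = integral\<^sup>L (density (distr lborel borel T) (\<lambda>_. ennreal (\<Prod>j\<in>UNIV. h j))) F"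
    using eq by simp
  also have "\<dots> = (\<integral>x. (\<Prod>j\<in>UNIV. h j) *\<^sub>R F x \<partial>distr lborel borel T)"
    by (subst integral_density) (use H in auto)
  also have "\<dots> = (LBINT x. (\<Prod>j\<in>UNIV. h j) *\<^sub>R F (T x))"
    by (subst integral_distr) auto
  finally show ?thesis by (simp add: T)
qed

section \<open>Gaussian regularisation\<close>

definition gauss :: "real \<Rightarrow> real ^ 'n \<Rightarrow> real" where
  "gauss \<epsilon> z = (\<Prod>j\<in>UNIV. normal_density 0 \<epsilon> (z $ j))"

text \<open>
  The regularising multiplier, complex valued because it always multiplies Fourier transforms.
  Its own transform is \<open>(2 * pi) ^ n * gauss \<epsilon>\<close>, and it increases to \<open>1\<close> as \<open>\<epsilon>\<close> decreases to \<open>0\<close>.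
\<close>

definition damp :: "real \<Rightarrow> real ^ 'n \<Rightarrow> complex" where
  "damp \<epsilon> \<xi> = complex_of_real (exp (- (\<epsilon> * norm \<xi>)\<^sup>2 / 2))"

lemma measurable_cis [measurable]: "cis \<in> borel_measurable borel"
  by (intro borel_measurable_continuous_onI continuous_intros)

text \<open>
  Up to scaling by \<open>\<epsilon>\<close> this is the characteristic function of the standard normal distribution.
\<close>

lemma fourier_gauss_real:
  assumes "\<epsilon> > 0"
  shows "integrable lborel (\<lambda>x. complex_of_real (exp (- (\<epsilon> * x)\<^sup>2 / 2)) * cis (x * z))"
    and "(LBINT x. complex_of_real (exp (- (\<epsilon> * x)\<^sup>2 / 2)) * cis (x * z))
      = complex_of_real (2 * pi * normal_density 0 \<epsilon> z)"
proof -
  let ?g = "\<lambda>x. std_normal_density x *\<^sub>R cis (z / \<epsilon> * x)"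
  have int: "integrable lborel ?g"
    by (rule Bochner_Integration.integrable_bound[OF integrable_normal_density[of 1 0]]) auto
  have "char std_normal_distribution (z / \<epsilon>) = (LBINT x. ?g x)"
    unfolding char_def by (subst integral_density) (auto simp: cis_conv_exp)
  then have g: "(LBINT x. ?g x) = complex_of_real (exp (- (z / \<epsilon>)\<^sup>2 / 2))"
    by (simp add: char_std_normal_distribution)
  have *: "complex_of_real (exp (- (\<epsilon> * x)\<^sup>2 / 2)) * cis (x * z) = sqrt (2 * pi) *\<^sub>R ?g (0 + \<epsilon> * x)" for x
    using assms by (simp add: std_normal_density_def scaleR_conv_of_real mult_ac)
  show "integrable lborel (\<lambda>x. complex_of_real (exp (- (\<epsilon> * x)\<^sup>2 / 2)) * cis (x * z))"
    unfolding * using assms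
    by (intro integrable_scaleR_right lborel_integrable_real_affine[OF int]) simp
  have "(LBINT x. complex_of_real (exp (- (\<epsilon> * x)\<^sup>2 / 2)) * cis (x * z))
     = sqrt (2 * pi) *\<^sub>R (LBINT x. ?g (0 + \<epsilon> * x))"
    unfolding * by (simp only: integral_scaleR_right)
  also have "(LBINT x. ?g (0 + \<epsilon> * x)) = (1 / \<epsilon>) *\<^sub>R (LBINT x. ?g x)"
    using lborel_integral_real_affine[of \<epsilon> ?g 0] assms by simp
  also have "sqrt (2 * pi) *\<^sub>R \<dots> = complex_of_real (sqrt (2 * pi) / \<epsilon> * exp (- (z / \<epsilon>)\<^sup>2 / 2))"
    unfolding g by (simp add: scaleR_conv_of_real)
  also have "sqrt (2 * pi) / \<epsilon> * exp (- (z / \<epsilon>)\<^sup>2 / 2) = 2 * pi * normal_density 0 \<epsilon> z"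
    using assms by (simp add: normal_density_def real_sqrt_mult real_div_sqrt field_simps)
  finally show "(LBINT x. complex_of_real (exp (- (\<epsilon> * x)\<^sup>2 / 2)) * cis (x * z))
      = complex_of_real (2 * pi * normal_density 0 \<epsilon> z)" .
qed

lemma cis_sum: "cis (sum f A) = (\<Prod>j\<in>A. cis (f j))"
  by (induction A rule: infinite_finite_induct) (auto simp: cis_mult[symmetric])

lemma fourier_gauss:
  fixes z :: "real ^ 'n"
  assumes "\<epsilon> > 0"
  shows "integrable lborel (\<lambda>\<xi>. damp \<epsilon> \<xi> * cis (\<xi> \<bullet> z))"
    and "(LBINT \<xi>. damp \<epsilon> \<xi> * cis (\<xi> \<bullet> z)) = complex_of_real ((2 * pi) ^ CARD('n)) * complex_of_real (gauss \<epsilon> z)"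
proof -
  have *: "damp \<epsilon> \<xi> * cis (\<xi> \<bullet> z)
     = (\<Prod>j\<in>UNIV. complex_of_real (exp (- (\<epsilon> * \<xi> $ j)\<^sup>2 / 2)) * cis (\<xi> $ j * z $ j))" for \<xi>
  proof -
    have "(\<Sum>j\<in>UNIV. - (\<epsilon> * \<xi> $ j)\<^sup>2 / 2) = - (\<epsilon>\<^sup>2 * (\<Sum>j\<in>UNIV. (\<xi> $ j)\<^sup>2)) / 2"
      by (simp add: power_mult_distrib sum_distrib_left sum_divide_distrib sum_negf)
    also have "(\<Sum>j\<in>UNIV. (\<xi> $ j)\<^sup>2) = (norm \<xi>)\<^sup>2"
      unfolding power2_norm_eq_inner inner_vec_def by (simp add: power2_eq_square)
    finally have "- (\<epsilon> * norm \<xi>)\<^sup>2 / 2 = (\<Sum>j\<in>UNIV. - (\<epsilon> * \<xi> $ j)\<^sup>2 / 2)"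
      by (simp add: power_mult_distrib)
    then show ?thesis
      by (simp add: damp_def inner_vec_def cis_sum prod.distrib exp_sum)
  qed
  show "integrable lborel (\<lambda>\<xi>. damp \<epsilon> \<xi> * cis (\<xi> \<bullet> z))"
    unfolding * by (rule integrable_prod_vec[OF fourier_gauss_real(1)[OF assms]])
  show "(LBINT \<xi>. damp \<epsilon> \<xi> * cis (\<xi> \<bullet> z)) = complex_of_real ((2 * pi) ^ CARD('n)) * complex_of_real (gauss \<epsilon> z)"
    unfolding * integral_prod_vec[OF fourier_gauss_real(1)[OF assms]] fourier_gauss_real(2)[OF assms]
    by (simp add: gauss_def prod.distrib)
qed

lemma measurable_damp [measurable]: "damp \<epsilon> \<in> borel_measurable borel"
  unfolding damp_def[abs_def] by measurable

lemma measurable_gauss [measurable]: "gauss \<epsilon> \<in> borel_measurable borel"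
  unfolding gauss_def[abs_def] by measurable

lemma norm_damp: "norm (damp \<epsilon> \<xi>) \<le> 1"
  unfolding damp_def by simp

lemma gauss_nonneg: "gauss \<epsilon> z \<ge> 0"
  unfolding gauss_def by (simp add: prod_nonneg)

lemma
  assumes "\<epsilon> > 0"
  shows integrable_gauss: "integrable lborel (gauss \<epsilon> :: real ^ 'n \<Rightarrow> real)"
    and integral_gauss: "(LBINT z. gauss \<epsilon> (z :: real ^ 'n)) = 1"
  using integrable_prod_vec[of "\<lambda>_. normal_density 0 \<epsilon>"] integral_prod_vec[of "\<lambda>_. normal_density 0 \<epsilon>"] assms
  by (simp_all add: gauss_def[abs_def])

lemma nn_integral_gauss:
  assumes "\<epsilon> > 0"
  shows "(\<integral>\<^sup>+z. ennreal (gauss \<epsilon> (z :: real ^ 'n)) \<partial>lborel) = 1"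
  using integrable_gauss[OF assms] integral_gauss[OF assms]
  by (subst nn_integral_eq_integral) (auto simp: gauss_nonneg)

lemma normal_density_scale:
  assumes "e > 0"
  shows "e * normal_density 0 e (e * t) = normal_density 0 1 t"
  using assms by (simp add: normal_density_def real_sqrt_mult power_mult_distrib)

text \<open>
  Substituting \<open>t = \<epsilon> s\<close> moves \<open>\<epsilon>\<close> from the kernel into the argument of \<open>u\<close>, where dominated
  convergence applies.
\<close>

lemma gauss_approximate_identity:
  fixes u :: "real ^ 'n \<Rightarrow> complex"
  assumes cont: "continuous_on UNIV u" and bdd: "\<And>x. norm (u x) \<le> C"
  shows "(\<lambda>k. LBINT t. u (w - t) * gauss (1 / real (Suc k)) t) \<longlonglongrightarrow> u w"
proof -
  have [measurable]: "u \<in> borel_measurable borel" using cont by (rule borel_measurable_continuous_onI)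
  have "(\<lambda>k. LBINT s. u (w - (1 / real (Suc k)) *\<^sub>R s) * gauss 1 s)
      \<longlonglongrightarrow> (LBINT s. u w * complex_of_real (gauss 1 (s :: real ^ 'n)))"
  proof (rule integral_dominated_convergence[where w = "\<lambda>s. C * gauss 1 s"])
    show "integrable lborel (\<lambda>s::real^'n. C * gauss 1 s)" using integrable_gauss[of 1] by auto
    show "AE s in lborel. norm (u (w - (1 / real (Suc k)) *\<^sub>R s) * gauss 1 s) \<le> C * gauss 1 s" for k
      by (auto simp: norm_mult gauss_nonneg intro!: mult_right_mono bdd)
    have "(\<lambda>k. u (w - (1 / real (Suc k)) *\<^sub>R s) * gauss 1 s) \<longlonglongrightarrow> u w * gauss 1 s" for s
    proof -
      have "(\<lambda>k. w - (1 / real (Suc k)) *\<^sub>R s) \<longlonglongrightarrow> w - 0 *\<^sub>R s"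
        by (intro tendsto_intros LIMSEQ_Suc[OF lim_1_over_n])
      moreover have "isCont u w" using cont by (simp add: continuous_on_eq_continuous_at)
      ultimately have "(\<lambda>k. u (w - (1 / real (Suc k)) *\<^sub>R s)) \<longlonglongrightarrow> u w"
        by (auto intro: isCont_tendsto_compose)
      then show ?thesis by (intro tendsto_intros)
    qed
    then show "AE s in lborel. (\<lambda>k. u (w - (1 / real (Suc k)) *\<^sub>R s) * gauss 1 s) \<longlonglongrightarrow> u w * gauss 1 s"
      by simp
  qed measurable
  also have "(LBINT s. u w * complex_of_real (gauss 1 (s :: real ^ 'n))) = u w"
    using integrable_gauss[of 1, where 'n='n] integral_gauss[of 1, where 'n='n] by simp
  also have "(\<lambda>k. LBINT s. u (w - (1 / real (Suc k)) *\<^sub>R s) * gauss 1 s)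
      = (\<lambda>k. LBINT t. u (w - t) * gauss (1 / real (Suc k)) t)"
  proof
    fix k
    let ?e = "1 / real (Suc k)"
    have e: "?e > 0" by simp
    have "(LBINT t. u (w - t) * gauss ?e t)
       = (\<Prod>j\<in>(UNIV::'n set). ?e) *\<^sub>R (LBINT s. u (w - (\<chi> j. ?e * s $ j)) * gauss ?e (\<chi> j. ?e * s $ j))"
      by (rule integral_lborel_diag) (measurable, simp?)
    also have "\<dots> = (LBINT s. (\<Prod>j\<in>(UNIV::'n set). ?e) *\<^sub>R (u (w - (\<chi> j. ?e * s $ j)) * gauss ?e (\<chi> j. ?e * s $ j)))"
      by simp
    also have "\<dots> = (LBINT s. u (w - ?e *\<^sub>R s) * gauss 1 s)"
    proof (rule Bochner_Integration.integral_cong[OF refl])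
      fix s :: "real ^ 'n"
      have 1: "(\<chi> j. ?e * s $ j) = ?e *\<^sub>R s" by (simp add: vec_eq_iff)
      have 2: "(\<Prod>j\<in>(UNIV::'n set). ?e) * gauss ?e (?e *\<^sub>R s) = gauss 1 s"
        unfolding gauss_def prod.distrib[symmetric]
        by (intro prod.cong refl) (simp only: vector_scaleR_component real_scaleR_def normal_density_scale[OF e])
      show "(\<Prod>j\<in>(UNIV::'n set). ?e) *\<^sub>R (u (w - (\<chi> j. ?e * s $ j)) * gauss ?e (\<chi> j. ?e * s $ j))
          = u (w - ?e *\<^sub>R s) * gauss 1 s"
        unfolding 1 2[symmetric] by (simp only: scaleR_conv_of_real of_real_mult mult_ac)
    qed
    finally show "(LBINT s. u (w - ?e *\<^sub>R s) * gauss 1 s) = (LBINT t. u (w - t) * gauss ?e t)" ..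
  qed
  finally show ?thesis .
qed

section \<open>The Fourier transform of integrable functions\<close>

definition fourier :: "(real ^ 'n \<Rightarrow> complex) \<Rightarrow> real ^ 'n \<Rightarrow> complex" where
  "fourier u \<xi> = (LBINT z. u z * cis (- (\<xi> \<bullet> z)))"

lemma measurable_fourier [measurable]:
  assumes [measurable]: "u \<in> borel_measurable borel"
  shows "fourier u \<in> borel_measurable borel"
  unfolding fourier_def[abs_def] by measurable

lemma norm_fourier_le: "norm (fourier u \<xi>) \<le> (LBINT z. norm (u z))"
  unfolding fourier_def by (rule order_trans[OF integral_norm_bound]) (simp add: norm_mult)

lemma integrable_mult_cis:
  assumes "integrable lborel u" "f \<in> borel_measurable borel"
  shows "integrable lborel (\<lambda>x. u x * cis (f x))"
  using assms by (intro Bochner_Integration.integrable_bound[OF assms(1)]) (auto simp: norm_mult)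

text \<open>
  Fubini's theorem for \<open>u z * m \<xi> * cis (- (\<xi> \<bullet> z))\<close>.
\<close>

lemma fourier_multiplication_formula:
  fixes u m :: "real ^ 'n \<Rightarrow> complex"
  assumes u: "integrable lborel u" and m: "integrable lborel m"
  shows "(LBINT \<xi>. fourier u \<xi> * m \<xi>) = (LBINT z. u z * fourier m z)"
proof -
  have [measurable]: "u \<in> borel_measurable borel" "m \<in> borel_measurable borel" using u m by auto
  let ?f = "\<lambda>z \<xi>. u z * m \<xi> * cis (- (\<xi> \<bullet> z))"
  have int: "integrable (lborel \<Otimes>\<^sub>M lborel) (case_prod ?f)"
  proof (rule lborel_pair.Fubini_integrable)
    show "case_prod ?f \<in> borel_measurable (lborel \<Otimes>\<^sub>M lborel)" by measurable
    show "integrable lborel (\<lambda>z. LBINT \<xi>. norm (case (z, \<xi>) of (z, \<xi>) \<Rightarrow> ?f z \<xi>))"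
      using u m by (simp add: norm_mult)
    show "AE z in lborel. integrable lborel (\<lambda>\<xi>. case (z, \<xi>) of (z, \<xi>) \<Rightarrow> ?f z \<xi>)"
      using m by (auto intro!: integrable_mult_cis)
  qed
  have "(LBINT \<xi>. fourier u \<xi> * m \<xi>) = (LBINT \<xi>. (LBINT z. ?f z \<xi>))"
    unfolding fourier_def
    by (subst integral_mult_left_zero[symmetric]) (simp add: mult_ac)
  also have "\<dots> = (LBINT z. (LBINT \<xi>. ?f z \<xi>))"
    by (rule lborel_pair.Fubini_integral[OF int])
  also have "\<dots> = (LBINT z. u z * fourier m z)"
    unfolding fourier_def
    by (subst integral_mult_right_zero[symmetric]) (simp add: mult_ac inner_commute)
  finally show ?thesis .
qed

text \<open>
  The regularised inverse transform of a product is the convolution of the two functions and a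
  Gaussian; it comes from the multiplication formula applied to \<open>u\<close> and then to \<open>v\<close>.  As \<open>\<epsilon>\<close> tends
  to \<open>0\<close> this one identity yields both Plancherel's inequality, with \<open>v\<close> the conjugate reflection of
  \<open>u\<close> and \<open>x = 0\<close>, and the inversion formula for convolutions.
\<close>

lemma fourier_product_regularised:
  fixes u v :: "real ^ 'n \<Rightarrow> complex"
  assumes u: "integrable lborel u" and v: "integrable lborel v" and e: "\<epsilon> > 0"
  shows "(LBINT \<xi>. fourier u \<xi> * fourier v \<xi> * cis (\<xi> \<bullet> x) * damp \<epsilon> \<xi>)
     = complex_of_real ((2 * pi) ^ CARD('n)) * (LBINT z. u z * (LBINT y. v y * complex_of_real (gauss \<epsilon> (x - z - y))))"
proof -
  have [measurable]: "u \<in> borel_measurable borel" "v \<in> borel_measurable borel" using u v by auto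
  have di: "integrable lborel (damp \<epsilon> :: real^'n \<Rightarrow> complex)"
    using fourier_gauss(1)[OF e, of 0] by simp
  let ?m = "\<lambda>\<xi>. fourier v \<xi> * (cis (\<xi> \<bullet> x) * damp \<epsilon> \<xi>)"
  have m: "integrable lborel ?m"
  proof (rule Bochner_Integration.integrable_bound)
    show "integrable lborel (\<lambda>\<xi>::real^'n. (LBINT z. norm (v z)) * norm (damp \<epsilon> \<xi>))"
      using di by auto
    show "AE \<xi> in lborel. norm (?m \<xi>) \<le> norm ((LBINT z. norm (v z)) * norm (damp \<epsilon> \<xi>))"
      by (auto simp: norm_mult intro!: mult_right_mono norm_fourier_le order_trans[OF _ abs_ge_self])
  qed measurable
  have "fourier ?m z = complex_of_real ((2 * pi) ^ CARD('n)) * (LBINT y. v y * complex_of_real (gauss \<epsilon> (x - z - y)))" for z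
  proof -
    let ?n = "\<lambda>\<xi>. damp \<epsilon> \<xi> * cis (\<xi> \<bullet> (x - z))"
    have n: "integrable lborel ?n" by (rule fourier_gauss(1)[OF e])
    have "fourier ?m z = (LBINT \<xi>. fourier v \<xi> * ?n \<xi>)"
      unfolding fourier_def[of ?m] by (simp add: mult_ac cis_mult inner_diff_right inner_commute[of _ z])
    also have "\<dots> = (LBINT y. v y * fourier ?n y)"
      by (rule fourier_multiplication_formula[OF v n])
    also have "\<dots> = (LBINT y. v y * (complex_of_real ((2 * pi) ^ CARD('n)) * complex_of_real (gauss \<epsilon> (x - z - y))))"
    proof (intro Bochner_Integration.integral_cong refl arg_cong2[where f="(*)"])
      fix y
      show "fourier ?n y = complex_of_real ((2 * pi) ^ CARD('n)) * complex_of_real (gauss \<epsilon> (x - z - y))" for y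
        unfolding fourier_def fourier_gauss(2)[OF e, symmetric]
        by (intro Bochner_Integration.integral_cong) (auto simp: mult_ac cis_mult inner_diff_right inner_commute[of _ y])
    qed
    also have "\<dots> = complex_of_real ((2 * pi) ^ CARD('n)) * (LBINT y. v y * complex_of_real (gauss \<epsilon> (x - z - y)))"
      by (subst integral_mult_right_zero[symmetric]) (simp add: mult_ac)
    finally show ?thesis .
  qed
  note fm = this
  have "(LBINT \<xi>. fourier u \<xi> * fourier v \<xi> * cis (\<xi> \<bullet> x) * damp \<epsilon> \<xi>) = (LBINT \<xi>. fourier u \<xi> * ?m \<xi>)"
    by (simp add: mult_ac)
  also have "\<dots> = (LBINT z. u z * fourier ?m z)"
    by (rule fourier_multiplication_formula[OF u m])
  also have "\<dots> = complex_of_real ((2 * pi) ^ CARD('n)) * (LBINT z. u z * (LBINT y. v y * complex_of_real (gauss \<epsilon> (x - z - y))))"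
    unfolding fm by (subst integral_mult_right_zero[symmetric]) (simp add: mult_ac)
  finally show ?thesis .
qed

lemma norm_integral_le_nn_integral:
  fixes f :: "'a \<Rightarrow> 'b::{banach, second_countable_topology}"
  shows "ennreal (norm (integral\<^sup>L M f)) \<le> (\<integral>\<^sup>+x. ennreal (norm (f x)) \<partial>M)"
  by (cases "integrable M f") (auto simp: integral_norm_bound_ennreal not_integrable_integral_eq)

text \<open>
  Since \<open>2 a b \<le> a\<^sup>2 + b\<^sup>2\<close> and the Gaussian has integral \<open>1\<close> in each of the two variables.
\<close>

lemma young_gauss:
  fixes a b :: "real ^ 'n \<Rightarrow> real"
  assumes [measurable]: "a \<in> borel_measurable borel" "b \<in> borel_measurable borel" and e: "\<epsilon> > 0"
    and nn: "\<And>x. a x \<ge> 0" "\<And>x. b x \<ge> 0"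
  shows "2 * (\<integral>\<^sup>+z. \<integral>\<^sup>+y. ennreal (a z * (b y * gauss \<epsilon> (x - z - y))) \<partial>lborel \<partial>lborel)
     \<le> (\<integral>\<^sup>+z. ennreal ((a z)\<^sup>2) \<partial>lborel) + (\<integral>\<^sup>+z. ennreal ((b z)\<^sup>2) \<partial>lborel)"
proof -
  have g1: "(\<integral>\<^sup>+y. ennreal (gauss \<epsilon> (w - y)) \<partial>lborel) = 1" for w :: "real ^ 'n"
    using nn_integral_lborel_reflect[of "\<lambda>x. ennreal (gauss \<epsilon> x)" w] nn_integral_gauss[OF e] by simp
  have "2 * (\<integral>\<^sup>+z. \<integral>\<^sup>+y. ennreal (a z * (b y * gauss \<epsilon> (x - z - y))) \<partial>lborel \<partial>lborel)
      = (\<integral>\<^sup>+z. \<integral>\<^sup>+y. 2 * ennreal (a z * (b y * gauss \<epsilon> (x - z - y))) \<partial>lborel \<partial>lborel)"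
    by (simp add: nn_integral_cmult)
  also have "\<dots> \<le> (\<integral>\<^sup>+z. \<integral>\<^sup>+y. ennreal ((a z)\<^sup>2) * ennreal (gauss \<epsilon> (x - z - y))
        + ennreal ((b y)\<^sup>2) * ennreal (gauss \<epsilon> (x - z - y)) \<partial>lborel \<partial>lborel)"
  proof (intro nn_integral_mono)
    fix z y
    let ?g = "gauss \<epsilon> (x - z - y)"
    have "2 * (a z * b y) \<le> (a z)\<^sup>2 + (b y)\<^sup>2" using sum_squares_bound[of "a z" "b y"] by simp
    then have "2 * (a z * b y) * ?g \<le> ((a z)\<^sup>2 + (b y)\<^sup>2) * ?g"
      by (intro mult_right_mono gauss_nonneg)
    then have "ennreal (2 * (a z * (b y * ?g))) \<le> ennreal ((a z)\<^sup>2 * ?g + (b y)\<^sup>2 * ?g)"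
      by (intro ennreal_leI) (simp add: algebra_simps)
    then show "2 * ennreal (a z * (b y * ?g)) \<le> ennreal ((a z)\<^sup>2) * ennreal ?g + ennreal ((b y)\<^sup>2) * ennreal ?g"
      by (simp add: ennreal_mult'' gauss_nonneg nn)
  qed
  also have "\<dots> = (\<integral>\<^sup>+z. \<integral>\<^sup>+y. ennreal ((a z)\<^sup>2) * ennreal (gauss \<epsilon> (x - z - y)) \<partial>lborel \<partial>lborel)
      + (\<integral>\<^sup>+z. \<integral>\<^sup>+y. ennreal ((b y)\<^sup>2) * ennreal (gauss \<epsilon> (x - z - y)) \<partial>lborel \<partial>lborel)"
    by (subst nn_integral_add[symmetric]) (auto simp: nn_integral_add)
  also have "(\<integral>\<^sup>+z. \<integral>\<^sup>+y. ennreal ((b y)\<^sup>2) * ennreal (gauss \<epsilon> (x - z - y)) \<partial>lborel \<partial>lborel)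
      = (\<integral>\<^sup>+y. \<integral>\<^sup>+z. ennreal ((b y)\<^sup>2) * ennreal (gauss \<epsilon> ((x - y) - z)) \<partial>lborel \<partial>lborel)"
    by (subst lborel_pair.Fubini') (auto simp: algebra_simps)
  finally show ?thesis by (simp add: nn_integral_cmult g1)
qed

lemma fourier_cnj_reflect:
  fixes u :: "real ^ 'n \<Rightarrow> complex"
  shows "fourier (\<lambda>y. cnj (u (- y))) \<xi> = cnj (fourier u \<xi>)"
proof -
  have "fourier (\<lambda>y. cnj (u (- y))) \<xi> = (LBINT y. cnj (u y) * cis (\<xi> \<bullet> y))"
    unfolding fourier_def
    using lborel_integral_reflect[of "\<lambda>y. cnj (u y) * cis (\<xi> \<bullet> y)" 0] by simp
  also have "\<dots> = (LBINT y. cnj (u y * cis (- (\<xi> \<bullet> y))))"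
    by (simp add: cis_cnj)
  also have "\<dots> = cnj (fourier u \<xi>)" unfolding fourier_def by (rule Bochner_Integration.integral_cnj)
  finally show ?thesis .
qed

text \<open>
  For the damped integral the inequality follows from \<open>fourier_product_regularised\<close> and
  \<open>young_gauss\<close>; Fatou's lemma removes the damping.
\<close>

lemma plancherel_le:
  fixes u :: "real ^ 'n \<Rightarrow> complex"
  assumes u: "integrable lborel u" and u2: "integrable lborel (\<lambda>x. (norm (u x))\<^sup>2)"
  shows "(\<integral>\<^sup>+\<xi>. ennreal ((norm (fourier u \<xi>))\<^sup>2) \<partial>lborel)
     \<le> ennreal ((2 * pi) ^ CARD('n) * (LBINT x. (norm (u x))\<^sup>2))"
proof -
  have [measurable]: "u \<in> borel_measurable borel" using u by auto
  define v where "v y = cnj (u (- y))" for y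
  have v: "integrable lborel v"
    using lborel_integrable_reflect_iff[of u 0] u unfolding v_def by simp
  have [measurable]: "v \<in> borel_measurable borel" using v by auto
  let ?I = "LBINT x. (norm (u x))\<^sup>2" and ?c = "(2 * pi) ^ CARD('n)"
  have nnI: "(\<integral>\<^sup>+x. ennreal ((norm (u x))\<^sup>2) \<partial>lborel) = ennreal ?I"
    by (rule nn_integral_eq_integral[OF u2]) simp
  have nnv: "(\<integral>\<^sup>+x. ennreal ((norm (v x))\<^sup>2) \<partial>lborel) = ennreal ?I"
    using nn_integral_lborel_reflect[of "\<lambda>x. ennreal ((norm (u x))\<^sup>2)" 0] nnI unfolding v_def by simp
  have bound: "(\<integral>\<^sup>+\<xi>. ennreal ((norm (fourier u \<xi>))\<^sup>2 * exp (- (\<epsilon> * norm \<xi>)\<^sup>2 / 2)) \<partial>lborel) \<le> ennreal (?c * ?I)"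
    if e: "\<epsilon> > 0" for \<epsilon>
  proof -
    have di: "integrable lborel (damp \<epsilon> :: real^'n \<Rightarrow> complex)"
      using fourier_gauss(1)[OF e, of 0] by simp
    let ?J = "(LBINT z. u z * (LBINT y. v y * gauss \<epsilon> (0 - z - y)))"
    let ?w = "\<lambda>\<xi>. (norm (fourier u \<xi>))\<^sup>2 * exp (- (\<epsilon> * norm \<xi>)\<^sup>2 / 2)"
    have w: "integrable lborel ?w"
    proof (rule Bochner_Integration.integrable_bound)
      show "integrable lborel (\<lambda>\<xi>::real^'n. (LBINT z. norm (u z))\<^sup>2 * norm (damp \<epsilon> \<xi>))"
        using di by auto
      show "AE \<xi> in lborel. norm (?w \<xi>) \<le> norm ((LBINT z. norm (u z))\<^sup>2 * norm (damp \<epsilon> \<xi>))"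
        by (auto simp: damp_def intro!: mult_right_mono power_mono norm_fourier_le)
    qed measurable
    have "complex_of_real (LBINT \<xi>. ?w \<xi>) = (LBINT \<xi>. complex_of_real (?w \<xi>))"
      by (rule integral_complex_of_real[symmetric])
    also have "\<dots> = (LBINT \<xi>. fourier u \<xi> * fourier v \<xi> * cis (\<xi> \<bullet> 0) * damp \<epsilon> \<xi>)"
      unfolding v_def fourier_cnj_reflect damp_def complex_norm_square[symmetric] of_real_power[symmetric] by simp
    also have "\<dots> = ?c * ?J"
      using fourier_product_regularised[OF u v e, of 0] by simp
    finally have "norm (complex_of_real (LBINT \<xi>. ?w \<xi>)) = ?c * norm ?J"
      by (simp only: norm_mult norm_of_real) simp
    then have eq: "(LBINT \<xi>. ?w \<xi>) = ?c * norm ?J"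
      by (simp add: integral_nonneg_AE)
    have "ennreal (norm ?J)
      \<le> (\<integral>\<^sup>+z. ennreal (norm (u z * (LBINT y. v y * gauss \<epsilon> (0 - z - y)))) \<partial>lborel)"
      by (rule norm_integral_le_nn_integral)
    also have "\<dots> \<le> (\<integral>\<^sup>+z. \<integral>\<^sup>+y. ennreal (norm (u z) * (norm (v y) * gauss \<epsilon> (0 - z - y))) \<partial>lborel \<partial>lborel)"
    proof (rule nn_integral_mono)
      fix z
      have "ennreal (norm (u z * (LBINT y. v y * gauss \<epsilon> (0 - z - y))))
        \<le> ennreal (norm (u z)) * (\<integral>\<^sup>+y. ennreal (norm (v y * gauss \<epsilon> (0 - z - y))) \<partial>lborel)"
        unfolding norm_mult[of "u z"] ennreal_mult''[OF norm_ge_zero]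
        by (rule mult_left_mono[OF norm_integral_le_nn_integral]) simp
      also have "\<dots> = (\<integral>\<^sup>+y. ennreal (norm (u z) * (norm (v y) * gauss \<epsilon> (0 - z - y))) \<partial>lborel)"
        by (subst nn_integral_cmult[symmetric]) (auto simp: norm_mult gauss_nonneg ennreal_mult')
      finally show "ennreal (norm (u z * (LBINT y. v y * gauss \<epsilon> (0 - z - y))))
        \<le> (\<integral>\<^sup>+y. ennreal (norm (u z) * (norm (v y) * gauss \<epsilon> (0 - z - y))) \<partial>lborel)" .
    qed
    finally have "2 * ennreal (norm ?J)
      \<le> 2 * (\<integral>\<^sup>+z. \<integral>\<^sup>+y. ennreal (norm (u z) * (norm (v y) * gauss \<epsilon> (0 - z - y))) \<partial>lborel \<partial>lborel)"
      by (rule mult_left_mono) simp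
    also have "\<dots> \<le> ennreal ?I + ennreal ?I"
      using young_gauss[OF _ _ e, of "\<lambda>z. norm (u z)" "\<lambda>z. norm (v z)" 0] unfolding nnI nnv by simp
    finally have "ennreal (2 * norm ?J) \<le> ennreal (?I + ?I)"
      by (subst ennreal_plus) (auto simp: ennreal_mult' integral_nonneg_AE)
    then have "norm ?J \<le> ?I"
      by (subst (asm) ennreal_le_iff) (auto simp: integral_nonneg_AE)
    then have "(LBINT \<xi>. ?w \<xi>) \<le> ?c * ?I" unfolding eq by (rule mult_left_mono) simp
    then show ?thesis
      by (subst nn_integral_eq_integral[OF w]) (auto intro: ennreal_leI)
  qed
  let ?w = "\<lambda>k \<xi>. ennreal ((norm (fourier u \<xi>))\<^sup>2 * exp (- (1 / real (Suc k) * norm \<xi>)\<^sup>2 / 2))"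
  have lim: "(\<lambda>k. ?w k \<xi>) \<longlonglongrightarrow> ennreal ((norm (fourier u \<xi>))\<^sup>2)" for \<xi>
  proof -
    have "(\<lambda>k. (norm (fourier u \<xi>))\<^sup>2 * exp (- (1 / real (Suc k) * norm \<xi>)\<^sup>2 / 2))
       \<longlonglongrightarrow> (norm (fourier u \<xi>))\<^sup>2 * exp (- (0 * norm \<xi>)\<^sup>2 / 2)"
      by (intro tendsto_intros LIMSEQ_Suc[OF lim_1_over_n]) simp
    then show ?thesis by (intro tendsto_ennrealI) simp
  qed
  have "(\<integral>\<^sup>+\<xi>. ennreal ((norm (fourier u \<xi>))\<^sup>2) \<partial>lborel) = (\<integral>\<^sup>+\<xi>. liminf (\<lambda>k. ?w k \<xi>) \<partial>lborel)"
    using lim_imp_Liminf[OF sequentially_bot lim] by simp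
  also have "\<dots> \<le> liminf (\<lambda>k. \<integral>\<^sup>+\<xi>. ?w k \<xi> \<partial>lborel)"
    by (rule nn_integral_liminf) measurable
  also have "\<dots> \<le> limsup (\<lambda>k. \<integral>\<^sup>+\<xi>. ?w k \<xi> \<partial>lborel)"
    by (rule Liminf_le_Limsup) simp
  also have "\<dots> \<le> ennreal (?c * ?I)"
    by (rule Limsup_bounded) (intro always_eventually allI bound, simp)
  finally show ?thesis .
qed

section \<open>Functions with bounded Wiener norm\<close>

text \<open>
  The norm of \<open>F\<close> in the Wiener algebra, the \<open>L\<^sub>1\<close> norm of its preimage \<open>g\<close>, is at most \<open>C\<close>.
\<close>

definition Wiener_norm_le :: "(real ^ 'n \<Rightarrow> complex) \<Rightarrow> real \<Rightarrow> bool" where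
  "Wiener_norm_le F C \<longleftrightarrow> (\<exists>g. integrable lborel g \<and> (LBINT x. norm (g x)) \<le> C \<and>
      (\<forall>y. F y = (LBINT x. g x * cis (x \<bullet> y))))"

lemma Wiener_norm_le_imp_Wiener_algebra:
  assumes "Wiener_norm_le F C" shows "F \<in> Wiener_algebra"
proof -
  from assms obtain g where g: "integrable lborel g" and F: "\<And>y. F y = (LBINT x. g x * cis (x \<bullet> y))"
    unfolding Wiener_norm_le_def by auto
  have [measurable]: "g \<in> borel_measurable borel" using g by auto
  have "F y = (LINT x|lebesgue. g x * exp (\<i> * complex_of_real (x \<bullet> y)))" for y
    unfolding F cis_conv_exp by (rule integral_completion[symmetric]) measurable
  moreover have "integrable lebesgue g" using g by (simp add: integrable_completion)
  ultimately show ?thesis unfolding Wiener_algebra_def by blast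
qed

lemma Wiener_norm_le_mono: "Wiener_norm_le F C \<Longrightarrow> C \<le> C' \<Longrightarrow> Wiener_norm_le F C'"
  unfolding Wiener_norm_le_def by force

text \<open>
  Completeness of \<open>L\<^sub>1\<close>, in the form in which it is used: pieces with summable norms may be
  added, and the pointwise sum of the pieces is the transform of the sum of their preimages.
\<close>

lemma Wiener_norm_le_sums:
  fixes F :: "nat \<Rightarrow> real ^ 'n \<Rightarrow> complex"
  assumes F: "\<And>k. Wiener_norm_le (F k) (C k)" and C: "C sums c" and G: "\<And>y. (\<lambda>k. F k y) sums G y"
  shows "Wiener_norm_le G c"
proof -
  obtain g where g: "\<And>k. integrable lborel (g k)" and gC: "\<And>k. (LBINT x. norm (g k x)) \<le> C k"
     and Fg: "\<And>k y. F k y = (LBINT x. g k x * cis (x \<bullet> y))"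
  proof -
    have "\<forall>k. \<exists>g. integrable lborel g \<and> (LBINT x. norm (g x)) \<le> C k \<and>
        (\<forall>y. F k y = (LBINT x. g x * cis (x \<bullet> y)))"
      using F unfolding Wiener_norm_le_def by blast
    then obtain g where "\<forall>k. integrable lborel (g k) \<and> (LBINT x. norm (g k x)) \<le> C k \<and>
        (\<forall>y. F k y = (LBINT x. g k x * cis (x \<bullet> y)))"
      by (rule choice[THEN exE])
    then show ?thesis by (intro that) auto
  qed
  have m[measurable]: "g k \<in> borel_measurable borel" for k using g[of k] by auto
  have sumC: "summable C" using C by (rule sums_summable)
  have sumn: "summable (\<lambda>k. LBINT x. norm (g k x))"
    by (rule summable_comparison_test'[OF sumC, of 0]) (use gC in \<open>auto simp: integral_nonneg_AE\<close>)
  have "(\<integral>\<^sup>+x. (\<Sum>k. ennreal (norm (g k x))) \<partial>lborel) = (\<Sum>k. \<integral>\<^sup>+x. ennreal (norm (g k x)) \<partial>lborel)"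
    by (rule nn_integral_suminf) measurable
  also have "\<dots> = (\<Sum>k. ennreal (LBINT x. norm (g k x)))"
    by (intro suminf_cong nn_integral_eq_integral integrable_norm g) simp
  also have "\<dots> \<noteq> \<infinity>"
    using sumn by (simp add: suminf_ennreal2 integral_nonneg_AE)
  finally have "AE x in lborel. (\<Sum>k. ennreal (norm (g k x))) \<noteq> \<infinity>"
    by (intro nn_integral_PInf_AE) auto
  then have ae: "AE x in lborel. summable (\<lambda>k. norm (g k x))"
    by eventually_elim (auto intro: summable_suminf_not_top)
  let ?g = "\<lambda>x. \<Sum>k. g k x"
  have int: "integrable lborel ?g"
    by (rule integrable_suminf[OF g ae sumn])
  have "Wiener_norm_le G (\<Sum>k. C k)"
    unfolding Wiener_norm_le_def
  proof (intro exI[of _ ?g] conjI allI int)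
    have "norm (?g x) \<le> (\<Sum>k. norm (g k x))" if "summable (\<lambda>k. norm (g k x))" for x
      by (rule summable_norm[OF that])
    then have ae2: "AE x in lborel. norm (?g x) \<le> (\<Sum>k. norm (g k x))"
      using ae by auto
    have ae': "AE x in lborel. summable (\<lambda>k. norm (norm (g k x)))"
      and sumn': "summable (\<lambda>k. LBINT x. norm (norm (g k x)))"
      using ae sumn by auto
    have "(LBINT x. norm (?g x)) \<le> (LBINT x. (\<Sum>k. norm (g k x)))"
      by (intro integral_mono_AE integrable_norm int ae2 integrable_suminf[OF integrable_norm[OF g] ae' sumn'])
    also have "\<dots> = (\<Sum>k. LBINT x. norm (g k x))"
      by (rule integral_suminf[OF integrable_norm[OF g] ae' sumn'])
    also have "\<dots> \<le> (\<Sum>k. C k)" by (rule suminf_le[OF gC sumn sumC])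
    finally show "(LBINT x. norm (?g x)) \<le> (\<Sum>k. C k)" .
    fix y
    have gc: "integrable lborel (\<lambda>x. g k x * cis (x \<bullet> y))" for k
      by (rule integrable_mult_cis[OF g]) measurable
    have "(LBINT x. (\<Sum>k. g k x * cis (x \<bullet> y))) = (\<Sum>k. F k y)"
      unfolding Fg by (rule integral_suminf[OF gc]) (use ae sumn in \<open>auto simp: norm_mult\<close>)
    also have "\<dots> = G y" using G[of y] by (simp add: sums_iff)
    finally have "G y = (LBINT x. (\<Sum>k. g k x * cis (x \<bullet> y)))" ..
    also have "\<dots> = (LBINT x. ?g x * cis (x \<bullet> y))"
    proof (rule integral_cong_AE)
      show "AE x in lborel. (\<Sum>k. g k x * cis (x \<bullet> y)) = ?g x * cis (x \<bullet> y)"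
        using ae by eventually_elim (simp add: suminf_mult2[symmetric] summable_norm_cancel)
    qed measurable
    finally show "G y = (LBINT x. ?g x * cis (x \<bullet> y))" .
  qed
  then show ?thesis using C by (simp add: sums_iff)
qed

lemma Wiener_norm_le_0: "Wiener_norm_le (\<lambda>_. 0) 0"
  unfolding Wiener_norm_le_def by (intro exI[of _ "\<lambda>_. 0"]) auto

lemma Wiener_norm_le_add:
  assumes "Wiener_norm_le F C" "Wiener_norm_le F' C'"
  shows "Wiener_norm_le (\<lambda>x. F x + F' x) (C + C')"
proof -
  have s: "(\<lambda>k::nat. if k = 0 then a else if k = 1 then b else 0) sums (a + b)" for a b :: "'b::real_normed_vector"
  proof -
    have "(\<lambda>k::nat. if k = 0 then a else if k = 1 then b else 0) sums (\<Sum>k<(2::nat). if k = 0 then a else if k = 1 then b else 0)"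
      by (rule sums_finite) auto
    then show ?thesis by (simp add: numeral_2_eq_2)
  qed
  show ?thesis
  proof (rule Wiener_norm_le_sums[of "\<lambda>k x. if k = 0 then F x else if k = 1 then F' x else 0"
        "\<lambda>k. if k = 0 then C else if k = 1 then C' else 0"])
    show "Wiener_norm_le (\<lambda>x. if k = 0 then F x else if k = 1 then F' x else 0)
       (if k = 0 then C else if k = 1 then C' else 0)" for k :: nat
      using assms Wiener_norm_le_0 by auto
  qed (rule s)+
qed

lemma Wiener_norm_le_sum:
  assumes "finite S" "\<And>s. s \<in> S \<Longrightarrow> Wiener_norm_le (F s) (C s)"
  shows "Wiener_norm_le (\<lambda>x. \<Sum>s\<in>S. F s x) (\<Sum>s\<in>S. C s)"
  using assms by (induction S rule: finite_induct) (auto intro: Wiener_norm_le_0 Wiener_norm_le_add)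

text \<open>
  The preimage is \<open>fourier v * fourier u / (2 * pi) ^ n\<close>.  Its \<open>L\<^sub>1\<close> norm is bounded by
  Cauchy-Schwarz and Plancherel, and letting \<open>\<epsilon>\<close> tend to \<open>0\<close> in \<open>fourier_product_regularised\<close> shows
  that it represents the convolution; continuity of \<open>u\<close> makes this hold at every point.
\<close>

lemma Wiener_norm_le_convolution:
  fixes u v :: "real ^ 'n \<Rightarrow> complex"
  assumes cont: "continuous_on UNIV u" and bdd: "\<And>x. norm (u x) \<le> B" and u: "integrable lborel u"
    and v: "integrable lborel v" and v2: "integrable lborel (\<lambda>x. (norm (v x))\<^sup>2)"
  shows "Wiener_norm_le (\<lambda>x. LBINT z. v z * u (x - z))
    (sqrt (LBINT x. (norm (u x))\<^sup>2) * sqrt (LBINT x. (norm (v x))\<^sup>2))"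
proof -
  have [measurable]: "u \<in> borel_measurable borel" "v \<in> borel_measurable borel" using u v by auto
  have u2: "integrable lborel (\<lambda>x. (norm (u x))\<^sup>2)"
  proof (rule Bochner_Integration.integrable_bound)
    show "integrable lborel (\<lambda>x. B * norm (u x))" using u by auto
    show "AE x in lborel. norm ((norm (u x))\<^sup>2) \<le> norm (B * norm (u x))"
    proof (rule AE_I2)
      fix x
      have "norm (u x) * norm (u x) \<le> B * norm (u x)" by (intro mult_right_mono bdd) simp
      then show "norm ((norm (u x))\<^sup>2) \<le> norm (B * norm (u x))" by (simp add: power2_eq_square)
    qed
  qed measurable
  let ?U = "LBINT x. (norm (u x))\<^sup>2" and ?V = "LBINT x. (norm (v x))\<^sup>2" and ?c = "(2 * pi) ^ CARD('n)"
  have c: "?c > 0" by simp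
  have UV: "?U \<ge> 0" "?V \<ge> 0" by (auto simp: integral_nonneg_AE)
  let ?p = "\<lambda>\<xi>. fourier v \<xi> * fourier u \<xi>"
  define S where "S = (\<integral>\<^sup>+\<xi>. ennreal (norm (?p \<xi>)) \<partial>lborel)"
  have "S = (\<integral>\<^sup>+\<xi>. ennreal (norm (fourier v \<xi>)) * ennreal (norm (fourier u \<xi>)) \<partial>lborel)"
    unfolding S_def by (simp add: norm_mult ennreal_mult)
  then have "S\<^sup>2 \<le> (\<integral>\<^sup>+\<xi>. ennreal (norm (fourier v \<xi>)) ^ 2 \<partial>lborel) * (\<integral>\<^sup>+\<xi>. ennreal (norm (fourier u \<xi>)) ^ 2 \<partial>lborel)"
    using Cauchy_Schwarz_nn_integral[of "\<lambda>\<xi>. ennreal (norm (fourier v \<xi>))" lborel "\<lambda>\<xi>. ennreal (norm (fourier u \<xi>))"] by simp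
  also have "\<dots> \<le> ennreal (?c * ?V) * ennreal (?c * ?U)"
    unfolding ennreal_power[OF norm_ge_zero] by (intro mult_mono plancherel_le u u2 v v2) auto
  also have "\<dots> = ennreal ((?c * (sqrt ?U * sqrt ?V))\<^sup>2)"
    using UV by (simp add: ennreal_mult'[symmetric] power_mult_distrib power2_eq_square mult_ac)
  finally have S2: "S\<^sup>2 \<le> ennreal ((?c * (sqrt ?U * sqrt ?V))\<^sup>2)" .
  then have "S \<noteq> \<infinity>" by (auto simp: power2_eq_square top_unique)
  then obtain s where s: "S = ennreal s" "s \<ge> 0" by (cases S) auto
  from S2 have "s\<^sup>2 \<le> (?c * (sqrt ?U * sqrt ?V))\<^sup>2"
    using s by (simp add: ennreal_power)
  then have sle: "s \<le> ?c * (sqrt ?U * sqrt ?V)"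
    by (rule power2_le_imp_le) (use UV in auto)
  have p: "integrable lborel ?p"
    using \<open>S \<noteq> \<infinity>\<close> unfolding S_def by (intro integrableI_bounded) (auto simp: less_top)
  have pn: "(LBINT \<xi>. norm (?p \<xi>)) \<le> ?c * (sqrt ?U * sqrt ?V)"
    using sle s nn_integral_eq_integral[OF integrable_norm[OF p]] unfolding S_def
    by (simp add: integral_nonneg_AE)
  show ?thesis unfolding Wiener_norm_le_def
  proof (intro exI[of _ "\<lambda>\<xi>. ?p \<xi> / complex_of_real ?c"] conjI allI)
    show "integrable lborel (\<lambda>\<xi>. ?p \<xi> / complex_of_real ?c)" using p by simp
    show "(LBINT \<xi>. norm (?p \<xi> / complex_of_real ?c)) \<le> sqrt ?U * sqrt ?V"
      using pn c
      by (simp only: norm_divide norm_of_real abs_of_pos[OF c]) (simp add: divide_le_eq mult.commute)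
    fix x
    let ?e = "\<lambda>k. 1 / real (Suc k)"
    have l1: "(\<lambda>k. LBINT \<xi>. ?p \<xi> * cis (\<xi> \<bullet> x) * damp (?e k) \<xi>) \<longlonglongrightarrow> (LBINT \<xi>. ?p \<xi> * cis (\<xi> \<bullet> x))"
    proof (rule integral_dominated_convergence[where w = "\<lambda>\<xi>. norm (?p \<xi>)"])
      show "integrable lborel (\<lambda>\<xi>. norm (?p \<xi>))" using p by auto
      show "AE \<xi> in lborel. norm (?p \<xi> * cis (\<xi> \<bullet> x) * damp (?e k) \<xi>) \<le> norm (?p \<xi>)" for k
        by (rule AE_I2) (simp add: norm_mult mult_left_le norm_damp)
      have "(\<lambda>k. damp (?e k) \<xi>) \<longlonglongrightarrow> complex_of_real (exp (- (0 * norm \<xi>)\<^sup>2 / 2))" for \<xi>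
        unfolding damp_def by (intro tendsto_intros LIMSEQ_Suc[OF lim_1_over_n]) simp
      from tendsto_mult[OF tendsto_const this]
      show "AE \<xi> in lborel. (\<lambda>k. ?p \<xi> * cis (\<xi> \<bullet> x) * damp (?e k) \<xi>) \<longlonglongrightarrow> ?p \<xi> * cis (\<xi> \<bullet> x)"
        by (intro AE_I2) simp
    qed measurable
    have "(\<lambda>k. LBINT z. v z * (LBINT y. u y * gauss (?e k) (x - z - y))) \<longlonglongrightarrow> (LBINT z. v z * u (x - z))"
    proof (rule integral_dominated_convergence[where w = "\<lambda>z. B * norm (v z)"])
      show "integrable lborel (\<lambda>z. B * norm (v z))" using v by auto
      have flip: "(LBINT y. u y * gauss (?e k) (w - y)) = (LBINT t. u (w - t) * gauss (?e k) t)" for k w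
        using lborel_integral_reflect[of "\<lambda>y. u y * gauss (?e k) (w - y)" w] by simp
      show "AE z in lborel. (\<lambda>k. v z * (LBINT y. u y * gauss (?e k) (x - z - y))) \<longlonglongrightarrow> v z * u (x - z)"
        unfolding flip by (intro AE_I2 tendsto_intros gauss_approximate_identity[OF cont bdd])
      show "AE z in lborel. norm (v z * (LBINT y. u y * gauss (?e k) (x - z - y))) \<le> B * norm (v z)" for k
      proof (rule AE_I2)
        fix z
        have gi: "integrable lborel (gauss (?e k) :: real^'n \<Rightarrow> real)" and g1: "(LBINT t. gauss (?e k) (t::real^'n)) = 1"
          by (auto intro: integrable_gauss integral_gauss)
        have "norm (LBINT y. u y * gauss (?e k) (x - z - y)) \<le> (LBINT t. norm (u (x - z - t) * gauss (?e k) t))"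
          unfolding flip by (rule integral_norm_bound)
        also have "\<dots> \<le> (LBINT t. B * gauss (?e k) (t::real^'n))"
        proof (rule integral_mono)
          have le: "norm (u (x - z - t) * gauss (?e k) t) \<le> B * gauss (?e k) t" for t
            by (auto simp: norm_mult gauss_nonneg intro!: mult_right_mono bdd)
          show "norm (u (x - z - t) * gauss (?e k) t) \<le> B * gauss (?e k) t" for t by (rule le)
          show i: "integrable lborel (\<lambda>t::real^'n. B * gauss (?e k) t)" using gi by auto
          show "integrable lborel (\<lambda>t. norm (u (x - z - t) * gauss (?e k) t))"
            by (rule Bochner_Integration.integrable_bound[OF i]) (use le in \<open>auto intro: order_trans[OF _ abs_ge_self]\<close>)
        qed
        also have "\<dots> = B" using g1 by simp
        finally show "norm (v z * (LBINT y. u y * gauss (?e k) (x - z - y))) \<le> B * norm (v z)"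
          unfolding norm_mult mult.commute[of B] by (rule mult_left_mono) simp
      qed
    qed measurable
    then have "(\<lambda>k. complex_of_real ?c * (LBINT z. v z * (LBINT y. u y * gauss (?e k) (x - z - y))))
        \<longlonglongrightarrow> complex_of_real ?c * (LBINT z. v z * u (x - z))"
      by (intro tendsto_intros)
    moreover have "complex_of_real ?c * (LBINT z. v z * (LBINT y. u y * gauss (?e k) (x - z - y)))
       = (LBINT \<xi>. ?p \<xi> * cis (\<xi> \<bullet> x) * damp (?e k) \<xi>)" for k
      using fourier_product_regularised[OF v u, of "?e k" x] by simp
    ultimately have "(\<lambda>k. LBINT \<xi>. ?p \<xi> * cis (\<xi> \<bullet> x) * damp (?e k) \<xi>)
        \<longlonglongrightarrow> complex_of_real ?c * (LBINT z. v z * u (x - z))" by (simp only:)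
    then have "(LBINT \<xi>. ?p \<xi> * cis (\<xi> \<bullet> x)) = complex_of_real ?c * (LBINT z. v z * u (x - z))"
      by (rule LIMSEQ_unique[OF l1])
    then show "(LBINT z. v z * u (x - z)) = (LBINT \<xi>. ?p \<xi> / complex_of_real ?c * cis (\<xi> \<bullet> x))"
      using c by (simp add: field_simps)
  qed
qed

definition cutoff :: "nat \<Rightarrow> real ^ 'n \<Rightarrow> real" where
  "cutoff n x = max 0 (min 1 (real n + 1 - norm x))"

lemma continuous_cutoff: "continuous_on S (cutoff n)"
  unfolding cutoff_def[abs_def] by (intro continuous_intros)

lemma cutoff_bounds: "0 \<le> cutoff n x" "cutoff n x \<le> 1"
  by (auto simp: cutoff_def)

lemma cutoff_eq_1: "norm x \<le> real n \<Longrightarrow> cutoff n x = 1"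
  by (auto simp: cutoff_def)

lemma cutoff_eq_0: "norm x \<ge> real n + 1 \<Longrightarrow> cutoff n x = 0"
  by (auto simp: cutoff_def)

text \<open>
  The difference \<open>\<Delta>\<^sub>h f\<close> is in \<open>L\<^sub>2\<close> but in general not in \<open>L\<^sub>1\<close>, so the previous lemma is applied to
  pieces \<open>w k\<close> of \<open>u\<close> cut out by differences of continuous cutoffs.  The cutoff radii grow so fast that the
  norms of the pieces decrease geometrically; summing the geometric series costs the factor \<open>4\<close>.
\<close>

lemma Wiener_norm_le_convolution_L2:
  fixes u v :: "real ^ 'n \<Rightarrow> complex"
  assumes cont: "continuous_on UNIV u" and bdd: "\<And>x. norm (u x) \<le> B"
    and u2: "integrable lborel (\<lambda>x. (norm (u x))\<^sup>2)"
    and v: "integrable lborel v" and v2: "integrable lborel (\<lambda>x. (norm (v x))\<^sup>2)"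
  shows "Wiener_norm_le (\<lambda>x. LBINT z. v z * u (x - z))
    (4 * (sqrt (LBINT x. (norm (u x))\<^sup>2) * sqrt (LBINT x. (norm (v x))\<^sup>2)))"
proof -
  have [measurable]: "u \<in> borel_measurable borel" using cont by (rule borel_measurable_continuous_onI)
  have [measurable]: "v \<in> borel_measurable borel" using v by auto
  have [measurable]: "cutoff n \<in> borel_measurable borel" for n
    using continuous_cutoff by (rule borel_measurable_continuous_onI)
  let ?U = "LBINT x. (norm (u x))\<^sup>2" and ?V = "LBINT x. (norm (v x))\<^sup>2"
  have B: "B \<ge> 0" using bdd[of 0] norm_ge_zero[of "u 0"] by linarith
  have UV: "?U \<ge> 0" "?V \<ge> 0" by (auto simp: integral_nonneg_AE)
  define T where "T n = (LBINT x. (norm (u x))\<^sup>2 * indicator {x. real n \<le> norm x} x)" for n :: nat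
  have Tint: "integrable lborel (\<lambda>x. (norm (u x))\<^sup>2 * indicator {x. real n \<le> norm x} x)" for n
    by (rule integrable_real_mult_indicator[OF _ u2]) measurable
  have TU: "T n \<le> ?U" for n
    unfolding T_def by (intro integral_mono Tint u2) (auto simp: indicator_def)
  have "T \<longlonglongrightarrow> (\<integral>x. 0 \<partial>(lborel :: (real^'n) measure))"
    unfolding T_def
  proof (rule integral_dominated_convergence[where w = "\<lambda>x. (norm (u x))\<^sup>2"])
    show "AE x in lborel. (\<lambda>n. (norm (u x))\<^sup>2 * indicator {x. real n \<le> norm x} x) \<longlonglongrightarrow> 0"
    proof (rule AE_I2)
      fix x :: "real^'n"
      obtain N where N: "norm x < real N" using reals_Archimedean2 by blast
      have "eventually (\<lambda>n. (norm (u x))\<^sup>2 * indicator {x. real n \<le> norm x} x = 0) sequentially"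
        using eventually_ge_at_top[of N] by eventually_elim (use N in \<open>auto simp: indicator_def\<close>)
      then show "(\<lambda>n. (norm (u x))\<^sup>2 * indicator {x. real n \<le> norm x} x) \<longlonglongrightarrow> 0"
        by (rule tendsto_eventually)
    qed
  qed (auto intro!: u2 simp: indicator_def)
  then have T0: "T \<longlonglongrightarrow> 0" by simp
  \<comment> \<open>a radius \<open>n \<ge> k\<close> outside which \<open>u\<close> keeps at most the part \<open>4 ^ - k\<close> of its energy\<close>
  have "\<exists>n\<ge>k. T n \<le> (1/4) ^ k * ?U" for k
  proof (cases "?U = 0")
    case True then show ?thesis using TU[of k] by auto
  next
    case False
    then have "?U > 0" using UV(1) by linarith
    then have "(1/4) ^ k * ?U > 0" by (intro mult_pos_pos) auto
    then have "eventually (\<lambda>n. T n < (1/4) ^ k * ?U) sequentially"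
      using T0 by (simp add: order_tendstoD(2))
    then show ?thesis using eventually_ge_at_top[of k]
      by (metis (mono_tags, lifting) eventually_conj eventually_sequentially less_imp_le order_refl)
  qed
  then obtain N where Nk: "\<And>k. N k \<ge> k" and TN: "\<And>k. T (N k) \<le> (1/4) ^ k * ?U" by metis
  define w where "w k x = (case k of 0 \<Rightarrow> u x * cutoff (N 0) x | Suc k \<Rightarrow> u x * (cutoff (N (Suc k)) x - cutoff (N k) x))" for k x
  have wsum: "(\<Sum>i<Suc k. w i x) = u x * cutoff (N k) x" for k x
    by (induction k) (simp_all add: w_def algebra_simps)
  have wle: "norm (w k x) \<le> norm (u x)" for k x
  proof -
    have "\<bar>cutoff (N (Suc j)) x - cutoff (N j) x\<bar> \<le> 1" for j
      using cutoff_bounds[of "N (Suc j)" x] cutoff_bounds[of "N j" x] by linarith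
    then show ?thesis using cutoff_bounds[of "N 0" x]
      by (cases k) (auto simp: w_def norm_mult mult_left_le simp flip: of_real_diff)
  qed
  have wcont: "continuous_on UNIV (w k)" for k
    unfolding w_def[abs_def] by (cases k) (auto intro!: continuous_intros cont continuous_cutoff)
  have [measurable]: "w k \<in> borel_measurable borel" for k
    using wcont by (rule borel_measurable_continuous_onI)
  have wint: "integrable lborel (w k)" for k
  proof -
    define R where "R = real (N k) + real (N (k - 1)) + 1"
    have w0: "w k x = 0" if "norm x > R" for x
      using that by (cases k) (auto simp: w_def R_def cutoff_eq_0)
    show ?thesis
    proof (rule Bochner_Integration.integrable_bound)
      show "integrable lborel (\<lambda>x. B * indicator (cball (0::real^'n) R) x)"
        by (intro integrable_mult_right integrable_real_indicator) (auto intro: emeasure_bounded_finite[unfolded infinity_ennreal_def])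
      show "AE x in lborel. norm (w k x) \<le> norm (B * indicator (cball (0::real^'n) R) x)"
      proof (rule AE_I2)
        fix x
        show "norm (w k x) \<le> norm (B * indicator (cball (0::real^'n) R) x)"
          using w0[of x] order_trans[OF wle bdd, of k x] B by (cases "norm x > R") auto
      qed
    qed measurable
  qed
  have w2: "integrable lborel (\<lambda>x. (norm (w k x))\<^sup>2)" for k
    by (rule Bochner_Integration.integrable_bound[OF u2]) (auto intro!: power_mono wle)
  have wk: "(LBINT x. (norm (w k x))\<^sup>2) \<le> (2 * (1/2) ^ k)\<^sup>2 * ?U" for k
  proof (cases k)
    case 0
    have "(LBINT x. (norm (w k x))\<^sup>2) \<le> ?U"
      by (intro integral_mono w2 u2 power_mono wle) auto
    also have "\<dots> \<le> 4 * ?U" using UV(1) by linarith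
    finally show ?thesis using 0 by simp
  next
    case (Suc j)
    let ?m = "min (N j) (N (Suc j))"
    \<comment> \<open>the radii need not be monotone, but both cutoffs are \<open>1\<close> inside the smaller ball\<close>
    have "(norm (w k x))\<^sup>2 \<le> (norm (u x))\<^sup>2 * indicator {x. real ?m \<le> norm x} x" for x
    proof (cases "real ?m \<le> norm x")
      case True then show ?thesis using wle[of k x] by (simp add: power_mono)
    next
      case False
      then have "cutoff (N (Suc j)) x = 1" "cutoff (N j) x = 1"
        by (auto intro!: cutoff_eq_1)
      then show ?thesis by (simp add: w_def Suc)
    qed
    then have "(LBINT x. (norm (w k x))\<^sup>2) \<le> T ?m"
      unfolding T_def by (intro integral_mono w2 Tint)
    also have "\<dots> \<le> (1/4) ^ j * ?U"
    proof -
      have "(1/4) ^ Suc j * ?U \<le> (1/4) ^ j * ?U"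
        by (intro mult_right_mono power_decreasing UV) auto
      then have "T (N (Suc j)) \<le> (1/4) ^ j * ?U" using TN[of "Suc j"] by linarith
      then show ?thesis using TN[of j] by (cases "N j \<le> N (Suc j)") (auto simp only: min_def if_True if_False)
    qed
    also have "(1/4) ^ j = (2 * (1/2) ^ k :: real)\<^sup>2"
    proof -
      have "2 * (1/2) ^ k = ((1/2) ^ j :: real)" by (simp add: Suc)
      moreover have "((1/2) ^ j)\<^sup>2 = ((1/4) ^ j :: real)"
        by (simp only: power2_eq_square flip: power_mult_distrib) simp
      ultimately show ?thesis by simp
    qed
    finally show ?thesis .
  qed
  show ?thesis
  proof (rule Wiener_norm_le_sums)
    fix k
    have "sqrt (LBINT x. (norm (w k x))\<^sup>2) \<le> sqrt ((2 * (1/2) ^ k)\<^sup>2 * ?U)"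
      by (rule real_sqrt_le_mono[OF wk])
    also have "\<dots> = 2 * (1/2) ^ k * sqrt ?U" by (simp add: real_sqrt_mult)
    finally have "sqrt (LBINT x. (norm (w k x))\<^sup>2) * sqrt ?V \<le> 2 * (1/2) ^ k * sqrt ?U * sqrt ?V"
      by (rule mult_right_mono) (simp add: UV)
    then show "Wiener_norm_le (\<lambda>x. LBINT z. v z * w k (x - z)) ((1/2) ^ k * (2 * (sqrt ?U * sqrt ?V)))"
      by (intro Wiener_norm_le_mono[OF Wiener_norm_le_convolution[OF wcont order_trans[OF wle bdd] wint v v2]]) (simp add: mult_ac)
  next
    show "(\<lambda>k. (1/2) ^ k * (2 * (sqrt ?U * sqrt ?V))) sums (4 * (sqrt ?U * sqrt ?V))"
      using sums_mult2[OF geometric_sums[of "1/2::real"], of "2 * (sqrt ?U * sqrt ?V)"] by simp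
  next
    fix x
    have vi: "integrable lborel (\<lambda>z. v z * w k (x - z))" for k
    proof (rule Bochner_Integration.integrable_bound)
      show "integrable lborel (\<lambda>z. B * norm (v z))" using v by auto
      show "AE z in lborel. norm (v z * w k (x - z)) \<le> norm (B * norm (v z))"
        using order_trans[OF wle bdd] B by (intro AE_I2) (simp add: norm_mult mult.commute[of B] mult_left_mono)
    qed measurable
    have eq: "(\<Sum>i<Suc k. LBINT z. v z * w i (x - z)) = (LBINT z. v z * (u (x - z) * cutoff (N k) (x - z)))" for k
      unfolding wsum[symmetric] sum_distrib_left by (rule Bochner_Integration.integral_sum[symmetric]) (rule vi)
    have "(\<lambda>k. LBINT z. v z * (u (x - z) * cutoff (N k) (x - z))) \<longlonglongrightarrow> (LBINT z. v z * u (x - z))"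
    proof (rule integral_dominated_convergence[where w = "\<lambda>z. B * norm (v z)"])
      show "integrable lborel (\<lambda>z. B * norm (v z))" using v by auto
      show "AE z in lborel. norm (v z * (u (x - z) * cutoff (N k) (x - z))) \<le> B * norm (v z)" for k
      proof (rule AE_I2)
        fix z
        have "norm (u (x - z)) * \<bar>cutoff (N k) (x - z)\<bar> \<le> B * 1"
          using cutoff_bounds[of "N k" "x - z"] B by (intro mult_mono bdd) auto
        then show "norm (v z * (u (x - z) * cutoff (N k) (x - z))) \<le> B * norm (v z)"
          by (simp add: norm_mult mult.commute[of B] mult_left_mono)
      qed
      show "AE z in lborel. (\<lambda>k. v z * (u (x - z) * cutoff (N k) (x - z))) \<longlonglongrightarrow> v z * u (x - z)"
      proof (rule AE_I2)
        fix z
        obtain M where M: "norm (x - z) < real M" using reals_Archimedean2 by blast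
        have "eventually (\<lambda>k. v z * (u (x - z) * cutoff (N k) (x - z)) = v z * u (x - z)) sequentially"
          using eventually_ge_at_top[of M]
        proof eventually_elim
          case (elim k)
          have "norm (x - z) \<le> real (N k)" using M elim Nk[of k] by linarith
          then show ?case by (simp add: cutoff_eq_1)
        qed
        then show "(\<lambda>k. v z * (u (x - z) * cutoff (N k) (x - z))) \<longlonglongrightarrow> v z * u (x - z)"
          by (rule tendsto_eventually)
      qed
    qed measurable
    then have "(\<lambda>k. \<Sum>i<Suc k. LBINT z. v z * w i (x - z)) \<longlonglongrightarrow> (LBINT z. v z * u (x - z))"
      by (simp only: eq)
    then show "(\<lambda>k. LBINT z. v z * w k (x - z)) sums (LBINT z. v z * u (x - z))"
      unfolding sums_def by (rule LIMSEQ_imp_Suc)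
  qed
qed

section \<open>Mixed differences and Bernstein's criterion\<close>

definition corner :: "('n \<Rightarrow> real) \<Rightarrow> 'n set \<Rightarrow> real ^ 'n" where
  "corner h T = (\<chi> j. if j \<in> T then h j else 0)"

definition mixed_diff :: "('n \<Rightarrow> real) \<Rightarrow> 'n set \<Rightarrow> (real ^ 'n \<Rightarrow> complex) \<Rightarrow> real ^ 'n \<Rightarrow> complex" where
  "mixed_diff h S f x = (\<Sum>T\<in>Pow S. (-1) ^ card T * f (x - corner h T))"

lemma corner_empty [simp]: "corner h {} = 0"
  by (simp add: corner_def vec_eq_iff)

lemma corner_insert: "j \<notin> T \<Longrightarrow> corner h (insert j T) = corner h T + axis j (h j)"
  by (auto simp: corner_def vec_eq_iff axis_def)

lemma mixed_diff_empty [simp]: "mixed_diff h {} f x = f x"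
  by (simp add: mixed_diff_def)

lemma mixed_diff_insert:
  fixes S :: "'n::finite set"
  assumes "j \<notin> S"
  shows "mixed_diff h (insert j S) f x = mixed_diff h S f x - mixed_diff h S f (x - axis j (h j))"
proof -
  have inj: "inj_on (insert j) (Pow S)" using assms by (auto simp: inj_on_def)
  have "mixed_diff h (insert j S) f x = mixed_diff h S f x + (\<Sum>T\<in>insert j ` Pow S. (-1) ^ card T * f (x - corner h T))"
    unfolding mixed_diff_def Pow_insert using assms by (subst sum.union_disjoint) auto
  also have "(\<Sum>T\<in>insert j ` Pow S. (-1) ^ card T * f (x - corner h T))
      = (\<Sum>T\<in>Pow S. - ((-1) ^ card T * f (x - axis j (h j) - corner h T)))"
    unfolding sum.reindex[OF inj] o_def
  proof (rule sum.cong[OF refl])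
    fix T assume "T \<in> Pow S"
    then have T: "j \<notin> T" using assms by auto
    show "(-1) ^ card (insert j T) * f (x - corner h (insert j T)) = - ((-1) ^ card T * f (x - axis j (h j) - corner h T))"
      using T by (simp add: corner_insert algebra_simps)
  qed
  also have "\<dots> = - mixed_diff h S f (x - axis j (h j))"
    by (simp add: mixed_diff_def sum_negf)
  finally show ?thesis by simp
qed

lemma continuous_mixed_diff:
  fixes f :: "real ^ 'n \<Rightarrow> complex"
  assumes "continuous_on UNIV f" shows "continuous_on UNIV (mixed_diff h S f)"
  unfolding mixed_diff_def[abs_def]
  by (intro continuous_intros continuous_on_compose2[OF assms]) auto

lemma norm_mixed_diff_le:
  fixes f :: "real ^ 'n \<Rightarrow> complex"
  assumes "\<And>x. norm (f x) \<le> B" shows "norm (mixed_diff h S f x) \<le> 2 ^ card S * B"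
proof -
  have "norm (mixed_diff h S f x) \<le> (\<Sum>T\<in>Pow S. norm ((-1) ^ card T * f (x - corner h T)))"
    unfolding mixed_diff_def by (rule norm_sum)
  also have "\<dots> \<le> (\<Sum>T\<in>Pow S. B)"
    by (intro sum_mono) (simp add: norm_mult norm_power assms)
  finally show ?thesis by (simp add: card_Pow)
qed

lemma C0_bounded:
  fixes f :: "real ^ 'n \<Rightarrow> complex"
  assumes "f \<in> C0"
  obtains B where "\<And>x. norm (f x) \<le> B"
proof -
  have cont: "continuous_on UNIV f" and lim: "(f \<longlongrightarrow> 0) at_infinity" using assms by (auto simp: C0_def)
  from lim have "eventually (\<lambda>x. norm (f x) < 1) at_infinity"
    using tendsto_norm_zero order_tendstoD(2) zero_less_one by blast
  then obtain R where R: "\<And>x. norm x \<ge> R \<Longrightarrow> norm (f x) < 1"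
    unfolding eventually_at_infinity by auto
  have "compact (f ` cball 0 R)"
    by (intro compact_continuous_image continuous_on_subset[OF cont]) auto
  then obtain B where B: "\<And>x. x \<in> cball 0 R \<Longrightarrow> norm (f x) \<le> B"
    using compact_imp_bounded bounded_iff by (metis image_eqI)
  show ?thesis
  proof (rule that[of "max B 1"])
    fix x show "norm (f x) \<le> max B 1"
      using R[of x] B[of x] by (cases "norm x \<ge> R") (auto simp: le_max_iff_disj)
  qed
qed

text \<open>
  The density of the uniform distribution on \<open>{0..<h}\<close>; convolution with it averages over an interval.
\<close>

definition avgk :: "real \<Rightarrow> real \<Rightarrow> real" where
  "avgk h t = indicator {0..<h} t / h"

lemma avgk_refine:
  assumes "h > 0"
  shows "avgk h t - avgk (2 * h) t = avgk h t / 2 - avgk h (t - h) / 2"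
  using assms by (auto simp: avgk_def indicator_def field_simps)

lemma measurable_avgk [measurable]: "avgk h \<in> borel_measurable borel"
  unfolding avgk_def[abs_def] by measurable

lemma integrable_avgk: "integrable lborel (avgk h)"
  unfolding avgk_def[abs_def] by (intro integrable_divide_zero integrable_real_indicator)
     (auto intro: emeasure_bounded_finite[unfolded infinity_ennreal_def])

lemma integrable_avgk_prod:
  "integrable lborel (\<lambda>y::real^'n. \<Prod>j\<in>UNIV. avgk (h j) (y $ j))"
  by (rule integrable_prod_vec) (rule integrable_avgk)

lemma integrable_mult_bounded:
  fixes V :: "real ^ 'n \<Rightarrow> real" and f :: "real ^ 'n \<Rightarrow> complex"
  assumes V: "integrable lborel V" and [measurable]: "f \<in> borel_measurable borel" and B: "\<And>x. norm (f x) \<le> B"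
  shows "integrable lborel (\<lambda>y. complex_of_real (V y) * f y)"
proof (rule Bochner_Integration.integrable_bound)
  have [measurable]: "V \<in> borel_measurable borel" using V by auto
  show "integrable lborel (\<lambda>y. B * norm (V y))" using V by auto
  have "0 \<le> B" using B[of 0] norm_ge_zero[of "f 0"] by linarith
  then show "AE y in lborel. norm (complex_of_real (V y) * f y) \<le> norm (B * norm (V y))"
    using B by (intro AE_I2) (auto simp: norm_mult mult.commute[of B] intro!: mult_left_mono)
  show "(\<lambda>y. complex_of_real (V y) * f y) \<in> borel_measurable lborel" by measurable
qed

text \<open>
  The one-dimensional kernel \<open>avgk h - avgk (2 * h)\<close> is half of \<open>avgk h\<close> minus its translate by \<open>h\<close>
  (a Haar function).  In the product over the coordinates the translations can be moved from the
  kernel to \<open>f\<close>, where they form the mixed difference.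
\<close>

lemma conv_haar_kernel:
  fixes f :: "real ^ 'n \<Rightarrow> complex"
  assumes cont: "continuous_on UNIV f" and B: "\<And>x. norm (f x) \<le> B" and h: "\<And>j. h j > 0"
  shows "(LBINT y. complex_of_real (\<Prod>j\<in>UNIV. avgk (h j) (y $ j) - avgk (2 * h j) (y $ j)) * f (x - y))
     = (LBINT y. complex_of_real (\<Prod>j\<in>UNIV. avgk (h j) (y $ j) / 2) * mixed_diff h UNIV f (x - y))"
proof -
  have [measurable]: "f \<in> borel_measurable borel" using cont by (rule borel_measurable_continuous_onI)
  define V where "V y = (\<Prod>j\<in>UNIV. avgk (h j) (y $ j) / 2)" for y :: "real ^ 'n"
  have Vint: "integrable lborel V"
    unfolding V_def by (rule integrable_prod_vec) (intro integrable_divide_zero integrable_avgk)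
  have exp: "(\<Prod>j\<in>UNIV. avgk (h j) (y $ j) - avgk (2 * h j) (y $ j)) = (\<Sum>T\<in>Pow UNIV. (-1) ^ card T * V (y - corner h T))" for y
  proof -
    have "(\<Prod>j\<in>UNIV. avgk (h j) (y $ j) - avgk (2 * h j) (y $ j))
      = (\<Prod>j\<in>UNIV. avgk (h j) (y $ j) / 2 - avgk (h j) (y $ j - h j) / 2)"
      by (simp add: avgk_refine h)
    also have "\<dots> = (\<Sum>T\<in>Pow UNIV. (-1) ^ card T * (\<Prod>j\<in>T. avgk (h j) (y $ j - h j) / 2) * (\<Prod>j\<in>UNIV-T. avgk (h j) (y $ j) / 2))"
      by (rule prod_diff_conv_sum) simp
    also have "\<dots> = (\<Sum>T\<in>Pow UNIV. (-1) ^ card T * V (y - corner h T))"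
    proof (rule sum.cong[OF refl])
      fix T :: "'n set"
      have "V (y - corner h T) = (\<Prod>j\<in>T. avgk (h j) ((y - corner h T) $ j) / 2) * (\<Prod>j\<in>UNIV-T. avgk (h j) ((y - corner h T) $ j) / 2)"
        unfolding V_def by (subst prod.subset_diff[of T]) (auto simp: mult.commute)
      then show "(-1) ^ card T * (\<Prod>j\<in>T. avgk (h j) (y $ j - h j) / 2) * (\<Prod>j\<in>UNIV-T. avgk (h j) (y $ j) / 2)
        = (-1) ^ card T * V (y - corner h T)"
        by (simp add: corner_def mult.assoc)
    qed
    finally show ?thesis .
  qed
  have int1: "integrable lborel (\<lambda>y. complex_of_real (V (y - corner h T)) * f (x - y))" for T
    by (rule integrable_mult_bounded[OF _ _ B])
       (use lborel_integrable_translate_iff[of V "- corner h T"] Vint in auto)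
  have int2: "integrable lborel (\<lambda>y. complex_of_real (V y) * f (x - y - corner h T))" for T
    by (rule integrable_mult_bounded[OF Vint _ B]) measurable
  have "(LBINT y. complex_of_real (\<Prod>j\<in>UNIV. avgk (h j) (y $ j) - avgk (2 * h j) (y $ j)) * f (x - y))
     = (LBINT y. (\<Sum>T\<in>Pow UNIV. (-1) ^ card T * (complex_of_real (V (y - corner h T)) * f (x - y))))"
    unfolding exp by (simp add: sum_distrib_right mult.assoc)
  also have "\<dots> = (\<Sum>T\<in>Pow UNIV. (-1) ^ card T * (LBINT y. complex_of_real (V (y - corner h T)) * f (x - y)))"
    by (subst Bochner_Integration.integral_sum) (auto intro!: integrable_mult_right int1)
  also have "\<dots> = (\<Sum>T\<in>Pow UNIV. (-1) ^ card T * (LBINT y. complex_of_real (V y) * f (x - y - corner h T)))"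
  proof (intro sum.cong refl arg_cong2[where f="(*)"])
    fix T
    show "(LBINT y. complex_of_real (V (y - corner h T)) * f (x - y)) = (LBINT y. complex_of_real (V y) * f (x - y - corner h T))"
      using lborel_integral_translate[of "\<lambda>y. complex_of_real (V (y - corner h T)) * f (x - y)" "corner h T"]
      by (simp add: diff_diff_eq)
  qed
  also have "\<dots> = (LBINT y. (\<Sum>T\<in>Pow UNIV. (-1) ^ card T * (complex_of_real (V y) * f (x - y - corner h T))))"
    by (subst Bochner_Integration.integral_sum) (auto intro!: integrable_mult_right int2)
  also have "\<dots> = (LBINT y. complex_of_real (V y) * mixed_diff h UNIV f (x - y))"
    by (simp add: mixed_diff_def sum_distrib_left mult_ac)
  finally show ?thesis unfolding V_def .
qed

text \<open>
  After scaling, averages over boxes of all sizes are integrals against one fixed kernel, which serves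
  as a dominating function when the sizes tend to \<open>0\<close> or \<open>\<infinity>\<close>.
\<close>

lemma conv_avgk_scale:
  fixes f :: "real ^ 'n \<Rightarrow> complex"
  assumes [measurable]: "f \<in> borel_measurable borel" and a: "\<And>j. a j > 0"
  shows "(LBINT y. complex_of_real (\<Prod>j\<in>UNIV. avgk (a j) (y $ j)) * f (x - y))
     = (LBINT s. complex_of_real (\<Prod>j\<in>UNIV. avgk 1 (s $ j)) * f (x - (\<chi> j. a j * s $ j)))"
proof -
  have "(LBINT y. complex_of_real (\<Prod>j\<in>UNIV. avgk (a j) (y $ j)) * f (x - y))
     = (\<Prod>j\<in>UNIV. a j) *\<^sub>R (LBINT s. complex_of_real (\<Prod>j\<in>UNIV. avgk (a j) (a j * s $ j)) * f (x - (\<chi> j. a j * s $ j)))"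
    by (subst integral_lborel_diag[where h = a, OF _ a]) (measurable, simp?)
  also have "\<dots> = (LBINT s. complex_of_real (\<Prod>j\<in>UNIV. a j * avgk (a j) (a j * s $ j)) * f (x - (\<chi> j. a j * s $ j)))"
    by (subst integral_scaleR_right[symmetric]) (simp add: scaleR_conv_of_real prod.distrib mult.assoc)
  also have "(\<lambda>s :: real^'n. \<Prod>j\<in>UNIV. a j * avgk (a j) (a j * s $ j)) = (\<lambda>s. \<Prod>j\<in>UNIV. avgk 1 (s $ j))"
  proof (intro ext prod.cong refl)
    fix j t
    show "a j * avgk (a j) (a j * t) = avgk 1 t"
      using a[of j] by (auto simp: avgk_def indicator_def zero_le_mult_iff)
  qed
  finally show ?thesis .
qed

text \<open>
  The exceptional coordinate hyperplanes are a null set.  They are excluded in the next lemma, where a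
  point with a zero coordinate does not escape to infinity under scaling, and later, where the
  derivatives are not controlled on them.
\<close>

lemma AE_off_axes: "AE x in lborel. x \<in> (off_axes :: (real ^ 'n) set)"
proof -
  have "AE s in lborel. (s :: real^'n) $ j \<noteq> 0" for j
  proof -
    have "negligible {s :: real^'n. s $ j = 0}" by (rule negligible_standard_hyperplane_cart)
    then have "AE s in lebesgue. (s :: real^'n) $ j \<noteq> 0"
      by (simp add: negligible_iff_null_sets AE_iff_null_sets[symmetric] eventually_ae_filter null_setsD1) blast
    then show ?thesis by (simp add: AE_completion_iff)
  qed
  then show ?thesis unfolding off_axes_def by (simp add: AE_all_countable)
qed

text \<open>
  Expanding the product gives one average for each set \<open>T\<close> of coordinates with the long side
  \<open>2 powr N\<close>.  For \<open>T = {}\<close> the box shrinks to a point and the average tends to \<open>f x\<close>.  For any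
  other \<open>T\<close> almost all points of the box run off to infinity, where \<open>f\<close> tends to \<open>0\<close>.
\<close>

lemma haar_reconstruction:
  fixes f :: "real ^ 'n \<Rightarrow> complex"
  assumes f: "f \<in> C0"
  shows "(\<lambda>N. LBINT y. complex_of_real (\<Prod>j\<in>UNIV. avgk (2 powr - real N) (y $ j) - avgk (2 powr real N) (y $ j)) * f (x - y))
     \<longlonglongrightarrow> f x"
proof -
  have cont: "continuous_on UNIV f" and lim0: "(f \<longlongrightarrow> 0) at_infinity" using f by (auto simp: C0_def)
  obtain B where B: "\<And>x. norm (f x) \<le> B" using C0_bounded[OF f] by blast
  have [measurable]: "f \<in> borel_measurable borel" using cont by (rule borel_measurable_continuous_onI)
  define a where "a N T j = 2 powr (if j \<in> T then real N else - real N)" for N :: nat and T :: "'n set" and j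
  have a: "a N T j > 0" for N T j by (simp add: a_def)
  define W where "W s = (\<Prod>j\<in>UNIV. avgk 1 (s $ j))" for s :: "real ^ 'n"
  have Wint: "integrable lborel W" unfolding W_def by (rule integrable_avgk_prod)
  have [measurable]: "W \<in> borel_measurable borel" using Wint by auto
  have "integral\<^sup>L lborel (avgk 1) = 1" unfolding avgk_def[abs_def] by simp
  then have W1: "(LBINT s. W s) = 1"
    unfolding W_def integral_prod_vec[OF integrable_avgk] by simp
  have exp: "(LBINT y. complex_of_real (\<Prod>j\<in>UNIV. avgk (2 powr - real N) (y $ j) - avgk (2 powr real N) (y $ j)) * f (x - y))
     = (\<Sum>T\<in>Pow UNIV. (-1) ^ card T * (LBINT s. complex_of_real (W s) * f (x - (\<chi> j. a N T j * s $ j))))" for N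
  proof -
    have "(\<Prod>j\<in>UNIV. avgk (2 powr - real N) (y $ j) - avgk (2 powr real N) (y $ j))
       = (\<Sum>T\<in>Pow UNIV. (-1) ^ card T * (\<Prod>j\<in>UNIV. avgk (a N T j) (y $ j)))" for y :: "real ^ 'n"
    proof -
      have "(\<Prod>j\<in>UNIV. avgk (2 powr - real N) (y $ j) - avgk (2 powr real N) (y $ j))
        = (\<Sum>T\<in>Pow UNIV. (-1) ^ card T * (\<Prod>j\<in>T. avgk (2 powr real N) (y $ j)) * (\<Prod>j\<in>UNIV-T. avgk (2 powr - real N) (y $ j)))"
        by (rule prod_diff_conv_sum) simp
      also have "\<dots> = (\<Sum>T\<in>Pow UNIV. (-1) ^ card T * (\<Prod>j\<in>UNIV. avgk (a N T j) (y $ j)))"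
      proof (rule sum.cong[OF refl])
        fix T :: "'n set"
        have "(\<Prod>j\<in>UNIV. avgk (a N T j) (y $ j)) = (\<Prod>j\<in>T. avgk (a N T j) (y $ j)) * (\<Prod>j\<in>UNIV-T. avgk (a N T j) (y $ j))"
          by (subst prod.subset_diff[of T]) (auto simp: mult.commute)
        then show "(-1) ^ card T * (\<Prod>j\<in>T. avgk (2 powr real N) (y $ j)) * (\<Prod>j\<in>UNIV-T. avgk (2 powr - real N) (y $ j))
          = (-1) ^ card T * (\<Prod>j\<in>UNIV. avgk (a N T j) (y $ j))"
          by (simp add: a_def mult.assoc)
      qed
      finally show ?thesis .
    qed
    then have "(LBINT y. complex_of_real (\<Prod>j\<in>UNIV. avgk (2 powr - real N) (y $ j) - avgk (2 powr real N) (y $ j)) * f (x - y))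
      = (LBINT y. (\<Sum>T\<in>Pow UNIV. (-1) ^ card T * (complex_of_real (\<Prod>j\<in>UNIV. avgk (a N T j) (y $ j)) * f (x - y))))"
      by (simp add: sum_distrib_right mult.assoc)
    also have "\<dots> = (\<Sum>T\<in>Pow UNIV. (-1) ^ card T * (LBINT y. complex_of_real (\<Prod>j\<in>UNIV. avgk (a N T j) (y $ j)) * f (x - y)))"
      by (subst Bochner_Integration.integral_sum)
         (auto intro!: integrable_mult_right integrable_mult_bounded[OF integrable_avgk_prod _ B] simp del: of_real_prod)
    finally show ?thesis unfolding W_def by (simp only: conv_avgk_scale[of f "a N _", OF _ a] \<open>f \<in> borel_measurable borel\<close>)
  qed
  have lims: "(\<lambda>N. LBINT s. complex_of_real (W s) * f (x - (\<chi> j. a N T j * s $ j)))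
     \<longlonglongrightarrow> (LBINT s. complex_of_real (W s) * (if T = {} then f x else 0))" for T
  proof (rule integral_dominated_convergence[where w = "\<lambda>s. B * norm (W s)"])
    show "integrable lborel (\<lambda>s. B * norm (W s))" using Wint by auto
    have m: "(\<lambda>s. (\<chi> j. a N T j * s $ j)) \<in> borel_measurable borel" for N
      by (intro borel_measurable_continuous_onI continuous_intros)
    show "(\<lambda>s. complex_of_real (W s) * f (x - (\<chi> j. a N T j * s $ j))) \<in> borel_measurable lborel" for N
      using m[of N] by measurable
    show "AE s in lborel. norm (complex_of_real (W s) * f (x - (\<chi> j. a N T j * s $ j))) \<le> B * norm (W s)" for N
      using B by (intro AE_I2) (auto simp: norm_mult mult.commute[of B] intro!: mult_left_mono)
    have "AE s in lborel. \<forall>j. (s :: real^'n) $ j \<noteq> 0"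
      using AE_off_axes by (simp add: off_axes_def)
    then show "AE s in lborel. (\<lambda>N. complex_of_real (W s) * f (x - (\<chi> j. a N T j * s $ j)))
        \<longlonglongrightarrow> complex_of_real (W s) * (if T = {} then f x else 0)"
    proof eventually_elim
      case (elim s)
      have "(\<lambda>N. f (x - (\<chi> j. a N T j * s $ j))) \<longlonglongrightarrow> (if T = {} then f x else 0)"
      proof (cases "T = {}")
        case True
        have "(\<lambda>N. 2 powr - real N * s $ j) \<longlonglongrightarrow> 0" for j by real_asymp
        then have "(\<lambda>N. x - (\<chi> j. a N T j * s $ j)) \<longlonglongrightarrow> x - (\<chi> j. 0)"
          using True unfolding a_def by (intro tendsto_intros) simp
        then have "(\<lambda>N. x - (\<chi> j. a N T j * s $ j)) \<longlonglongrightarrow> x" by (simp add: zero_vec_def[symmetric])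
        moreover have "isCont f x" using cont by (simp add: continuous_on_eq_continuous_at)
        ultimately show ?thesis using True by (auto intro: isCont_tendsto_compose)
      next
        case False
        then obtain j where j: "j \<in> T" by auto
        have sj: "\<bar>s $ j\<bar> > 0" using elim by auto
        have "filterlim (\<lambda>N. 2 powr real N * \<bar>s $ j\<bar> - \<bar>x $ j\<bar>) at_top sequentially"
          using sj by real_asymp
        then have "filterlim (\<lambda>N. norm (x - (\<chi> j. a N T j * s $ j))) at_top sequentially"
        proof (rule filterlim_at_top_mono, intro always_eventually allI)
          fix N
          have "2 powr real N * \<bar>s $ j\<bar> - \<bar>x $ j\<bar> \<le> \<bar>(x - (\<chi> j. a N T j * s $ j)) $ j\<bar>"
            using j by (simp add: a_def abs_mult[symmetric, of "2 powr real N"])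
          also have "\<dots> \<le> norm (x - (\<chi> j. a N T j * s $ j))" by (rule component_le_norm_cart)
          finally show "2 powr real N * \<bar>s $ j\<bar> - \<bar>x $ j\<bar> \<le> norm (x - (\<chi> j. a N T j * s $ j))" .
        qed
        then have "filterlim (\<lambda>N. x - (\<chi> j. a N T j * s $ j)) at_infinity sequentially"
          by (rule filterlim_norm_at_top_imp_at_infinity)
        then show ?thesis using filterlim_compose[OF lim0] False by simp
      qed
      then show ?case by (intro tendsto_intros)
    qed
  qed measurable
  have "(\<lambda>N. \<Sum>T\<in>Pow UNIV. (-1) ^ card T * (LBINT s. complex_of_real (W s) * f (x - (\<chi> j. a N T j * s $ j))))
      \<longlonglongrightarrow> (\<Sum>T\<in>Pow (UNIV::'n set). (-1) ^ card T * (LBINT s. complex_of_real (W s) * (if T = {} then f x else 0)))"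
    by (rule tendsto_sum, rule tendsto_mult[OF tendsto_const lims])
  also have "(\<Sum>T\<in>Pow (UNIV::'n set). (-1) ^ card T * (LBINT s. complex_of_real (W s) * (if T = {} then f x else 0)))
      = (\<Sum>T\<in>{{}::'n set}. (-1) ^ card T * (LBINT s. complex_of_real (W s) * (if T = {} then f x else 0)))"
    by (rule sum.mono_neutral_right) auto
  also have "\<dots> = f x" using W1 by (simp add: integral_complex_of_real)
  finally show ?thesis unfolding exp .
qed

lemma sum_geometric_int:
  fixes r :: real
  assumes "0 \<le> r" "r < 1"
  shows "(\<Sum>s\<in>{- int N..<int N}. r ^ nat \<bar>s\<bar>) \<le> 2 / (1 - r)"
proof -
  have "(\<Sum>s\<in>{- int N..<int N}. r ^ nat \<bar>s\<bar>) \<le> 2 * (\<Sum>k<N. r ^ k)"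
  proof (induction N)
    case (Suc N)
    have eq: "{- int (Suc N)..<int (Suc N)} = insert (- int (Suc N)) (insert (int N) {- int N..<int N})"
      by auto
    have "(\<Sum>s\<in>{- int (Suc N)..<int (Suc N)}. r ^ nat \<bar>s\<bar>)
        = r ^ Suc N + (r ^ N + (\<Sum>s\<in>{- int N..<int N}. r ^ nat \<bar>s\<bar>))"
      unfolding eq by (subst sum.insert) (auto simp: nat_add_distrib)
    also have "r ^ Suc N \<le> r ^ N" using assms by (intro power_decreasing) auto
    finally show ?case using Suc by simp
  qed simp
  also have "(\<Sum>k<N. r ^ k) \<le> 1 / (1 - r)"
    using sum_le_suminf[OF summable_geometric[of r], of "{..<N}"] suminf_geometric[of r] assms by simp
  finally show ?thesis by simp
qed

lemma real_sqrt_prod: "sqrt (\<Prod>j\<in>A. g j) = (\<Prod>j\<in>A. sqrt (g j))"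
  by (induction A rule: infinite_finite_induct) (auto simp: real_sqrt_mult)

text \<open>
  The function \<open>P s\<close> is the piece of \<open>f\<close> at scale \<open>2 powr s\<^sub>j\<close> in the \<open>j\<close>-th variable.  It is the convolution of
  a mixed difference with a kernel of \<open>L\<^sub>2\<close> norm \<open>\<Prod>j. 1 / (2 * sqrt (2 powr s\<^sub>j))\<close>, so its Wiener norm is
  at most a constant times \<open>\<Prod>j. r ^ \<bar>s\<^sub>j\<bar>\<close>.  The partial sums over the cubes \<open>Q N\<close> telescope to the
  averages of the previous lemma.
\<close>

lemma Bernstein_criterion:
  fixes f :: "real ^ 'n \<Rightarrow> complex"
  assumes f: "f \<in> C0" and r: "0 \<le> r" "r < 1"
    and int: "\<And>h. (\<And>j. h j > 0) \<Longrightarrow> integrable lborel (\<lambda>x. (norm (mixed_diff h UNIV f x))\<^sup>2)"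
    and bound: "\<And>s :: 'n \<Rightarrow> int. sqrt (LBINT x. (norm (mixed_diff (\<lambda>j. 2 powr s j) UNIV f x))\<^sup>2)
        \<le> C * (\<Prod>j\<in>UNIV. sqrt (2 powr s j) * r ^ nat \<bar>s j\<bar>)"
  shows "f \<in> Wiener_algebra"
proof -
  have cont: "continuous_on UNIV f" using f by (auto simp: C0_def)
  obtain B where B: "\<And>x. norm (f x) \<le> B" using C0_bounded[OF f] by blast
  define C' where "C' = max C 0"
  have C': "C' \<ge> 0" "C \<le> C'" by (auto simp: C'_def)
  define q where "q s y = (\<Prod>j\<in>UNIV. avgk (2 powr s j) (y $ j) - avgk (2 powr (s j + 1)) (y $ j))"
    for s :: "'n \<Rightarrow> int" and y :: "real ^ 'n"
  define P where "P s x = (LBINT y. complex_of_real (q s y) * f (x - y))" for s x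
  have qint: "integrable lborel (q s)" for s
    unfolding q_def by (rule integrable_prod_vec) (intro Bochner_Integration.integrable_diff integrable_avgk)
  have [measurable]: "f \<in> borel_measurable borel" using cont by (rule borel_measurable_continuous_onI)
  define w where "w s = 4 * C' * (\<Prod>j\<in>UNIV. r ^ nat \<bar>s j\<bar>)" for s :: "'n \<Rightarrow> int"
  have w0: "w s \<ge> 0" for s using C' r by (auto simp: w_def intro!: mult_nonneg_nonneg prod_nonneg)
  have P: "Wiener_norm_le (P s) (w s)" for s
  proof -
    define h where "h j = 2 powr s j" for j
    have h: "h j > 0" for j by (simp add: h_def)
    define V where "V y = complex_of_real (\<Prod>j\<in>UNIV. avgk (h j) (y $ j) / 2)" for y :: "real^'n"
    have "q s = (\<lambda>y. \<Prod>j\<in>UNIV. avgk (h j) (y $ j) - avgk (2 * h j) (y $ j))"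
      by (simp add: q_def h_def fun_eq_iff powr_add mult.commute)
    then have Peq: "P s = (\<lambda>x. LBINT y. V y * mixed_diff h UNIV f (x - y))"
      unfolding P_def V_def by (simp only: conv_haar_kernel[OF cont B h])
    have Vi: "integrable lborel V"
      unfolding V_def by (intro integrable_of_real integrable_prod_vec integrable_divide_zero integrable_avgk)
    have Vsq: "(norm (V y))\<^sup>2 = (\<Prod>j\<in>UNIV. avgk (h j) (y $ j) / (4 * h j))" for y
    proof -
      have "(norm (V y))\<^sup>2 = (\<Prod>j\<in>UNIV. (avgk (h j) (y $ j) / 2)\<^sup>2)"
        unfolding V_def norm_of_real power2_abs by (simp add: prod_power_distrib)
      also have "\<dots> = (\<Prod>j\<in>UNIV. avgk (h j) (y $ j) / (4 * h j))"
        by (intro prod.cong refl) (auto simp: avgk_def power2_eq_square indicator_def)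
      finally show ?thesis .
    qed
    have V2: "integrable lborel (\<lambda>y. (norm (V y))\<^sup>2)"
      unfolding Vsq by (intro integrable_prod_vec integrable_divide_zero integrable_avgk)
    have ia: "integral\<^sup>L lborel (avgk (h j)) = 1" for j
      using h[of j] unfolding avgk_def[abs_def] by simp
    have "(LBINT y. (norm (V y))\<^sup>2) = (\<Prod>j\<in>UNIV. 1 / (4 * h j))"
      unfolding Vsq by (subst integral_prod_vec) (auto intro!: integrable_divide_zero integrable_avgk simp: ia)
    then have VS: "sqrt (LBINT y. (norm (V y))\<^sup>2) = (\<Prod>j\<in>UNIV. 1 / (2 * sqrt (h j)))"
      by (simp add: real_sqrt_prod real_sqrt_divide real_sqrt_mult)
    have "Wiener_norm_le (P s) (4 * (sqrt (LBINT x. (norm (mixed_diff h UNIV f x))\<^sup>2) * sqrt (LBINT x. (norm (V x))\<^sup>2)))"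
      unfolding Peq
      by (rule Wiener_norm_le_convolution_L2[OF continuous_mixed_diff[OF cont] norm_mixed_diff_le[OF B] int[OF h] Vi V2])
    moreover have "4 * (sqrt (LBINT x. (norm (mixed_diff h UNIV f x))\<^sup>2) * sqrt (LBINT x. (norm (V x))\<^sup>2)) \<le> w s"
    proof -
      have "sqrt (LBINT x. (norm (mixed_diff h UNIV f x))\<^sup>2) * sqrt (LBINT x. (norm (V x))\<^sup>2)
         \<le> (C * (\<Prod>j\<in>UNIV. sqrt (h j) * r ^ nat \<bar>s j\<bar>)) * (\<Prod>j\<in>UNIV. 1 / (2 * sqrt (h j)))"
        unfolding VS using bound[of s] h by (intro mult_right_mono) (auto simp: h_def[abs_def] intro!: prod_nonneg)
      also have "\<dots> = C * (\<Prod>j\<in>UNIV. r ^ nat \<bar>s j\<bar> / 2)"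
        unfolding mult.assoc prod.distrib[symmetric] using h
        by (intro arg_cong2[where f="(*)"] refl prod.cong) (simp add: less_imp_neq[symmetric])
      also have "\<dots> \<le> C' * (\<Prod>j\<in>UNIV. r ^ nat \<bar>s j\<bar>)"
        using C' r by (intro mult_mono prod_mono) (auto intro!: prod_nonneg)
      finally show ?thesis unfolding w_def by simp
    qed
    ultimately show ?thesis by (rule Wiener_norm_le_mono)
  qed
  define Q where "Q N = PiE (UNIV :: 'n set) (\<lambda>_. {- int N..<int N})" for N
  have Qfin: "finite (Q N)" for N unfolding Q_def by (intro finite_PiE) auto
  have Qmono: "Q N \<subseteq> Q (Suc N)" for N unfolding Q_def by (intro PiE_mono) auto
  have Q0: "Q 0 = {}" unfolding Q_def by (auto simp: PiE_eq_empty_iff)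
  define F where "F N x = (\<Sum>s\<in>Q N. P s x)" for N x
  \<comment> \<open>telescoping in one variable; the product over all variables sums over the cube\<close>
  have tele: "(\<Sum>s\<in>{- int N..<int N}. avgk (2 powr s) t - avgk (2 powr (s + 1)) t)
      = avgk (2 powr - real N) t - avgk (2 powr real N) t" for N t
  proof (induction N)
    case (Suc N)
    have eq: "{- int (Suc N)..<int (Suc N)} = insert (- int (Suc N)) (insert (int N) {- int N..<int N})"
      by auto
    have "(\<Sum>s\<in>{- int (Suc N)..<int (Suc N)}. avgk (2 powr s) t - avgk (2 powr (s + 1)) t)
        = (avgk (2 powr - real (Suc N)) t - avgk (2 powr - real N) t) + ((avgk (2 powr real N) t - avgk (2 powr real (Suc N)) t)
         + (\<Sum>s\<in>{- int N..<int N}. avgk (2 powr s) t - avgk (2 powr (s + 1)) t))"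
      unfolding eq by (subst sum.insert) (auto simp: add.commute)
    then show ?case using Suc by simp
  qed simp
  have F: "F N x = (LBINT y. complex_of_real (\<Prod>j\<in>UNIV. avgk (2 powr - real N) (y $ j) - avgk (2 powr real N) (y $ j)) * f (x - y))" for N x
  proof -
    have "F N x = (LBINT y. (\<Sum>s\<in>Q N. complex_of_real (q s y) * f (x - y)))"
      unfolding F_def P_def
      by (rule Bochner_Integration.integral_sum[symmetric], rule integrable_mult_bounded[OF qint _ B]) measurable
    also have "\<dots> = (LBINT y. complex_of_real (\<Sum>s\<in>Q N. q s y) * f (x - y))"
      by (simp add: sum_distrib_right)
    also have "(\<lambda>y. \<Sum>s\<in>Q N. q s y) = (\<lambda>y. \<Prod>j\<in>UNIV. avgk (2 powr - real N) (y $ j) - avgk (2 powr real N) (y $ j))"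
      unfolding q_def Q_def tele[symmetric] by (intro ext prod_sum_PiE[symmetric]) auto
    finally show ?thesis .
  qed
  \<comment> \<open>the sum over all scales is arranged as a series over the shells between consecutive cubes\<close>
  define c where "c N = (\<Sum>s\<in>Q (Suc N) - Q N. w s)" for N
  have csum: "(\<Sum>k<N. c k) = (\<Sum>s\<in>Q N. w s)" for N
  proof (induction N)
    case (Suc N)
    then show ?case
      unfolding c_def using sum.subset_diff[OF Qmono[of N] Qfin, of w] by simp
  qed (simp add: Q0)
  have "summable c"
  proof (rule summableI_nonneg_bounded)
    show "0 \<le> c N" for N unfolding c_def by (intro sum_nonneg w0)
    fix N
    have "(\<Sum>s\<in>Q N. w s) = 4 * C' * (\<Prod>j\<in>(UNIV::'n set). \<Sum>s\<in>{- int N..<int N}. r ^ nat \<bar>s\<bar>)"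
      unfolding w_def sum_distrib_left[symmetric] Q_def by (subst prod_sum_PiE) auto
    also have "\<dots> \<le> 4 * C' * (\<Prod>j\<in>(UNIV::'n set). 2 / (1 - r))"
      using C' r by (intro mult_left_mono prod_mono) (auto intro!: sum_nonneg sum_geometric_int)
    finally show "(\<Sum>k<N. c k) \<le> 4 * C' * (\<Prod>j\<in>(UNIV::'n set). 2 / (1 - r))" unfolding csum .
  qed
  have "Wiener_norm_le f (suminf c)"
  proof (rule Wiener_norm_le_sums)
    show "c sums suminf c" using \<open>summable c\<close> by (rule summable_sums)
    show "Wiener_norm_le (\<lambda>x. F (Suc N) x - F N x) (c N)" for N
    proof -
      have "(\<lambda>x. F (Suc N) x - F N x) = (\<lambda>x. \<Sum>s\<in>Q (Suc N) - Q N. P s x)"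
        unfolding F_def by (simp add: fun_eq_iff sum_diff[OF Qfin Qmono])
      then show ?thesis unfolding c_def
        using Wiener_norm_le_sum[of "Q (Suc N) - Q N" P w] Qfin P by auto
    qed
    fix x
    have "(\<lambda>N. F N x) \<longlonglongrightarrow> f x" unfolding F by (rule haar_reconstruction[OF f])
    then have "(\<lambda>N. F (Suc N) x - F N x) sums (f x - F 0 x)" by (rule telescope_sums)
    then show "(\<lambda>N. F (Suc N) x - F N x) sums f x" by (simp add: F_def Q0)
  qed
  then show ?thesis by (rule Wiener_norm_le_imp_Wiener_algebra)
qed

section \<open>Convexity and averages over translates\<close>

lemma weighted_AM_GM:
  fixes x e :: "'a \<Rightarrow> real"
  assumes S: "finite S" and e: "\<And>i. i \<in> S \<Longrightarrow> e i \<ge> 0" "sum e S = 1" and x: "\<And>i. i \<in> S \<Longrightarrow> x i > 0"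
  shows "(\<Prod>i\<in>S. x i powr e i) \<le> (\<Sum>i\<in>S. e i * x i)"
proof -
  have "S \<noteq> {}" using e(2) by auto
  have "(\<Prod>i\<in>S. x i powr e i) = exp (\<Sum>i\<in>S. e i *\<^sub>R ln (x i))"
    unfolding exp_sum[OF S] by (intro prod.cong refl) (use x in \<open>force simp: powr_def\<close>)
  also have "\<dots> \<le> (\<Sum>i\<in>S. e i * exp (ln (x i)))"
    by (rule convex_on_sum[OF S \<open>S \<noteq> {}\<close> exp_convex]) (use e in auto)
  also have "\<dots> = (\<Sum>i\<in>S. e i * x i)"
    by (intro sum.cong refl) (use x in force)
  finally show ?thesis .
qed

text \<open>
  The weighted inequality of the means for \<open>t powr p\<close> and \<open>1\<close>; equivalently, \<open>t powr p\<close> lies above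
  its tangent at \<open>1\<close>.
\<close>

lemma powr_tangent:
  fixes t p :: real
  assumes "t \<ge> 0" "p \<ge> 1"
  shows "t \<le> t powr p / p + (1 - 1 / p)"
proof (cases "t = 0")
  case True then show ?thesis using assms by simp
next
  case False
  then have t: "t > 0" using assms by simp
  let ?x = "\<lambda>b. if b then t powr p else 1" and ?e = "\<lambda>b. if b then 1 / p else 1 - 1 / p"
  have "(\<Prod>b\<in>UNIV. ?x b powr ?e b) \<le> (\<Sum>b\<in>UNIV. ?e b * ?x b)"
    by (rule weighted_AM_GM) (use assms t in \<open>auto simp: UNIV_bool\<close>)
  then show ?thesis using t assms by (simp add: UNIV_bool powr_powr)
qed

lemma integrable_powr_imp_integrable:
  fixes g :: "'a \<Rightarrow> complex"
  assumes fin: "finite_measure M" and [measurable]: "g \<in> borel_measurable M" and p: "p \<ge> 1"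
    and int: "integrable M (\<lambda>y. norm (g y) powr p)"
  shows "integrable M g"
proof (rule Bochner_Integration.integrable_bound)
  interpret finite_measure M by fact
  show "integrable M (\<lambda>y. norm (g y) powr p + 1)" using int by simp
  show "AE y in M. norm (g y) \<le> norm (norm (g y) powr p + 1)"
  proof (rule AE_I2)
    fix y
    have "norm (g y) \<le> norm (g y) powr p / p + (1 - 1 / p)" using p by (intro powr_tangent) auto
    also have "\<dots> \<le> norm (g y) powr p / 1 + 1"
      using p by (intro add_mono divide_left_mono) auto
    finally show "norm (g y) \<le> norm (norm (g y) powr p + 1)" by simp
  qed
qed fact

text \<open>
  Jensen's inequality for the power \<open>p\<close> on a measure of arbitrary finite mass, obtained by
  integrating \<open>powr_tangent\<close> at \<open>norm (g y)\<close> divided by the mean \<open>c\<close>.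
\<close>

lemma power_mean_inequality:
  fixes g :: "'a \<Rightarrow> complex"
  assumes fin: "finite_measure M" and m: "measure M (space M) > 0"
    and [measurable]: "g \<in> borel_measurable M" and p: "p \<ge> 1"
    and int: "integrable M (\<lambda>y. norm (g y) powr p)"
  shows "norm (integral\<^sup>L M g) powr p \<le> measure M (space M) powr (p - 1) * (\<integral>y. norm (g y) powr p \<partial>M)"
proof -
  interpret finite_measure M by fact
  let ?m = "measure M (space M)"
  have gi: "integrable M g" by (rule integrable_powr_imp_integrable) fact+
  define a where "a = (\<integral>y. norm (g y) \<partial>M)"
  define I where "I = (\<integral>y. norm (g y) powr p \<partial>M)"
  have le: "norm (integral\<^sup>L M g) \<le> a" unfolding a_def by (rule integral_norm_bound)
  have a0: "a \<ge> 0" unfolding a_def by (simp add: integral_nonneg_AE)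
  have "a powr p \<le> ?m powr (p - 1) * I"
  proof (cases "a = 0")
    case True
    have "0 \<le> I" unfolding I_def by (simp add: integral_nonneg_AE)
    then show ?thesis using True by simp
  next
    case False
    then have a: "a > 0" using a0 by simp
    define c where "c = a / ?m"
    have c: "c > 0" using a m by (simp add: c_def)
    have "a / c = (\<integral>y. norm (g y) / c \<partial>M)" unfolding a_def by simp
    also have "\<dots> \<le> (\<integral>y. norm (g y) powr p / (c powr p * p) + (1 - 1 / p) \<partial>M)"
    proof (rule integral_mono)
      fix y
      show "norm (g y) / c \<le> norm (g y) powr p / (c powr p * p) + (1 - 1 / p)"
        using powr_tangent[of "norm (g y) / c" p] c p by (simp add: powr_divide)
    qed (use gi int in auto)
    also have "\<dots> = I / (c powr p * p) + ?m * (1 - 1 / p)"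
      unfolding I_def using int by simp
    finally have "?m \<le> I / (c powr p * p) + ?m * (1 - 1 / p)" using a m by (simp add: c_def)
    then have "?m / p \<le> I / (c powr p * p)" by (simp add: algebra_simps)
    then have "?m * c powr p \<le> I" using p c by (simp add: field_simps)
    moreover have "?m * c powr p = a powr p * ?m powr (1 - p)"
      using a m by (simp add: c_def powr_divide powr_diff)
    ultimately have "a powr p * ?m powr (1 - p) * ?m powr (p - 1) \<le> I * ?m powr (p - 1)"
      by (intro mult_right_mono) auto
    moreover have "?m powr (1 - p) * ?m powr (p - 1) = 1"
      using m by (simp add: powr_add[symmetric])
    ultimately show ?thesis by (simp add: mult.assoc mult.commute[of I])
  qed
  moreover have "norm (integral\<^sup>L M g) powr p \<le> a powr p"
    using le p by (intro powr_mono2) auto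
  ultimately show ?thesis unfolding I_def by linarith
qed

lemma nn_integral_translates:
  fixes F :: "real ^ 'n \<Rightarrow> ennreal"
  assumes M: "sigma_finite_measure M" and [measurable]: "F \<in> borel_measurable borel" "\<tau> \<in> borel_measurable M"
  shows "(\<integral>\<^sup>+x. \<integral>\<^sup>+y. F (x - \<tau> y) \<partial>M \<partial>lborel) = emeasure M (space M) * integral\<^sup>N lborel F"
proof -
  interpret M: sigma_finite_measure M by fact
  interpret pair_sigma_finite lborel M ..
  have "(\<integral>\<^sup>+x. \<integral>\<^sup>+y. F (x - \<tau> y) \<partial>M \<partial>lborel) = (\<integral>\<^sup>+y. \<integral>\<^sup>+x. F (x - \<tau> y) \<partial>lborel \<partial>M)"
    by (rule Fubini'[symmetric]) measurable
  also have "\<dots> = (\<integral>\<^sup>+y. integral\<^sup>N lborel F \<partial>M)"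
  proof (rule nn_integral_cong)
    fix y
    show "(\<integral>\<^sup>+x. F (x - \<tau> y) \<partial>lborel) = integral\<^sup>N lborel F"
      using nn_integral_lborel_translate[of F "- \<tau> y"] by simp
  qed
  finally show ?thesis by (simp add: mult.commute)
qed

text \<open>
  Each translate of a null set is a null set, so for every \<open>y\<close> the statement \<open>P (x - \<tau> y)\<close> holds for
  almost all \<open>x\<close>, and Fubini's theorem exchanges the two quantifiers.  With \<open>\<tau>\<close> running along a coordinate axis this replaces
  splitting \<open>\<real>\<^sup>n\<close> into one coordinate and the others.
\<close>

lemma AE_translates:
  fixes \<tau> :: "'b \<Rightarrow> real ^ 'n"
  assumes M: "sigma_finite_measure M" and [measurable]: "\<tau> \<in> borel_measurable M"
    and ae: "AE x in lborel. P x"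
  shows "AE x in lborel. AE y in M. P (x - \<tau> y)"
proof -
  interpret M: sigma_finite_measure M by fact
  from ae obtain N where N: "{x. \<not> P x} \<subseteq> N" "emeasure lborel N = 0" "N \<in> sets borel"
    by (auto elim!: AE_E)
  note N(3)[measurable]
  have "(\<integral>\<^sup>+x. \<integral>\<^sup>+y. indicator N (x - \<tau> y) \<partial>M \<partial>lborel) = emeasure M (space M) * integral\<^sup>N lborel (indicator N)"
    by (rule nn_integral_translates[OF M]) measurable
  also have "\<dots> = 0" using N by simp
  finally have "AE x in lborel. (\<integral>\<^sup>+y. indicator N (x - \<tau> y) \<partial>M) = 0"
    by (subst (asm) nn_integral_0_iff_AE) auto
  then show ?thesis
  proof eventually_elim
    case (elim x)
    have "AE y in M. indicator N (x - \<tau> y) = (0::ennreal)"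
      using elim by (subst (asm) nn_integral_0_iff_AE) auto
    then show ?case by eventually_elim (use N(1) in \<open>auto split: split_indicator_asm\<close>)
  qed
qed

text \<open>
  The case of a one-point measure.
\<close>

lemma AE_translate:
  fixes c :: "real ^ 'n"
  assumes "AE x in lborel. P x"
  shows "AE x in lborel. P (x - c)"
proof -
  have sf: "sigma_finite_measure (return borel (0::real))"
    by (intro prob_space_imp_sigma_finite prob_space_return) simp
  have "AE x in lborel. AE y in return borel (0::real). P (x - c)"
    by (rule AE_translates[OF sf _ assms]) simp
  then show ?thesis by (subst (asm) AE_return) auto
qed

lemma AE_integrable_translates:
  fixes g :: "real ^ 'n \<Rightarrow> complex" and \<tau> :: "'b \<Rightarrow> real ^ 'n"
  assumes M: "finite_measure M" and [measurable]: "\<tau> \<in> borel_measurable M" "g \<in> borel_measurable borel"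
    and int: "integrable lborel (\<lambda>x. norm (g x) powr p)"
  shows "AE x in lborel. integrable M (\<lambda>y. norm (g (x - \<tau> y)) powr p)"
proof -
  interpret finite_measure M by fact
  have "(\<integral>\<^sup>+x. \<integral>\<^sup>+y. ennreal (norm (g (x - \<tau> y)) powr p) \<partial>M \<partial>lborel)
      = emeasure M (space M) * (\<integral>\<^sup>+x. ennreal (norm (g x) powr p) \<partial>lborel)"
    by (rule nn_integral_translates) (auto intro: sigma_finite_measure_axioms)
  also have "\<dots> \<noteq> \<infinity>"
    using int by (auto simp: nn_integral_eq_integral ennreal_mult_eq_top_iff emeasure_eq_measure)
  finally have "AE x in lborel. (\<integral>\<^sup>+y. ennreal (norm (g (x - \<tau> y)) powr p) \<partial>M) \<noteq> \<infinity>"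
    by (intro nn_integral_PInf_AE) measurable
  then show ?thesis
  proof eventually_elim
    case (elim x)
    then show ?case by (intro integrableI_bounded) (auto simp: less_top)
  qed
qed

section \<open>The fundamental theorem of calculus for absolutely continuous functions\<close>

lemma sum_length_division_le_measure:
  fixes t U :: "real set"
  assumes D: "\<D> division_of t" and tU: "t \<subseteq> U" and U: "U \<in> lmeasurable"
  shows "(\<Sum>k\<in>\<D>. Sup k - Inf k) \<le> measure lebesgue U"
proof -
  have box: "\<exists>a b. k = {a..b} \<and> a \<le> b" if "k \<in> \<D>" for k
    using division_ofD(3,4)[OF D that] by auto
  have lm: "k \<in> lmeasurable" if "k \<in> \<D>" for k using box[OF that] by auto
  have "(\<Sum>k\<in>\<D>. Sup k - Inf k) = (\<Sum>k\<in>\<D>. measure lebesgue k)"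
    by (intro sum.cong refl) (use box in fastforce)
  also have "\<dots> = measure lebesgue (\<Union>\<D>)"
  proof (rule measure_negligible_finite_Union[symmetric])
    show "finite \<D>" using D by auto
    show "pairwise (\<lambda>S T. negligible (S \<inter> T)) \<D>"
    proof (rule pairwiseI)
      fix S T assume ST: "S \<in> \<D>" "T \<in> \<D>" "S \<noteq> T"
      have "interior S \<inter> interior T = {}" using division_ofD(5)[OF D ST(1,2,3)] .
      then have "S \<inter> T \<subseteq> frontier S \<union> frontier T"
        using closure_subset unfolding frontier_def by blast
      moreover have "negligible (frontier S \<union> frontier T)"
        using box[OF ST(1)] box[OF ST(2)] by (intro negligible_Un negligible_convex_frontier) auto
      ultimately show "negligible (S \<inter> T)" using negligible_subset by blast
    qed
  qed (use lm in auto)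
  also have un: "\<Union>\<D> = t" using D by auto
  also have "measure lebesgue t \<le> measure lebesgue U"
  proof (rule measure_mono_fmeasurable[OF tU _ U])
    have "\<Union>\<D> \<in> lmeasurable" using D lm by (intro fmeasurable.finite_Union) auto
    then show "t \<in> sets lebesgue" using un by (simp add: fmeasurableD)
  qed
  finally show ?thesis .
qed

text \<open>
  In the gauge integral the proof is direct.  Off the null set \<open>N\<close> the gauge makes each increment of
  \<open>\<phi>\<close> close to the derivative times the length.  The intervals with tags in \<open>N\<close> are forced into an open
  set \<open>U\<close> of small measure, so absolute continuity makes their increments small in total.
\<close>

lemma fundamental_theorem_of_calculus_absolutely_continuous:
  fixes \<phi> \<psi> :: "real \<Rightarrow> complex"
  assumes ab: "a \<le> b" and ac: "absolutely_continuous_on {a..b} \<phi>"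
    and neg: "negligible N" and der: "\<And>s. s \<in> {a..b} - N \<Longrightarrow> (\<phi> has_vector_derivative \<psi> s) (at s)"
  shows "(\<psi> has_integral \<phi> b - \<phi> a) {a..b}"
proof -
  define \<psi>' where "\<psi>' s = (if s \<in> N then 0 else \<psi> s)" for s
  have "(\<psi>' has_integral \<phi> b - \<phi> a) (cbox a b)"
    unfolding has_integral
  proof (intro allI impI)
    fix e :: real assume e: "e > 0"
    from ac e obtain \<delta> where \<delta>: "\<delta> > 0" and ac': "\<And>\<D> t. \<D> division_of t \<Longrightarrow> t \<subseteq> {a..b} \<Longrightarrow>
        (\<Sum>k\<in>\<D>. Sup k - Inf k) < \<delta> \<Longrightarrow> (\<Sum>k\<in>\<D>. norm (\<phi> (Sup k) - \<phi> (Inf k))) < e / 2"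
      unfolding absolutely_continuous_on_def by (metis half_gt_zero)
    have Ns: "N \<in> sets lebesgue" using neg by (rule negligible_imp_sets)
    obtain U where U: "open U" "N \<subseteq> U" "U - N \<in> lmeasurable" "emeasure lebesgue (U - N) < ennreal \<delta>"
      using sets_lebesgue_outer_open[OF Ns \<delta>] by blast
    have Nl: "N \<in> lmeasurable" "measure lebesgue N = 0" using neg negligible_iff_measure by auto
    have Ul: "U \<in> lmeasurable"
      using fmeasurable.Un[OF U(3) Nl(1)] U(2) by (simp add: Un_absorb2)
    have Um: "measure lebesgue U < \<delta>"
    proof -
      have "measure lebesgue U \<le> measure lebesgue (U - N) + measure lebesgue N"
        using measure_Un_le[of "U - N" lebesgue N] U(2,3) Ns by (simp add: Un_absorb2 fmeasurableD)
      also have "\<dots> < \<delta>" using U(3,4) \<delta> Nl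
        by (simp add: emeasure_eq_measure2 ennreal_less_iff)
      finally show ?thesis .
    qed
    define e' where "e' = e / (4 * (b - a + 1))"
    have e': "e' > 0" using e ab by (simp add: e'_def)
    have "\<exists>d>0. \<forall>y. norm (y - s) < d \<longrightarrow> norm (\<phi> y - \<phi> s - (y - s) *\<^sub>R \<psi> s) \<le> e' * norm (y - s)"
      if "s \<in> {a..b} - N" for s
      using der[OF that] e' unfolding has_vector_derivative_def has_derivative_within_alt by auto
    then obtain d where d: "\<And>s. s \<in> {a..b} - N \<Longrightarrow> d s > 0"
      and dd: "\<And>s y. s \<in> {a..b} - N \<Longrightarrow> norm (y - s) < d s \<Longrightarrow> norm (\<phi> y - \<phi> s - (y - s) *\<^sub>R \<psi> s) \<le> e' * norm (y - s)"
      by metis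
    define \<gamma> where "\<gamma> s = (if s \<in> N then U else if s \<in> {a..b} then ball s (d s) else UNIV)" for s
    show "\<exists>\<gamma>. gauge \<gamma> \<and> (\<forall>\<D>. \<D> tagged_division_of cbox a b \<and> \<gamma> fine \<D> \<longrightarrow>
        norm ((\<Sum>(x, k)\<in>\<D>. measure lborel k *\<^sub>R \<psi>' x) - (\<phi> b - \<phi> a)) < e)"
    proof (intro exI[of _ \<gamma>] conjI allI impI)
      show "gauge \<gamma>" using U d by (auto simp: gauge_def \<gamma>_def)
      fix \<D> assume "\<D> tagged_division_of cbox a b \<and> \<gamma> fine \<D>"
      then have D: "\<D> tagged_division_of {a..b}" and fine: "\<gamma> fine \<D>" by auto
      have finD: "finite \<D>" using D by auto
      define A where "A = {(x, k). (x, k) \<in> \<D> \<and> x \<in> N}"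
      have AD: "A \<subseteq> \<D>" by (auto simp: A_def)
      let ?\<Delta> = "\<lambda>k. \<phi> (Sup k) - \<phi> (Inf k)"
      have kx: "\<exists>u v. k = {u..v} \<and> u \<le> x \<and> x \<le> v \<and> a \<le> u \<and> v \<le> b" if xk: "(x, k) \<in> \<D>" for x k
      proof -
        obtain u v where "k = {u..v}" using tagged_division_ofD(4)[OF D xk] by auto
        then show ?thesis using tagged_division_ofD(2,3)[OF D xk] by auto
      qed
      have "(\<Sum>(x, k)\<in>\<D>. measure lborel k *\<^sub>R \<psi>' x) - (\<phi> b - \<phi> a) = (\<Sum>(x, k)\<in>\<D>. measure lborel k *\<^sub>R \<psi>' x - ?\<Delta> k)"
        using additive_tagged_division_1[OF ab D, of \<phi>] by (simp add: sum_subtractf case_prod_unfold)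
      also have "\<dots> = (\<Sum>(x, k)\<in>\<D> - A. measure lborel k *\<^sub>R \<psi>' x - ?\<Delta> k) + (\<Sum>(x, k)\<in>A. measure lborel k *\<^sub>R \<psi>' x - ?\<Delta> k)"
        by (rule sum.subset_diff[OF AD finD])
      also have "norm \<dots> \<le> (\<Sum>(x, k)\<in>\<D> - A. e' * measure lborel k) + (\<Sum>(x, k)\<in>A. norm (?\<Delta> k))"
      proof (rule norm_triangle_mono; rule sum_norm_le; clarify)
        fix x k assume xk: "(x, k) \<in> \<D>" "(x, k) \<notin> A"
        then have x: "x \<in> {a..b} - N" using kx[OF xk(1)] by (auto simp: A_def)
        obtain u v where k: "k = {u..v}" "u \<le> x" "x \<le> v" using kx[OF xk(1)] by blast
        have "k \<subseteq> \<gamma> x" using fine xk(1) by (auto simp: fine_def)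
        then have "k \<subseteq> ball x (d x)" using x by (simp add: \<gamma>_def)
        moreover have "u \<in> k" "v \<in> k" using k by auto
        ultimately have "u \<in> ball x (d x)" "v \<in> ball x (d x)" by blast+
        then have nv: "norm (v - x) < d x" "norm (u - x) < d x" by (auto simp: dist_norm norm_minus_commute)
        have "measure lborel k *\<^sub>R \<psi>' x - ?\<Delta> k = (\<phi> u - \<phi> x - (u - x) *\<^sub>R \<psi> x) - (\<phi> v - \<phi> x - (v - x) *\<^sub>R \<psi> x)"
          using k x by (simp add: \<psi>'_def algebra_simps)
        also have "norm \<dots> \<le> e' * norm (u - x) + e' * norm (v - x)"
          by (rule order_trans[OF norm_triangle_ineq4 add_mono[OF dd[OF x nv(2)] dd[OF x nv(1)]]])
        also have "\<dots> = e' * measure lborel k" using k by (simp add: algebra_simps)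
        finally show "norm (measure lborel k *\<^sub>R \<psi>' x - ?\<Delta> k) \<le> e' * measure lborel k" .
      next
        fix x k assume "(x, k) \<in> A"
        then show "norm (measure lborel k *\<^sub>R \<psi>' x - ?\<Delta> k) \<le> norm (?\<Delta> k)" by (simp add: A_def \<psi>'_def norm_minus_commute)
      qed
      also have "(\<Sum>(x, k)\<in>\<D> - A. e' * measure lborel k) \<le> (\<Sum>(x, k)\<in>\<D>. e' * measure lborel k)"
        using e' by (intro sum_mono2 finD) auto
      also have "\<dots> = e' * (b - a)"
        using additive_content_tagged_division[of \<D> a b] D ab
        by (simp add: case_prod_unfold sum_distrib_left[symmetric])
      also have "\<dots> < e / 2"
      proof -
        have "e' * (b - a) \<le> e' * (b - a + 1)" using e' by (intro mult_left_mono) auto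
        also have "\<dots> = e / 4"
        proof -
          have "b - a + 1 \<noteq> 0" using ab by linarith
          then show ?thesis unfolding e'_def by (metis divide_divide_eq_left nonzero_divide_eq_eq mult.commute times_divide_eq_right)
        qed
        finally show ?thesis using e by linarith
      qed
      also have "(\<Sum>(x, k)\<in>A. norm (?\<Delta> k)) < e / 2"
      proof -
        have Ap: "A tagged_partial_division_of {a..b}"
          using D AD tagged_partial_division_subset tagged_division_of_def by blast
        have Au: "A tagged_division_of (\<Union>(snd ` A))"
          by (rule tagged_partial_division_of_Union_self[OF Ap])
        have div: "(snd ` A) division_of (\<Union>(snd ` A))" by (rule partial_division_of_tagged_division[OF Ap])
        \<comment> \<open>the empty interval needs the value \<open>0\<close>, as \<open>Sup {}\<close> and \<open>Inf {}\<close> are arbitrary\<close>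
        define d' where "d' k = (if k = {} then 0 else norm (?\<Delta> k))" for k :: "real set"
        have ne: "k \<noteq> {}" if "(x, k) \<in> A" for x k using tagged_division_ofD(2)[OF Au that] by auto
        have "(\<Sum>(x, k)\<in>A. norm (?\<Delta> k)) = (\<Sum>(x, k)\<in>A. d' k)"
          by (intro sum.cong) (auto simp: d'_def dest: ne)
        also have "\<dots> = (\<Sum>k\<in>snd ` A. d' k)"
        proof (rule sum.over_tagged_division_lemma[OF Au])
          fix u v :: real assume "box u v = {}"
          then show "d' (cbox u v) = 0" by (cases "u = v") (auto simp: d'_def)
        qed
        also have "\<dots> = (\<Sum>k\<in>snd ` A. norm (?\<Delta> k))"
          by (intro sum.cong) (auto simp: d'_def dest: ne)
        also have "\<dots> < e / 2"
        proof (rule ac'[OF div])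
          show "\<Union>(snd ` A) \<subseteq> {a..b}" using kx AD by fastforce
          have "k \<subseteq> U" if "(x, k) \<in> A" for x k
          proof -
            have "k \<subseteq> \<gamma> x" "x \<in> N" using fine that by (auto simp: fine_def A_def)
            then show ?thesis by (simp add: \<gamma>_def)
          qed
          then have "\<Union>(snd ` A) \<subseteq> U" by fastforce
          then have "(\<Sum>k\<in>snd ` A. Sup k - Inf k) \<le> measure lebesgue U"
            by (rule sum_length_division_le_measure[OF div _ Ul])
          then show "(\<Sum>k\<in>snd ` A. Sup k - Inf k) < \<delta>" using Um by linarith
        qed
        finally show ?thesis .
      qed
      finally show "norm ((\<Sum>(x, k)\<in>\<D>. measure lborel k *\<^sub>R \<psi>' x) - (\<phi> b - \<phi> a)) < e" by simp
    qed
  qed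
  then show ?thesis
    by (intro has_integral_spike[OF neg, of "{a..b}" \<psi> \<psi>']) (auto simp: \<psi>'_def)
qed

section \<open>Differences as integrals of derivatives, along one variable\<close>

text \<open>
  Fubini's theorem for product measures speaks of Borel functions, so the Lebesgue measurable
  derivatives are replaced by Borel functions that agree with them almost everywhere.
\<close>

lemma Lp_borel_representative:
  fixes g :: "real ^ 'n \<Rightarrow> complex"
  assumes "g \<in> Lp p"
  obtains B where "B \<in> borel_measurable borel" "AE x in lborel. g x = B x"
    "integrable lborel (\<lambda>x. norm (B x) powr p)"
proof -
  have g[measurable]: "g \<in> borel_measurable lebesgue" and gi: "integrable lebesgue (\<lambda>x. norm (g x) powr p)"
    using assms by (auto simp: Lp_def)
  have "(\<lambda>x. Re (g x)) \<in> borel_measurable lebesgue" "(\<lambda>x. Im (g x)) \<in> borel_measurable lebesgue"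
    by measurable
  from this[THEN completion_ex_borel_measurable_real]
  obtain a b where a: "a \<in> borel_measurable lborel" "AE x in lborel. Re (g x) = a x"
    and b: "b \<in> borel_measurable lborel" "AE x in lborel. Im (g x) = b x"
    by (elim bexE)
  define B where "B x = complex_of_real (a x) + \<i> * complex_of_real (b x)" for x
  have [measurable]: "B \<in> borel_measurable borel"
    using a(1) b(1) unfolding B_def[abs_def] by simp
  have eq: "AE x in lborel. g x = B x"
    using a(2) b(2) by eventually_elim (auto simp: B_def complex_eq_iff)
  have Bm: "(\<lambda>x. norm (B x) powr p) \<in> borel_measurable lborel" by measurable
  have "integrable lebesgue (\<lambda>x. norm (B x) powr p)"
  proof (rule integrable_cong_AE_imp[OF gi])
    show "(\<lambda>x. norm (B x) powr p) \<in> borel_measurable lebesgue" using Bm by (rule measurable_completion)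
    show "AE x in lebesgue. norm (g x) powr p = norm (B x) powr p"
      using AE_completion[OF eq] by eventually_elim simp
  qed
  then have "integrable lborel (\<lambda>x. norm (B x) powr p)"
    using integrable_completion[OF Bm] by simp
  then show ?thesis using eq by (intro that) auto
qed

lemma AE_reflect:
  fixes c :: "'a::euclidean_space"
  assumes "AE x in lborel. P x" shows "AE x in lborel. P (c - x)"
proof -
  from assms obtain N where N: "{x. \<not> P x} \<subseteq> N" "emeasure lborel N = 0" "N \<in> sets borel"
    by (auto elim!: AE_E)
  note N(3)[measurable]
  have "(\<integral>\<^sup>+x. indicator N (c - x) \<partial>lborel) = 0"
    using nn_integral_lborel_reflect[of "indicator N" c] N by simp
  then have "AE x in lborel. indicator N (c - x) = (0::ennreal)"
    by (subst (asm) nn_integral_0_iff_AE) auto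
  then show ?thesis by eventually_elim (use N(1) in \<open>auto split: split_indicator_asm\<close>)
qed

lemma AE_lborel_negligible:
  assumes "AE x in lborel. P x" shows "negligible {x. \<not> P x}"
proof -
  from assms obtain N where N: "{x. \<not> P x} \<subseteq> N" "emeasure lborel N = 0" "N \<in> sets borel"
    by (auto elim!: AE_E)
  then have "N \<in> null_sets lborel" by auto
  then have "N \<in> null_sets lebesgue" by (rule null_sets_completionI)
  then have "negligible N" by (simp add: negligible_iff_null_sets)
  then show ?thesis using N(1) by (rule negligible_subset)
qed

text \<open>
  Lebesgue measure on \<open>{0..t}\<close>, as a measure on all of \<open>\<real>\<close>, so that the families of them can be
  multiplied to measures on boxes of any set of coordinates.
\<close>

definition slab :: "real \<Rightarrow> real measure" where
  "slab t = density lborel (\<lambda>s. ennreal (indicator {0..t} s))"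

lemma space_slab [simp]: "space (slab t) = UNIV" and sets_slab [simp, measurable_cong]: "sets (slab t) = sets borel"
  by (auto simp: slab_def)

lemma emeasure_slab: "t \<ge> 0 \<Longrightarrow> A \<in> sets borel \<Longrightarrow> emeasure (slab t) A = emeasure lborel ({0..t} \<inter> A)"
  by (simp add: slab_def emeasure_density ennreal_indicator indicator_inter_arith[symmetric])

lemma finite_measure_slab: "finite_measure (slab t)"
proof
  have "emeasure (slab t) UNIV = emeasure lborel {0..t}"
    by (simp add: slab_def emeasure_density ennreal_indicator)
  then show "emeasure (slab t) (space (slab t)) \<noteq> \<infinity>"
    by (simp add: emeasure_lborel_Icc_eq)
qed

lemma integrable_slab_iff:
  fixes g :: "real \<Rightarrow> 'b::{banach, second_countable_topology}"
  assumes "g \<in> borel_measurable borel"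
  shows "integrable (slab t) g \<longleftrightarrow> set_integrable lborel {0..t} g"
  unfolding slab_def set_integrable_def using assms by (subst integrable_density) auto

lemma integral_slab:
  fixes g :: "real \<Rightarrow> 'b::{banach, second_countable_topology}"
  assumes "g \<in> borel_measurable borel"
  shows "integral\<^sup>L (slab t) g = (LBINT s:{0..t}. g s)"
  unfolding slab_def set_lebesgue_integral_def using assms by (subst integral_density) auto

interpretation slab: product_sigma_finite "\<lambda>j. slab (h j)" for h :: "'n \<Rightarrow> real"
  by (intro product_sigma_finite.intro finite_measure.axioms(1) finite_measure_slab)

abbreviation slabs :: "('n \<Rightarrow> real) \<Rightarrow> 'n set \<Rightarrow> ('n \<Rightarrow> real) measure" where
  "slabs h S \<equiv> Pi\<^sub>M S (\<lambda>j. slab (h j))"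

lemma measurable_corner [measurable]:
  "(\<lambda>\<omega>. corner \<omega> S) \<in> borel_measurable (slabs h S)"
proof -
  have "(\<lambda>\<omega>. if j \<in> S then \<omega> j else 0) \<in> borel_measurable (slabs h S)" for j
    using measurable_component_singleton[of j S "\<lambda>j. slab (h j)"]
    by (cases "j \<in> S") (auto cong: measurable_cong_sets)
  then have "\<forall>b\<in>Basis. (\<lambda>\<omega>. corner \<omega> S \<bullet> b) \<in> borel_measurable (slabs h S)"
    by (auto simp: Basis_vec_def inner_axis corner_def)
  then show ?thesis using borel_measurable_euclidean_space by blast
qed

lemma axis_continuous [continuous_intros]: "continuous_on A g \<Longrightarrow> continuous_on A (\<lambda>t. axis j (g t) :: real ^ 'n)"
  unfolding axis_def
proof (rule continuous_on_vec_lambda)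
  show "continuous_on A g \<Longrightarrow> continuous_on A (\<lambda>t. if i = j then g t else 0)" for i
    by (cases "i = j") simp_all
qed

lemma measurable_axis [measurable]: "(\<lambda>t. axis j t :: real ^ 'n) \<in> borel_measurable borel"
  by (intro borel_measurable_continuous_onI continuous_intros)

lemma emeasure_PiM_slab:
  fixes h :: "'n::finite \<Rightarrow> real"
  assumes "\<And>j. h j \<ge> 0"
  shows "emeasure (slabs h S) (space (slabs h S)) = ennreal (\<Prod>j\<in>S. h j)"
proof -
  interpret finite_product_sigma_finite "\<lambda>j. slab (h j)" S by standard simp
  have "emeasure (slabs h S) (Pi\<^sub>E S (\<lambda>_. UNIV)) = (\<Prod>j\<in>S. emeasure (slab (h j)) UNIV)"
    by (rule measure_times) auto
  also have "\<dots> = (\<Prod>j\<in>S. ennreal (h j))" using assms by (simp add: emeasure_slab)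
  also have "\<dots> = ennreal (\<Prod>j\<in>S. h j)" using assms by (simp add: prod_ennreal)
  finally show ?thesis by (simp add: space_PiM)
qed

lemma finite_measure_PiM_slab:
  fixes h :: "'n::finite \<Rightarrow> real"
  assumes "\<And>j. h j \<ge> 0"
  shows "finite_measure (slabs h S)"
  by standard (use emeasure_PiM_slab[of h S] assms in auto)

lemma measure_PiM_slab:
  fixes h :: "'n::finite \<Rightarrow> real"
  assumes "\<And>j. h j \<ge> 0"
  shows "measure (slabs h S) (space (slabs h S)) = (\<Prod>j\<in>S. h j)"
  unfolding measure_def emeasure_PiM_slab[OF assms] by (simp add: prod_nonneg assms)

lemma constant_from_rationals:
  fixes K :: "real \<Rightarrow> complex"
  assumes cont: "continuous_on {l..r} K" and lr: "l < r" and eq: "\<And>q. q \<in> \<rat> \<Longrightarrow> l < q \<Longrightarrow> q < r \<Longrightarrow> K q = v"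
  shows "K l = v" "K r = v"
proof -
  let ?C = "{x \<in> {l..r}. K x = v}"
  have cl: "closed ?C" using cont by (intro continuous_closed_preimage_constant) auto
  have "{l<..<r} \<subseteq> closure ({l<..<r} \<inter> \<rat>)"
    using open_Int_closure_subset[of "{l<..<r}" \<rat>] Rats_closure_real by auto
  also have "\<dots> \<subseteq> ?C" by (rule closure_minimal[OF _ cl]) (use eq in auto)
  finally have "closure {l<..<r} \<subseteq> ?C" using cl by (rule closure_minimal)
  then have "{l..r} \<subseteq> ?C" using lr by simp
  moreover have "l \<in> {l..r}" "r \<in> {l..r}" using lr by auto
  ultimately show "K l = v" "K r = v" by blast+
qed

text \<open>
  The function \<open>\<Psi>\<close> in the proof, \<open>U\<close> plus the indefinite integral of \<open>\<psi>\<close>, is continuous.  By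
  hypothesis it takes equal values at rational points that are not separated by \<open>c\<close>, so it is
  constant on both sides of \<open>c\<close>, and continuity at \<open>c\<close> joins the two constants.  Only countably many
  increments occur in the hypothesis, because each of them will be known only almost everywhere.
\<close>

lemma increment_across_exceptional_point:
  fixes U \<psi> :: "real \<Rightarrow> complex"
  assumes H: "H > 0" and U: "continuous_on {0..H} U" and \<psi>: "set_integrable lborel {0..H} \<psi>"
    and incr: "\<And>a b. a \<in> insert H \<rat> \<Longrightarrow> b \<in> insert H \<rat> \<Longrightarrow> 0 \<le> a \<Longrightarrow> a < b \<Longrightarrow> b \<le> H \<Longrightarrow> c \<notin> {a..b} \<Longrightarrow>
      U a - U b = (LBINT s:{a..b}. \<psi> s)"
  shows "U 0 - U H = (LBINT s:{0..H}. \<psi> s)"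
proof -
  have sub: "set_integrable lborel {a..b} \<psi>" if "0 \<le> a" "b \<le> H" for a b
    using \<psi> that by (auto intro: set_integrable_subset)
  have LI: "(LBINT s:{a..b}. \<psi> s) = integral {a..b} \<psi>" if "0 \<le> a" "b \<le> H" for a b
    by (rule set_borel_integral_eq_integral(2)[OF sub[OF that]])
  have int: "\<psi> integrable_on {0..H}" by (rule set_borel_integral_eq_integral(1)[OF \<psi>])
  define \<Psi> where "\<Psi> t = U t + integral {0..t} \<psi>" for t
  have cont: "continuous_on {0..H} \<Psi>"
    unfolding \<Psi>_def by (intro continuous_intros U indefinite_integral_continuous_1 int)
  have eq: "\<Psi> a = \<Psi> b"
    if "a \<in> insert H \<rat>" "b \<in> insert H \<rat>" "0 \<le> a" "a < b" "b \<le> H" "c \<notin> {a..b}" for a b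
  proof -
    have "integral {0..a} \<psi> + integral {a..b} \<psi> = integral {0..b} \<psi>"
      using that by (intro Henstock_Kurzweil_Integration.integral_combine integrable_subinterval_real[OF int]) auto
    then show ?thesis using incr[OF that] LI[of a b] that by (simp add: \<Psi>_def algebra_simps)
  qed
  have "\<Psi> 0 = \<Psi> H"
  proof (cases "c \<in> {0..H}")
    case False
    then show ?thesis using eq[of 0 H] H by auto
  next
    case True
    have "\<Psi> c = \<Psi> 0"
    proof (cases "c = 0")
      case False
      show ?thesis
      proof (rule constant_from_rationals(2))
        show "continuous_on {0..c} \<Psi>" using True by (intro continuous_on_subset[OF cont]) auto
        show "0 < c" using True False by simp
        show "\<Psi> q = \<Psi> 0" if "q \<in> \<rat>" "0 < q" "q < c" for q
          using eq[of 0 q] that True by simp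
      qed
    qed simp
    moreover have "\<Psi> c = \<Psi> H"
    proof (cases "c = H")
      case False
      show ?thesis
      proof (rule constant_from_rationals(1))
        show "continuous_on {c..H} \<Psi>" using True by (intro continuous_on_subset[OF cont]) auto
        show "c < H" using True False by simp
        show "\<Psi> q = \<Psi> H" if "q \<in> \<rat>" "c < q" "q < H" for q
          using eq[of q H] that True by simp
      qed
    qed simp
    ultimately show ?thesis by simp
  qed
  then show ?thesis using LI[of 0 H] by (simp add: \<Psi>_def algebra_simps)
qed

lemma upd_coord_diff_axis: "x - axis j t = upd_coord x j (x $ j - t)"
  by (auto simp: upd_coord_def axis_def vec_eq_iff)

lemma upd_coord_upd_coord: "upd_coord (upd_coord x j s) j t = upd_coord x j t"
  by (auto simp: upd_coord_def vec_eq_iff)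

text \<open>
  Along almost every line parallel to the \<open>j\<close>-th axis the derivative exists almost everywhere and its
  Borel version is integrable over bounded intervals.  The step must not cross \<open>x $ j = 0\<close>, where \<open>F\<close>
  need not be continuous.
\<close>

lemma difference_eq_integral_of_derivative:
  fixes F G :: "real ^ 'n \<Rightarrow> complex"
  assumes ac: "locally_ac_each_variable F"
    and der: "AE x in lborel. has_partial_derivative_at F j (G x) x"
    and F': "AE x in lborel. F x = F' x" and G': "AE x in lborel. G x = G' x"
    and [measurable]: "G' \<in> borel_measurable borel" and p: "p \<ge> 1" and int: "integrable lborel (\<lambda>x. norm (G' x) powr p)"
    and h: "h > 0"
  shows "AE x in lborel. 0 \<notin> {x $ j - h..x $ j} \<longrightarrow>
     F' x - F' (x - axis j h) = (\<integral>t. G' (x - axis j t) \<partial>slab h)"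
proof -
  have ae1: "AE x in lborel. AE t in lborel. has_partial_derivative_at F j (G (x - axis j t)) (x - axis j t) \<and>
      G (x - axis j t) = G' (x - axis j t)"
    using AE_translates[of lborel "\<lambda>t. axis j t" "\<lambda>x. has_partial_derivative_at F j (G x) x \<and> G x = G' x"]
      der G' lborel.sigma_finite_measure_axioms by simp
  have m[measurable]: "(\<lambda>t. G' (x - axis j t)) \<in> borel_measurable borel" for x by measurable
  have ae2: "AE x in lborel. integrable (slab h) (\<lambda>t. norm (G' (x - axis j t)) powr p)"
    by (rule AE_integrable_translates[OF finite_measure_slab _ _ int]) measurable
  from AE_off_axes ae1 ae2 F' AE_translate[OF F', of "axis j h"] show ?thesis
  proof (eventually_elim, intro impI)
    fix x assume x: "x \<in> off_axes"
      and 1: "AE t in lborel. has_partial_derivative_at F j (G (x - axis j t)) (x - axis j t) \<and> G (x - axis j t) = G' (x - axis j t)"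
      and 2: "integrable (slab h) (\<lambda>t. norm (G' (x - axis j t)) powr p)"
      and 3: "F x = F' x" and 4: "F (x - axis j h) = F' (x - axis j h)"
      and nc: "0 \<notin> {x $ j - h..x $ j}"
    define \<phi> where "\<phi> s = F (upd_coord x j s)" for s
    define \<psi> where "\<psi> s = G' (upd_coord x j s)" for s
    have \<psi>t: "\<psi> s = G' (x - axis j (x $ j - s))" for s by (simp add: \<psi>_def upd_coord_diff_axis)
    have [measurable]: "\<psi> \<in> borel_measurable borel" unfolding \<psi>t by measurable
    have "AE t in lborel. (\<phi> has_vector_derivative \<psi> (x $ j - t)) (at (x $ j - t))"
      using 1
    proof eventually_elim
      case (elim t)
      then have "has_partial_derivative_at F j (G' (x - axis j t)) (x - axis j t)" by metis
      then show ?case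
        by (simp add: has_partial_derivative_at_def upd_coord_diff_axis upd_coord_upd_coord \<phi>_def[abs_def] \<psi>_def)
           (simp add: upd_coord_def)
    qed
    from AE_reflect[OF this, of "x $ j"]
    have "AE s in lborel. (\<phi> has_vector_derivative \<psi> s) (at s)" by simp
    then have neg: "negligible {s. \<not> (\<phi> has_vector_derivative \<psi> s) (at s)}" by (rule AE_lborel_negligible)
    have acx: "absolutely_continuous_on {x $ j - h..x $ j} \<phi>"
      using ac x nc unfolding locally_ac_each_variable_def \<phi>_def by blast
    have hi: "(\<psi> has_integral \<phi> (x $ j) - \<phi> (x $ j - h)) {x $ j - h..x $ j}"
      by (rule fundamental_theorem_of_calculus_absolutely_continuous[OF _ acx neg]) (use h in auto)
    have gi: "integrable (slab h) (\<lambda>t. G' (x - axis j t))"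
      by (rule integrable_powr_imp_integrable[OF finite_measure_slab _ p 2]) measurable
    then have "set_integrable lborel {0..h} (\<lambda>t. G' (x - axis j t))"
      by (simp add: integrable_slab_iff)
    then have "integrable lborel (\<lambda>t. indicator {0..h} t *\<^sub>R G' (x - axis j t))"
      by (simp add: set_integrable_def)
    then have r: "integrable lborel (\<lambda>s. indicator {0..h} (x $ j - s) *\<^sub>R G' (x - axis j (x $ j - s)))"
      by (subst lborel_integrable_reflect_iff)
    have ind: "indicator {0..h} (x $ j - s) = (indicator {x $ j - h..x $ j} s :: real)" for s
      by (auto simp: indicator_def)
    have si: "set_integrable lborel {x $ j - h..x $ j} \<psi>"
      using r unfolding ind \<psi>t[symmetric] set_integrable_def .
    have "(\<integral>t. G' (x - axis j t) \<partial>slab h) = (LBINT t. indicator {0..h} t *\<^sub>R G' (x - axis j t))"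
      by (simp add: integral_slab set_lebesgue_integral_def)
    also have "\<dots> = (LBINT s. indicator {0..h} (x $ j - s) *\<^sub>R G' (x - axis j (x $ j - s)))"
      by (rule lborel_integral_reflect[symmetric])
    also have "\<dots> = (LBINT s:{x $ j - h..x $ j}. \<psi> s)"
      unfolding ind \<psi>t[symmetric] set_lebesgue_integral_def ..
    also have "\<dots> = integral {x $ j - h..x $ j} \<psi>"
      by (rule set_borel_integral_eq_integral(2)[OF si])
    also have "\<dots> = \<phi> (x $ j) - \<phi> (x $ j - h)" using hi by (rule integral_unique)
    also have "\<dots> = F x - F (x - axis j h)"
    proof -
      have "upd_coord x j (x $ j) = x" by (simp add: upd_coord_def vec_eq_iff)
      then show ?thesis by (simp add: \<phi>_def upd_coord_diff_axis)
    qed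
    finally show "F' x - F' (x - axis j h) = (\<integral>t. G' (x - axis j t) \<partial>slab h)" using 3 4 by simp
  qed
qed

section \<open>Mixed differences as integrals of mixed derivatives\<close>

lemma integral_slab_subinterval:
  fixes k :: "real \<Rightarrow> complex"
  assumes [measurable]: "k \<in> borel_measurable borel" and ab: "0 \<le> a" "b \<le> H"
  shows "(\<integral>s. indicator {a..b} s *\<^sub>R k s \<partial>slab H) = (LBINT s:{a..b}. k s)"
proof -
  have "indicator {0..H} s * indicator {a..b} s = (indicator {a..b} s :: real)" for s
    using ab by (auto simp: indicator_def)
  moreover have "(\<lambda>s. indicator {a..b} s *\<^sub>R k s) \<in> borel_measurable borel" by measurable
  ultimately show ?thesis by (simp only: integral_slab set_lebesgue_integral_def scaleR_scaleR)
qed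

lemma integral_slab_translate:
  fixes k :: "real \<Rightarrow> complex"
  assumes [measurable]: "k \<in> borel_measurable borel"
  shows "(\<integral>t. k (a + t) \<partial>slab (b - a)) = (LBINT s:{a..b}. k s)"
proof -
  have ind: "indicator {a..b} (t + a) = (indicator {0..b - a} t :: real)" for t
    by (auto simp: indicator_def)
  have "(LBINT s:{a..b}. k s) = (LBINT t. indicator {a..b} (t + a) *\<^sub>R k (t + a))"
    unfolding set_lebesgue_integral_def by (rule lborel_integral_translate[symmetric])
  then show ?thesis unfolding ind by (simp add: integral_slab set_lebesgue_integral_def add.commute)
qed

text \<open>
  One more variable \<open>j\<close> is added to the set \<open>S\<close>.  While the step in the \<open>j\<close>-th variable does not cross
  \<open>0\<close>, it suffices to apply the formula for \<open>G\<close> and \<open>G'\<close> under the integral (the claim \<open>NC\<close>).  This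
  formula fails when the step crosses \<open>0\<close>, since \<open>G\<close> could jump.  But the difference \<open>u\<close> of \<open>f\<close>
  in the variables of \<open>S\<close> is continuous, and \<open>increment_across_exceptional_point\<close> carries the formula
  for \<open>u\<close> over the point \<open>0\<close>.
\<close>

lemma mixed_difference_step:
  fixes f G G' :: "real ^ 'n \<Rightarrow> complex"
  assumes f: "continuous_on UNIV f" and h: "\<And>j. h j > 0" and jS: "j \<notin> S"
    and [measurable]: "G \<in> borel_measurable borel" "G' \<in> borel_measurable borel"
    and p: "p \<ge> 1" "integrable lborel (\<lambda>x. norm (G x) powr p)"
    and p': "p' \<ge> 1" "integrable lborel (\<lambda>x. norm (G' x) powr p')"
    and step: "\<And>d. d > 0 \<Longrightarrow> AE x in lborel. 0 \<notin> {x $ j - d..x $ j} \<longrightarrow>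
      G x - G (x - axis j d) = (\<integral>t. G' (x - axis j t) \<partial>slab d)"
    and IH: "AE x in lborel. mixed_diff h S f x = (\<integral>\<omega>. G (x - corner \<omega> S) \<partial>slabs h S)"
  shows "AE x in lborel. mixed_diff h (insert j S) f x
    = (\<integral>\<omega>. G' (x - corner \<omega> (insert j S)) \<partial>slabs h (insert j S))"
proof -
  let ?z = "\<lambda>\<omega> a. corner \<omega> S + axis j a :: real ^ 'n"
  have h': "h j \<ge> 0" for j using h[of j] by simp
  define M where "M = slabs h S"
  define H where "H = h j"
  have H: "H > 0" using h by (simp add: H_def)
  define u where "u = mixed_diff h S f"
  have u: "continuous_on UNIV u" unfolding u_def by (rule continuous_mixed_diff[OF f])
  have finM: "finite_measure M" unfolding M_def by (rule finite_measure_PiM_slab[OF h'])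
  interpret M: finite_measure M by (rule finM)
  interpret sl: finite_measure "slab H" by (rule finite_measure_slab)
  interpret P: pair_sigma_finite M "slab H" ..
  have finP: "finite_measure (M \<Otimes>\<^sub>M slab H)"
    by (rule finite_measure_pair_measure[OF finite_measure_slab finM])
  have sh[measurable]: "(\<lambda>\<omega>. corner \<omega> S) \<in> borel_measurable M" unfolding M_def by (rule measurable_corner)
  have A: "AE x in lborel. integrable (M \<Otimes>\<^sub>M slab H) (\<lambda>(\<omega>, s). G' (x - ?z \<omega> s))"
  proof -
    have "AE x in lborel. integrable (M \<Otimes>\<^sub>M slab H) (\<lambda>z. norm (G' (x - (corner (fst z) S + axis j (snd z)))) powr p')"
      by (rule AE_integrable_translates[OF finP _ _ p'(2)]) measurable
    then show ?thesis
    proof eventually_elim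
      case (elim x)
      then have "integrable (M \<Otimes>\<^sub>M slab H) (\<lambda>z. G' (x - (corner (fst z) S + axis j (snd z))))"
        by (intro integrable_powr_imp_integrable[OF finP _ p'(1)]) measurable
      then show ?case by (simp add: case_prod_unfold)
    qed
  qed
  have B: "AE x in lborel. integrable (slabs h (insert j S)) (\<lambda>\<omega>. G' (x - corner \<omega> (insert j S)))"
  proof -
    have fi: "finite_measure (slabs h (insert j S))" by (rule finite_measure_PiM_slab[OF h'])
    have "AE x in lborel. integrable (slabs h (insert j S)) (\<lambda>\<omega>. norm (G' (x - corner \<omega> (insert j S))) powr p')"
      by (rule AE_integrable_translates[OF fi _ _ p'(2)]) measurable
    then show ?thesis
      by eventually_elim (intro integrable_powr_imp_integrable[OF fi _ p'(1)], measurable)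
  qed
  have NC: "AE x in lborel. x $ j \<notin> {a..b} \<longrightarrow> u (x - axis j a) - u (x - axis j b)
      = (\<integral>\<omega>. \<integral>t. G' (x - ?z \<omega> (a + t)) \<partial>slab (b - a) \<partial>M)" if ab: "a < b" for a b
  proof -
    have ca: "AE x in lborel. integrable M (\<lambda>\<omega>. G (x - ?z \<omega> c))" for c
    proof -
      have "AE x in lborel. integrable M (\<lambda>\<omega>. norm (G (x - ?z \<omega> c)) powr p)"
        by (rule AE_integrable_translates[OF finM _ _ p(2)]) measurable
      then show ?thesis
        by eventually_elim (intro integrable_powr_imp_integrable[OF finM _ p(1)], measurable)
    qed
    have ea: "AE x in lborel. u (x - axis j c) = (\<integral>\<omega>. G (x - ?z \<omega> c) \<partial>M)" for c
      using AE_translate[OF IH, of "axis j c"] unfolding u_def M_def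
      by (simp add: diff_diff_eq add.commute)
    have st: "AE x in lborel. AE \<omega> in M. 0 \<notin> {(x - ?z \<omega> a) $ j - (b - a)..(x - ?z \<omega> a) $ j} \<longrightarrow>
      G (x - ?z \<omega> a) - G (x - ?z \<omega> a - axis j (b - a))
      = (\<integral>t. G' (x - ?z \<omega> a - axis j t) \<partial>slab (b - a))"
      by (rule AE_translates[OF M.sigma_finite_measure_axioms _ step]) (use ab in auto)
    from ca[of a] ca[of b] ea[of a] ea[of b] st show ?thesis
    proof (eventually_elim, intro impI)
      fix x
      assume i: "integrable M (\<lambda>\<omega>. G (x - ?z \<omega> a))" "integrable M (\<lambda>\<omega>. G (x - ?z \<omega> b))"
        and e: "u (x - axis j a) = (\<integral>\<omega>. G (x - ?z \<omega> a) \<partial>M)"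
           "u (x - axis j b) = (\<integral>\<omega>. G (x - ?z \<omega> b) \<partial>M)"
        and s: "AE \<omega> in M. 0 \<notin> {(x - ?z \<omega> a) $ j - (b - a)..(x - ?z \<omega> a) $ j} \<longrightarrow>
          G (x - ?z \<omega> a) - G (x - ?z \<omega> a - axis j (b - a))
          = (\<integral>t. G' (x - ?z \<omega> a - axis j t) \<partial>slab (b - a))"
        and nc: "x $ j \<notin> {a..b}"
      have ax: "axis j a + axis j t = (axis j (a + t) :: real^'n)" for t by (simp add: vec_eq_iff axis_def)
      have xj: "(x - ?z \<omega> a) $ j = x $ j - a" for \<omega>
        using jS by (simp add: corner_def axis_def)
      have "u (x - axis j a) - u (x - axis j b) = (\<integral>\<omega>. G (x - ?z \<omega> a) - G (x - ?z \<omega> b) \<partial>M)"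
        unfolding e using i by (rule Bochner_Integration.integral_diff[symmetric])
      also have "\<dots> = (\<integral>\<omega>. \<integral>t. G' (x - ?z \<omega> (a + t)) \<partial>slab (b - a) \<partial>M)"
      proof (rule integral_cong_AE)
        have [measurable]: "(\<lambda>(\<omega>, t). G' (x - ?z \<omega> (a + t))) \<in> borel_measurable (M \<Otimes>\<^sub>M slab (b - a))"
          by measurable
        interpret sb: finite_measure "slab (b - a)" by (rule finite_measure_slab)
        show "(\<lambda>\<omega>. \<integral>t. G' (x - ?z \<omega> (a + t)) \<partial>slab (b - a)) \<in> borel_measurable M"
          by measurable
        show "AE \<omega> in M. G (x - ?z \<omega> a) - G (x - ?z \<omega> b)
           = (\<integral>t. G' (x - ?z \<omega> (a + t)) \<partial>slab (b - a))"
          using s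
        proof eventually_elim
          case (elim \<omega>)
          have "0 \<notin> {(x - ?z \<omega> a) $ j - (b - a)..(x - ?z \<omega> a) $ j}"
            unfolding xj using nc by auto
          with elim show ?case using ax[of "b - a"] ax by (simp add: diff_diff_eq add.assoc)
        qed
      qed measurable
      finally show "u (x - axis j a) - u (x - axis j b)
        = (\<integral>\<omega>. \<integral>t. G' (x - ?z \<omega> (a + t)) \<partial>slab (b - a) \<partial>M)" .
    qed
  qed
  \<comment> \<open>one null set for all rational endpoints; \<open>H\<close> itself may be irrational\<close>
  have C: "AE x in lborel. \<forall>ab\<in>insert H \<rat> \<times> insert H \<rat>. fst ab < snd ab \<longrightarrow> x $ j \<notin> {fst ab..snd ab} \<longrightarrow>
      u (x - axis j (fst ab)) - u (x - axis j (snd ab))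
      = (\<integral>\<omega>. \<integral>t. G' (x - (corner \<omega> S + axis j (fst ab + t))) \<partial>slab (snd ab - fst ab) \<partial>M)"
  proof (rule AE_ball_countable[THEN iffD2])
    show "countable (insert H \<rat> \<times> insert H \<rat>)" by (simp add: countable_rat)
    show "\<forall>ab\<in>insert H \<rat> \<times> insert H \<rat>. AE x in lborel. fst ab < snd ab \<longrightarrow> x $ j \<notin> {fst ab..snd ab} \<longrightarrow>
      u (x - axis j (fst ab)) - u (x - axis j (snd ab))
      = (\<integral>\<omega>. \<integral>t. G' (x - (corner \<omega> S + axis j (fst ab + t))) \<partial>slab (snd ab - fst ab) \<partial>M)"
      using NC by auto
  qed
  from A B C show ?thesis
  proof eventually_elim
    case (elim x)
    define g where "g \<omega> s = G' (x - ?z \<omega> s)" for \<omega> s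
    have gi: "integrable (M \<Otimes>\<^sub>M slab H) (case_prod g)" using elim(1) unfolding g_def .
    have gm2: "(\<lambda>s. g \<omega> s) \<in> borel_measurable borel" for \<omega> unfolding g_def by measurable
    define \<psi> where "\<psi> s = (\<integral>\<omega>. g \<omega> s \<partial>M)" for s
    have \<psi>m[measurable]: "\<psi> \<in> borel_measurable borel"
    proof -
      have "(\<lambda>(s, \<omega>). g \<omega> s) \<in> borel_measurable (borel \<Otimes>\<^sub>M M)" unfolding g_def by measurable
      then show ?thesis unfolding \<psi>_def[abs_def] by (rule M.borel_measurable_lebesgue_integral)
    qed
    have \<psi>i: "set_integrable lborel {0..H} \<psi>"
      using P.integrable_snd[OF gi] unfolding \<psi>_def[symmetric, abs_def] by (simp add: integrable_slab_iff)
    have fub: "(\<integral>\<omega>. (LBINT s:{a..b}. g \<omega> s) \<partial>M) = (LBINT s:{a..b}. \<psi> s)" if "0 \<le> a" "b \<le> H" for a b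
    proof -
      have ii: "integrable (M \<Otimes>\<^sub>M slab H) (\<lambda>(\<omega>, s). indicator {a..b} s *\<^sub>R g \<omega> s)"
      proof (rule Bochner_Integration.integrable_bound[OF gi])
        have "case_prod g \<in> borel_measurable (M \<Otimes>\<^sub>M slab H)" using gi by auto
        then have [measurable]: "(\<lambda>z. g (fst z) (snd z)) \<in> borel_measurable (M \<Otimes>\<^sub>M slab H)" by (simp add: case_prod_unfold)
        show "(\<lambda>(\<omega>, s). indicator {a..b} s *\<^sub>R g \<omega> s) \<in> borel_measurable (M \<Otimes>\<^sub>M slab H)"
          unfolding case_prod_unfold by measurable
        show "AE z in M \<Otimes>\<^sub>M slab H. norm (case z of (\<omega>, s) \<Rightarrow> indicator {a..b} s *\<^sub>R g \<omega> s) \<le> norm (case z of (\<omega>, s) \<Rightarrow> g \<omega> s)"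
          by (intro AE_I2) (auto simp: indicator_def)
      qed
      have "(\<integral>\<omega>. (LBINT s:{a..b}. g \<omega> s) \<partial>M) = (\<integral>\<omega>. (\<integral>s. indicator {a..b} s *\<^sub>R g \<omega> s \<partial>slab H) \<partial>M)"
        using integral_slab_subinterval[OF gm2 that] by simp
      also have "\<dots> = (\<integral>s. (\<integral>\<omega>. indicator {a..b} s *\<^sub>R g \<omega> s \<partial>M) \<partial>slab H)"
        by (rule P.Fubini_integral[OF ii, symmetric])
      also have "\<dots> = (\<integral>s. indicator {a..b} s *\<^sub>R \<psi> s \<partial>slab H)" by (simp add: \<psi>_def)
      also have "\<dots> = (LBINT s:{a..b}. \<psi> s)" by (rule integral_slab_subinterval[OF \<psi>m that])
      finally show ?thesis .
    qed
    have "u (x - axis j 0) - u (x - axis j H) = (LBINT s:{0..H}. \<psi> s)"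
    proof (rule increment_across_exceptional_point[OF H _ \<psi>i])
      show "continuous_on {0..H} (\<lambda>t. u (x - axis j t))"
        by (intro continuous_on_compose2[OF u] continuous_intros) auto
      fix a b assume ab: "a \<in> insert H \<rat>" "b \<in> insert H \<rat>" "0 \<le> a" "a < b" "b \<le> H" "x $ j \<notin> {a..b}"
      have "u (x - axis j a) - u (x - axis j b) = (\<integral>\<omega>. \<integral>t. g \<omega> (a + t) \<partial>slab (b - a) \<partial>M)"
        using bspec[OF elim(3), of "(a, b)"] ab unfolding g_def by simp
      also have "\<dots> = (\<integral>\<omega>. (LBINT s:{a..b}. g \<omega> s) \<partial>M)"
        by (simp add: integral_slab_translate[OF gm2])
      also have "\<dots> = (LBINT s:{a..b}. \<psi> s)" using ab by (intro fub) auto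
      finally show "u (x - axis j a) - u (x - axis j b) = (LBINT s:{a..b}. \<psi> s)" .
    qed
    also have "(LBINT s:{0..H}. \<psi> s) = (\<integral>\<omega>. (LBINT s:{0..H}. g \<omega> s) \<partial>M)"
      by (rule fub[symmetric]) auto
    also have "\<dots> = (\<integral>\<omega>. (\<integral>s. g \<omega> s \<partial>slab H) \<partial>M)" by (simp add: integral_slab[OF gm2])
    also have "\<dots> = (\<integral>\<omega>. G' (x - corner \<omega> (insert j S)) \<partial>slabs h (insert j S))"
    proof -
      have upd: "corner (fun_upd \<omega> j y) (insert j S) = corner \<omega> S + axis j y" for \<omega> :: "'n \<Rightarrow> real" and y
        using jS by (auto simp: corner_def axis_def vec_eq_iff)
      show ?thesis
        by (subst slab.product_integral_insert[OF _ jS elim(2)]) (simp_all add: upd g_def[abs_def] M_def H_def)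
    qed
    moreover have "axis j (0::real) = (0 :: real^'n)" by (simp add: axis_def vec_eq_iff)
    ultimately show ?case
      unfolding mixed_diff_insert[OF jS] u_def[symmetric] H_def by simp
  qed
qed

text \<open>
  Induction on \<open>S\<close>, along whatever order of differentiation produced the derivatives.
\<close>

lemma mixed_difference_integral:
  fixes f :: "real ^ 'n \<Rightarrow> complex" and B :: "'n set \<Rightarrow> real ^ 'n \<Rightarrow> complex"
  assumes f: "continuous_on UNIV f" and B0: "B {} = f" and Bm: "\<And>S. B S \<in> borel_measurable borel"
    and p: "\<And>S. p S \<ge> 1" and int: "\<And>S. integrable lborel (\<lambda>x. norm (B S x) powr p S)"
    and step: "\<And>S. S \<noteq> {} \<Longrightarrow> \<exists>j\<in>S. \<forall>d>0. AE x in lborel. 0 \<notin> {x $ j - d..x $ j} \<longrightarrow>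
      B (S - {j}) x - B (S - {j}) (x - axis j d) = (\<integral>t. B S (x - axis j t) \<partial>slab d)"
    and h: "\<And>j. h j > 0"
  shows "AE x in lborel. mixed_diff h S f x = (\<integral>\<omega>. B S (x - corner \<omega> S) \<partial>slabs h S)"
proof -
  have "finite S" by simp
  then show ?thesis
  proof (induction S rule: finite_psubset_induct)
    case (psubset S)
    show ?case
    proof (cases "S = {}")
      case True
      have "measure (slabs h {}) (space (slabs h {})) = 1"
        using measure_PiM_slab[of h "{}"] h by (simp add: less_imp_le)
      then show ?thesis by (simp add: True B0)
    next
      case False
      then obtain j where j: "j \<in> S" and st: "\<And>d. d > 0 \<Longrightarrow> AE x in lborel. 0 \<notin> {x $ j - d..x $ j} \<longrightarrow>
        B (S - {j}) x - B (S - {j}) (x - axis j d) = (\<integral>t. B S (x - axis j t) \<partial>slab d)"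
        using step by blast
      have eq: "insert j (S - {j}) = S" using j by auto
      have IH: "AE x in lborel. mixed_diff h (S - {j}) f x = (\<integral>\<omega>. B (S - {j}) (x - corner \<omega> (S - {j})) \<partial>slabs h (S - {j}))"
        by (rule psubset.IH) (use j in auto)
      have "AE x in lborel. mixed_diff h (insert j (S - {j})) f x
        = (\<integral>\<omega>. B S (x - corner \<omega> (insert j (S - {j}))) \<partial>slabs h (insert j (S - {j})))"
        by (rule mixed_difference_step[OF f h _ Bm Bm p int p int st IH]) simp_all
      then show ?thesis unfolding eq .
    qed
  qed
qed

text \<open>
  Minkowski's inequality for the average over a box, in the form of \<open>power_mean_inequality\<close>
  followed by Fubini's theorem and translation invariance.
\<close>

lemma mixed_diff_Lp_le_derivative:
  fixes f B :: "real ^ 'n \<Rightarrow> complex"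
  assumes rep: "AE x in lborel. mixed_diff h S f x = (\<integral>\<omega>. B (x - corner \<omega> S) \<partial>slabs h S)"
    and [measurable]: "B \<in> borel_measurable borel" and p: "p \<ge> 1" and int: "integrable lborel (\<lambda>x. norm (B x) powr p)"
    and h: "\<And>j. h j > 0"
  shows "(\<integral>\<^sup>+x. ennreal (norm (mixed_diff h S f x) powr p) \<partial>lborel)
     \<le> ennreal ((\<Prod>j\<in>S. h j) powr p * (LBINT x. norm (B x) powr p))"
proof -
  have h': "h j \<ge> 0" for j using h[of j] by simp
  define M where "M = slabs h S"
  define m where "m = (\<Prod>j\<in>S. h j)"
  have m: "m > 0" unfolding m_def by (intro prod_pos) (simp add: h)
  have finM: "finite_measure M" unfolding M_def by (rule finite_measure_PiM_slab[OF h'])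
  interpret M: finite_measure M by (rule finM)
  have [measurable]: "(\<lambda>\<omega>. corner \<omega> S) \<in> borel_measurable M" unfolding M_def by (rule measurable_corner)
  have mM: "measure M (space M) = m" unfolding M_def m_def by (rule measure_PiM_slab[OF h'])
  have eM: "emeasure M (space M) = ennreal m" using mM by (simp add: M.emeasure_eq_measure)
  have ae: "AE x in lborel. integrable M (\<lambda>\<omega>. norm (B (x - corner \<omega> S)) powr p)"
    by (rule AE_integrable_translates[OF finM _ _ int]) measurable
  have "(\<integral>\<^sup>+x. ennreal (norm (mixed_diff h S f x) powr p) \<partial>lborel)
     \<le> (\<integral>\<^sup>+x. ennreal (m powr (p - 1)) * (\<integral>\<^sup>+\<omega>. ennreal (norm (B (x - corner \<omega> S)) powr p) \<partial>M) \<partial>lborel)"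
  proof (rule nn_integral_mono_AE)
    from rep ae show "AE x in lborel. ennreal (norm (mixed_diff h S f x) powr p)
       \<le> ennreal (m powr (p - 1)) * (\<integral>\<^sup>+\<omega>. ennreal (norm (B (x - corner \<omega> S)) powr p) \<partial>M)"
    proof eventually_elim
      case (elim x)
      have "norm (mixed_diff h S f x) powr p \<le> m powr (p - 1) * (\<integral>\<omega>. norm (B (x - corner \<omega> S)) powr p \<partial>M)"
        unfolding elim(1) M_def[symmetric] mM[symmetric]
        by (rule power_mean_inequality[OF finM _ _ p elim(2)]) (use mM m in auto)
      then have "ennreal (norm (mixed_diff h S f x) powr p) \<le> ennreal (m powr (p - 1) * (\<integral>\<omega>. norm (B (x - corner \<omega> S)) powr p \<partial>M))"
        by (rule ennreal_leI)
      also have "\<dots> = ennreal (m powr (p - 1)) * ennreal (\<integral>\<omega>. norm (B (x - corner \<omega> S)) powr p \<partial>M)"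
        by (rule ennreal_mult') simp
      also have "ennreal (\<integral>\<omega>. norm (B (x - corner \<omega> S)) powr p \<partial>M) = (\<integral>\<^sup>+\<omega>. ennreal (norm (B (x - corner \<omega> S)) powr p) \<partial>M)"
        by (rule nn_integral_eq_integral[symmetric, OF elim(2)]) simp
      finally show ?case .
    qed
  qed
  also have "\<dots> = ennreal (m powr (p - 1)) * (ennreal m * (\<integral>\<^sup>+x. ennreal (norm (B x) powr p) \<partial>lborel))"
    by (subst nn_integral_cmult)
       (simp_all add: eM nn_integral_translates[OF M.sigma_finite_measure_axioms, of "\<lambda>x. ennreal (norm (B x) powr p)"])
  also have "(\<integral>\<^sup>+x. ennreal (norm (B x) powr p) \<partial>lborel) = ennreal (LBINT x. norm (B x) powr p)"
    by (rule nn_integral_eq_integral[OF int]) simp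
  also have "ennreal (m powr (p - 1)) * (ennreal m * ennreal (LBINT x. norm (B x) powr p))
      = ennreal (m powr (p - 1) * m * (LBINT x. norm (B x) powr p))"
    using m by (simp add: ennreal_mult' mult.assoc)
  also have "m powr (p - 1) * m = m powr p"
    using m by (simp add: powr_diff)
  finally show ?thesis unfolding m_def .
qed

text \<open>
  Each further difference is a difference of two translates and so loses only a constant factor.
  This leads from the difference in the variables of \<open>S\<close> to the one in all variables.
\<close>

lemma mixed_diff_Lp_le_partial:
  fixes f :: "real ^ 'n \<Rightarrow> complex"
  assumes f: "continuous_on UNIV f" and p: "p \<ge> 1" and "S \<inter> T = {}"
  shows "(\<integral>\<^sup>+x. ennreal (norm (mixed_diff h (T \<union> S) f x) powr p) \<partial>lborel)
     \<le> ennreal ((2 * 2 powr p) ^ card T) * (\<integral>\<^sup>+x. ennreal (norm (mixed_diff h S f x) powr p) \<partial>lborel)"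
proof -
  have [measurable]: "mixed_diff h S f \<in> borel_measurable borel" for S
    using continuous_mixed_diff[OF f] by (rule borel_measurable_continuous_onI)
  have "finite T" by simp
  then show ?thesis using assms(3)
  proof (induction T rule: finite_induct)
    case (insert j T)
    then have j: "j \<notin> T \<union> S" by auto
    let ?g = "\<lambda>x. mixed_diff h (T \<union> S) f x"
    let ?N = "\<integral>\<^sup>+x. ennreal (norm (?g x) powr p) \<partial>lborel"
    have "(\<integral>\<^sup>+x. ennreal (norm (mixed_diff h (insert j (T \<union> S)) f x) powr p) \<partial>lborel)
      \<le> (\<integral>\<^sup>+x. ennreal (2 powr p) * (ennreal (norm (?g x) powr p) + ennreal (norm (?g (x - axis j (h j))) powr p)) \<partial>lborel)"
    proof (rule nn_integral_mono)
      fix x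
      let ?a = "norm (?g x)" and ?b = "norm (?g (x - axis j (h j)))"
      have "norm (?g x - ?g (x - axis j (h j))) \<le> 2 * max ?a ?b"
        using norm_triangle_ineq4[of "?g x" "?g (x - axis j (h j))"] by linarith
      then have "norm (?g x - ?g (x - axis j (h j))) powr p \<le> (2 * max ?a ?b) powr p"
        using p by (intro powr_mono2) auto
      also have "\<dots> = 2 powr p * (max ?a ?b) powr p" by (simp add: powr_mult)
      also have "\<dots> \<le> 2 powr p * (?a powr p + ?b powr p)"
        by (intro mult_left_mono) (auto simp: max_def)
      finally have "ennreal (norm (?g x - ?g (x - axis j (h j))) powr p) \<le> ennreal (2 powr p * (?a powr p + ?b powr p))"
        by (rule ennreal_leI)
      then show "ennreal (norm (mixed_diff h (insert j (T \<union> S)) f x) powr p)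
        \<le> ennreal (2 powr p) * (ennreal (?a powr p) + ennreal (?b powr p))"
        by (simp add: mixed_diff_insert[OF j] ennreal_mult' ennreal_plus)
    qed
    also have "\<dots> = ennreal (2 powr p) * (?N + (\<integral>\<^sup>+x. ennreal (norm (?g (x - axis j (h j))) powr p) \<partial>lborel))"
      by (simp add: nn_integral_cmult nn_integral_add)
    also have "(\<integral>\<^sup>+x. ennreal (norm (?g (x - axis j (h j))) powr p) \<partial>lborel) = ?N"
      using nn_integral_lborel_translate[of "\<lambda>x. ennreal (norm (?g x) powr p)" "- axis j (h j)"] by simp
    also have "ennreal (2 powr p) * (?N + ?N) = ennreal (2 * 2 powr p) * ?N"
      by (simp add: ennreal_mult' mult_ac flip: mult_2)
    also have "\<dots> \<le> ennreal (2 * 2 powr p) * (ennreal ((2 * 2 powr p) ^ card T) * (\<integral>\<^sup>+x. ennreal (norm (mixed_diff h S f x) powr p) \<partial>lborel))"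
      using insert by (intro mult_left_mono) auto
    also have "\<dots> = ennreal ((2 * 2 powr p) ^ card (insert j T)) * (\<integral>\<^sup>+x. ennreal (norm (mixed_diff h S f x) powr p) \<partial>lborel)"
      using insert by (simp add: ennreal_mult'[symmetric] mult.assoc[symmetric])
    finally show ?case by simp
  qed simp
qed

lemma distr_PiM_slab:
  fixes h :: "'n::finite \<Rightarrow> real"
  shows "density lborel (indicator (cbox (0 :: real ^ 'n) (\<chi> j. h j)))
     = distr (slabs h UNIV) borel (\<lambda>\<omega>. \<chi> j. \<omega> j)"
proof (rule distr_PiM_vec_eqI)
  interpret product_sigma_finite "\<lambda>_::'n. lborel::real measure" ..
  let ?N = "density lborel (indicator (cbox (0 :: real ^ 'n) (\<chi> j. h j)))"
  have eq: "emeasure ?N (box l u) = emeasure lborel (cbox (0 :: real^'n) (\<chi> j. h j) \<inter> box l u)" for l u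
    by (simp add: emeasure_density indicator_inter_arith[symmetric])
  show "emeasure ?N (box l u) \<noteq> \<infinity>" for l u
  proof -
    have "emeasure lborel (cbox (0 :: real^'n) (\<chi> j. h j) \<inter> box l u) \<le> emeasure lborel (box l u)"
      by (intro emeasure_mono) auto
    also have "\<dots> < \<infinity>" by (simp add: emeasure_bounded_finite[unfolded infinity_ennreal_def] bounded_box)
    finally show ?thesis unfolding eq by simp
  qed
  fix l u :: "real ^ 'n"
  let ?A = "\<lambda>i. {0..h i} \<inter> {l $ i<..<u $ i}"
  have m: "(\<lambda>w. \<chi> i. w i) \<in> borel_measurable (Pi\<^sub>M (UNIV::'n set) (\<lambda>_. lborel::real measure))"
    by (rule measurable_vec_of_fun) simp
  have "emeasure ?N (box l u) = emeasure (distr (Pi\<^sub>M UNIV (\<lambda>_. lborel)) borel (\<lambda>w. \<chi> i. w i)) (cbox (0 :: real^'n) (\<chi> j. h j) \<inter> box l u)"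
    unfolding eq by (subst lborel_vec_eq_distr) simp
  also have "\<dots> = emeasure (Pi\<^sub>M UNIV (\<lambda>_. lborel)) (Pi\<^sub>E UNIV ?A)"
  proof -
    have "(\<lambda>w. \<chi> i. w i) -` (cbox (0 :: real^'n) (\<chi> j. h j) \<inter> box l u) \<inter> space (Pi\<^sub>M UNIV (\<lambda>_. lborel)) = Pi\<^sub>E UNIV ?A"
      by (auto simp: mem_box_cart space_PiM PiE_iff)
    then show ?thesis by (simp add: emeasure_distr[OF m])
  qed
  also have "\<dots> = (\<Prod>i\<in>UNIV. emeasure lborel (?A i))" by (rule emeasure_PiM) auto
  also have "\<dots> = (\<Prod>i\<in>UNIV. emeasure (slab (h i)) {l $ i<..<u $ i})"
    by (simp add: slab_def emeasure_density ennreal_indicator indicator_inter_arith[symmetric])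
  finally show "emeasure ?N (box l u) = (\<Prod>i\<in>UNIV. emeasure (slab (h i)) {l $ i<..<u $ i})" .
qed (auto intro: finite_measure.axioms(1) finite_measure_slab)

text \<open>
  When the box has full dimension, the average over it is bounded by Hoelder's inequality through the
  integral over the whole space, uniformly in \<open>x\<close>.
\<close>

lemma mixed_diff_sup_le:
  fixes f B :: "real ^ 'n \<Rightarrow> complex"
  assumes rep: "AE x in lborel. mixed_diff h UNIV f x = (\<integral>\<omega>. B (x - corner \<omega> UNIV) \<partial>slabs h UNIV)"
    and [measurable]: "B \<in> borel_measurable borel" and p: "p \<ge> 1" and int: "integrable lborel (\<lambda>x. norm (B x) powr p)"
    and h: "\<And>j. h j > 0"
  shows "AE x in lborel. norm (mixed_diff h UNIV f x) powr p \<le> (\<Prod>j\<in>UNIV. h j) powr (p - 1) * (LBINT x. norm (B x) powr p)"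
proof -
  have h': "h j \<ge> 0" for j using h[of j] by simp
  define M where "M = slabs h UNIV"
  define m where "m = (\<Prod>j\<in>UNIV. h j)"
  have m: "m > 0" unfolding m_def by (intro prod_pos) (simp add: h)
  have finM: "finite_measure M" unfolding M_def by (rule finite_measure_PiM_slab[OF h'])
  interpret M: finite_measure M by (rule finM)
  have sh[measurable]: "(\<lambda>\<omega>. corner \<omega> UNIV) \<in> borel_measurable M" unfolding M_def by (rule measurable_corner)
  have mM: "measure M (space M) = m" unfolding M_def m_def by (rule measure_PiM_slab[OF h'])
  have ae: "AE x in lborel. integrable M (\<lambda>\<omega>. norm (B (x - corner \<omega> UNIV)) powr p)"
    by (rule AE_integrable_translates[OF finM _ _ int]) measurable
  have su: "corner \<omega> UNIV = (\<chi> j. \<omega> j)" for \<omega> :: "'n \<Rightarrow> real" by (simp add: corner_def)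
  from rep ae show ?thesis
  proof eventually_elim
    case (elim x)
    have "(\<integral>\<^sup>+\<omega>. ennreal (norm (B (x - corner \<omega> UNIV)) powr p) \<partial>M)
      = (\<integral>\<^sup>+y. ennreal (norm (B (x - y)) powr p) \<partial>distr M borel (\<lambda>\<omega>. corner \<omega> UNIV))"
      by (subst nn_integral_distr[OF sh]) auto
    also have "distr M borel (\<lambda>\<omega>. corner \<omega> UNIV) = density lborel (indicator (cbox (0 :: real ^ 'n) (\<chi> j. h j)))"
      unfolding distr_PiM_slab M_def su ..
    also have "(\<integral>\<^sup>+y. ennreal (norm (B (x - y)) powr p) \<partial>\<dots>)
       = (\<integral>\<^sup>+y. indicator (cbox (0 :: real ^ 'n) (\<chi> j. h j)) y * ennreal (norm (B (x - y)) powr p) \<partial>lborel)"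
      by (subst nn_integral_density) auto
    also have "\<dots> \<le> (\<integral>\<^sup>+y. ennreal (norm (B (x - y)) powr p) \<partial>lborel)"
      by (intro nn_integral_mono) (auto simp: indicator_def)
    also have "\<dots> = (\<integral>\<^sup>+y. ennreal (norm (B y) powr p) \<partial>lborel)"
      by (rule nn_integral_lborel_reflect[of "\<lambda>y. ennreal (norm (B y) powr p)"]) measurable
    also have "\<dots> = ennreal (LBINT x. norm (B x) powr p)"
      by (rule nn_integral_eq_integral[OF int]) simp
    also have "(\<integral>\<^sup>+\<omega>. ennreal (norm (B (x - corner \<omega> UNIV)) powr p) \<partial>M) = ennreal (\<integral>\<omega>. norm (B (x - corner \<omega> UNIV)) powr p \<partial>M)"
      by (rule nn_integral_eq_integral[OF elim(2)]) simp
    finally have le: "(\<integral>\<omega>. norm (B (x - corner \<omega> UNIV)) powr p \<partial>M) \<le> (LBINT x. norm (B x) powr p)"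
      by (simp add: integral_nonneg_AE)
    have "norm (mixed_diff h UNIV f x) powr p \<le> m powr (p - 1) * (\<integral>\<omega>. norm (B (x - corner \<omega> UNIV)) powr p \<partial>M)"
      unfolding elim(1) M_def[symmetric] mM[symmetric]
      by (rule power_mean_inequality[OF finM _ _ p elim(2)]) (use mM m in auto)
    also have "\<dots> \<le> m powr (p - 1) * (LBINT x. norm (B x) powr p)"
      using le by (intro mult_left_mono) auto
    finally show ?case unfolding m_def .
  qed
qed

section \<open>Interpolation between the \<open>L\<^sub>p\<close> bounds\<close>

lemma sum_subset_weights:
  fixes a b :: "'n::finite \<Rightarrow> real"
  shows "(\<Sum>S\<in>UNIV. (\<Prod>i\<in>S. a i) * (\<Prod>i\<in>UNIV - S. b i)) = (\<Prod>i\<in>UNIV. a i + b i)"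
  using prod_add[of "UNIV :: 'n set" a b] by simp

text \<open>
  The weights are the distribution of a random subset that contains each \<open>j\<close> independently with
  probability \<open>a j\<close>; the sum is the expectation of \<open>\<Sum>j\<in>S. l j\<close>.
\<close>

lemma sum_subset_weights_marginal:
  fixes a b l :: "'n::finite \<Rightarrow> real"
  assumes ab: "\<And>i. a i + b i = 1"
  shows "(\<Sum>S\<in>UNIV. (\<Prod>i\<in>S. a i) * (\<Prod>i\<in>UNIV - S. b i) * (\<Sum>j\<in>S. l j)) = (\<Sum>j\<in>UNIV. a j * l j)"
proof -
  let ?\<theta> = "\<lambda>S. (\<Prod>i\<in>S. a i) * (\<Prod>i\<in>UNIV - S. b i)"
  have marg: "(\<Sum>S\<in>UNIV. if j \<in> S then ?\<theta> S else 0) = a j" for j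
  proof -
    \<comment> \<open>setting \<open>b j\<close> to \<open>0\<close> removes exactly the sets that do not contain \<open>j\<close>\<close>
    let ?b = "\<lambda>i. if i = j then 0 else b i"
    have "(\<Sum>S\<in>UNIV. if j \<in> S then ?\<theta> S else 0) = (\<Sum>S\<in>UNIV. (\<Prod>i\<in>S. a i) * (\<Prod>i\<in>UNIV - S. ?b i))"
    proof (rule sum.cong[OF refl])
      fix S
      show "(if j \<in> S then ?\<theta> S else 0) = (\<Prod>i\<in>S. a i) * (\<Prod>i\<in>UNIV - S. ?b i)"
      proof (cases "j \<in> S")
        case True
        then have "(\<Prod>i\<in>UNIV - S. ?b i) = (\<Prod>i\<in>UNIV - S. b i)" by (intro prod.cong) auto
        then show ?thesis using True by simp
      next
        case False
        then have "(\<Prod>i\<in>UNIV - S. ?b i) = 0" by (intro prod_zero) auto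
        then show ?thesis using False by simp
      qed
    qed
    also have "\<dots> = (\<Prod>i\<in>UNIV. a i + ?b i)" by (rule sum_subset_weights)
    also have "\<dots> = (\<Prod>i\<in>UNIV. if i = j then a j else 1)" by (intro prod.cong) (auto simp: ab)
    also have "\<dots> = a j" by simp
    finally show ?thesis .
  qed
  have "(\<Sum>S\<in>UNIV. ?\<theta> S * (\<Sum>j\<in>S. l j)) = (\<Sum>S\<in>UNIV. \<Sum>j\<in>UNIV. (if j \<in> S then ?\<theta> S else 0) * l j)"
  proof (rule sum.cong[OF refl])
    fix S :: "'n set"
    have "(\<Sum>j\<in>UNIV. (if j \<in> S then ?\<theta> S else 0) * l j) = (\<Sum>j\<in>S. ?\<theta> S * l j)"
      by (rule sum.mono_neutral_cong_right) auto
    then show "?\<theta> S * (\<Sum>j\<in>S. l j) = (\<Sum>j\<in>UNIV. (if j \<in> S then ?\<theta> S else 0) * l j)"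
      by (simp add: sum_distrib_left)
  qed
  also have "\<dots> = (\<Sum>j\<in>UNIV. (\<Sum>S\<in>UNIV. if j \<in> S then ?\<theta> S else 0) * l j)"
    by (subst sum.swap) (simp add: sum_distrib_right)
  finally show ?thesis unfolding marg .
qed

text \<open>
  Here \<open>l j\<close> stands for \<open>ln (h j)\<close>.  The numbers \<open>e S\<close> are the Hoelder exponents of the factors with
  exponent \<open>p S\<close>, and \<open>r\<close> is the power that is estimated by the uniform bound \<open>(\<Prod>j. h j) powr c\<close>.
  The conclusion says that together they bound the square of the \<open>L\<^sub>2\<close> norm by \<open>\<Prod>j. h j\<close>, which
  corresponds to the power \<open>1/2\<close> of every \<open>h j\<close> in the norm, improved by the factor \<open>exp (- \<kappa> * \<bar>l j\<bar>)\<close> in every variable.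

  In the proof the weights \<open>\<theta> S\<close> are the uniform ones \<open>2 ^ - n\<close>, tilted by \<open>\<delta>\<close> towards the sets that
  contain the variables with \<open>l j \<le> 0\<close> and avoid the others.  Their mean \<open>A\<close> of \<open>1 / p S\<close> exceeds
  \<open>1/2\<close>.  They are mixed, in the ratio of \<open>\<mu>\<close> to \<open>1 - \<mu>\<close>, with a combination of the norm of exponent
  \<open>p UNIV\<close> (weight \<open>t\<close>) and the uniform bound (weight \<open>1 - t\<close>); this combination has the power \<open>1/2\<close>
  of every \<open>h j\<close> and the reciprocal exponent \<open>y < 1/2\<close>.
\<close>

lemma interpolation_exponents:
  fixes p :: "'n::finite set \<Rightarrow> real"
  assumes p: "\<And>S. p S \<ge> 1" and p1: "p UNIV > 1"
    and sum: "(\<Sum>S\<in>UNIV. 1 / p S) > 2 ^ (CARD('n) - 1)"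
  obtains \<kappa> c where "\<kappa> > 0" "0 \<le> c" "c \<le> 1 - 1 / p UNIV"
    and "\<And>l :: 'n \<Rightarrow> real. \<exists>e r. (\<forall>S. e S \<ge> 0) \<and> (\<Sum>S\<in>UNIV. e S) = 1 \<and> r \<ge> 0 \<and> r + (\<Sum>S\<in>UNIV. e S * p S) = 2 \<and>
       r * c * (\<Sum>j\<in>UNIV. l j) + (\<Sum>S\<in>UNIV. e S * p S * (\<Sum>j\<in>S. l j)) \<le> (\<Sum>j\<in>UNIV. l j - \<kappa> * \<bar>l j\<bar>)"
proof -
  let ?d = "CARD('n)"
  define P where "P = p UNIV"
  have P: "P > 1" using p1 by (simp add: P_def)
  \<comment> \<open>for \<open>P \<ge> 2\<close> the uniform bounds reach the power \<open>1/2\<close> alone; otherwise \<open>t\<close> solves \<open>t + (1 - t) * (1 - 1 / P) = 1/2\<close>\<close>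
  define t where "t = (if P \<ge> 2 then 0 else 1 - P / 2)"
  define c where "c = (if P \<ge> 2 then 1/2 else 1 - 1 / P)"
  define y where "y = t / P"
  have t: "0 \<le> t" "t \<le> 1" using P by (auto simp: t_def)
  have c: "0 \<le> c" "c \<le> 1 - 1 / P" using P by (auto simp: c_def field_simps)
  have tc: "t + (1 - t) * c = 1/2" using P by (auto simp: t_def c_def field_simps)
  have y: "y < 1/2" "y \<ge> 0" using P t by (auto simp: y_def t_def field_simps)
  define s where "s = (\<Sum>S\<in>UNIV. 1 / p S) / 2 ^ ?d"
  have s: "s > 1/2"
  proof -
    have "(2::real) ^ ?d = 2 * 2 ^ (?d - 1)"
      by (metis One_nat_def Suc_pred power_Suc zero_less_card_finite)
    then show ?thesis using sum by (simp add: s_def field_simps)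
  qed
  obtain \<delta> where \<delta>: "0 < \<delta>" "\<delta> < 1" "(1 - \<delta>) ^ ?d * s > 1/2"
  proof -
    have "((\<lambda>\<delta>. (1 - \<delta>) ^ ?d * s) \<longlongrightarrow> (1 - 0) ^ ?d * s) (at_right 0)" by (intro tendsto_intros)
    then have "eventually (\<lambda>\<delta>. (1 - \<delta>) ^ ?d * s > 1/2) (at_right 0)"
      using s by (intro order_tendstoD(1)) auto
    moreover have "eventually (\<lambda>\<delta>. \<delta> \<in> {0<..<1::real}) (at_right 0)"
      by (rule eventually_at_right_real) simp
    ultimately have "eventually (\<lambda>\<delta>. 0 < \<delta> \<and> \<delta> < 1 \<and> (1 - \<delta>) ^ ?d * s > 1/2) (at_right (0::real))"
      by eventually_elim auto
    then show ?thesis using that eventually_happens trivial_limit_at_right_real by blast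
  qed
  define \<kappa> where "\<kappa> = \<delta> * (1/2 - y)"
  have \<kappa>: "\<kappa> > 0" using \<delta> y by (simp add: \<kappa>_def)
  show ?thesis
  proof (rule that[OF \<kappa> c[unfolded P_def]])
    fix l :: "'n \<Rightarrow> real"
    define \<sigma> where "\<sigma> j = (if l j \<le> 0 then 1 else -1 :: real)" for j
    define a where "a j = (1 + \<sigma> j * \<delta>) / 2" for j
    define b where "b j = (1 - \<sigma> j * \<delta>) / 2" for j
    have ab1: "a j + b j = 1" for j by (simp add: a_def b_def field_simps)
    have al: "a j \<ge> (1 - \<delta>) / 2" "b j \<ge> (1 - \<delta>) / 2" for j using \<delta> by (auto simp: a_def b_def \<sigma>_def)
    have "(1 - \<delta>) / 2 \<ge> 0" using \<delta> by simp
    then have a0: "a j \<ge> 0" "b j \<ge> 0" for j using al[of j] by (blast intro: order_trans)+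
    define \<theta> where "\<theta> S = (\<Prod>i\<in>S. a i) * (\<Prod>i\<in>UNIV - S. b i)" for S
    have \<theta>1: "(\<Sum>S\<in>UNIV. \<theta> S) = 1"
      unfolding \<theta>_def sum_subset_weights by (simp add: ab1)
    have \<theta>0: "\<theta> S \<ge> 0" for S unfolding \<theta>_def using a0 by (intro mult_nonneg_nonneg prod_nonneg) auto
    have \<theta>l: "\<theta> S \<ge> ((1 - \<delta>) / 2) ^ ?d" for S
    proof -
      have "((1 - \<delta>) / 2) ^ ?d = (\<Prod>i\<in>S. (1 - \<delta>) / 2) * (\<Prod>i\<in>UNIV - S. (1 - \<delta>) / 2)"
        by (simp add: power_add[symmetric] card_Diff_subset card_mono)
      also have "\<dots> \<le> \<theta> S"
        unfolding \<theta>_def using al \<delta> by (intro mult_mono prod_mono prod_nonneg) (auto intro: a0)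
      finally show ?thesis .
    qed
    define A where "A = (\<Sum>S\<in>UNIV. \<theta> S / p S)"
    have pS: "p S > 0" for S using p[of S] by linarith
    have A1: "A > 1/2"
    proof -
      have "(1 - \<delta>) ^ ?d * s = (\<Sum>S\<in>(UNIV :: 'n set set). ((1 - \<delta>) / 2) ^ ?d / p S)"
        by (simp add: s_def sum_divide_distrib sum_distrib_left power_divide field_simps)
      also have "\<dots> \<le> A" unfolding A_def using \<theta>l pS by (intro sum_mono divide_right_mono) (auto intro: less_imp_le)
      finally show ?thesis using \<delta> by linarith
    qed
    have A2: "A \<le> 1"
    proof -
      have "A \<le> (\<Sum>S\<in>UNIV. \<theta> S)" unfolding A_def
      proof (rule sum_mono)
        fix S
        have "\<theta> S / p S \<le> \<theta> S / 1" using \<theta>0 p pS by (intro divide_left_mono) auto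
        then show "\<theta> S / p S \<le> \<theta> S" by simp
      qed
      then show ?thesis using \<theta>1 by simp
    qed
    \<comment> \<open>chosen so that the reciprocal exponents combine to \<open>\<mu> * A + (1 - \<mu>) * y = 1/2\<close>\<close>
    define \<mu> where "\<mu> = (1/2 - y) / (A - y)"
    have Ay: "A - y > 0" "A - y \<le> 1" using A1 A2 y by auto
    have \<mu>A: "\<mu> * (A - y) = 1/2 - y" using Ay by (simp add: \<mu>_def)
    have \<mu>: "\<mu> > 0" "\<mu> < 1" using Ay y A1 by (auto simp: \<mu>_def field_simps)
    have \<mu>l: "\<mu> \<ge> 1/2 - y"
    proof -
      have "1/2 - y = \<mu> * (A - y)" using \<mu>A by simp
      also have "\<dots> \<le> \<mu>" using \<mu> Ay by (simp add: mult_left_le)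
      finally show ?thesis .
    qed
    define w where "w S = 2 * (\<mu> * \<theta> S + (if S = UNIV then (1 - \<mu>) * t else 0))" for S
    define r where "r = 2 * (1 - \<mu>) * (1 - t)"
    have wsum: "(\<Sum>S\<in>UNIV. w S * g S) = 2 * (\<mu> * (\<Sum>S\<in>UNIV. \<theta> S * g S) + (1 - \<mu>) * t * g UNIV)" for g
    proof -
      have "(\<Sum>S\<in>UNIV. w S * g S) = (\<Sum>S\<in>UNIV. 2 * (\<mu> * (\<theta> S * g S)) + (if S = UNIV then 2 * ((1 - \<mu>) * t * g UNIV) else 0))"
        by (intro sum.cong) (auto simp: w_def algebra_simps)
      also have "\<dots> = 2 * (\<mu> * (\<Sum>S\<in>UNIV. \<theta> S * g S)) + 2 * ((1 - \<mu>) * t * g UNIV)"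
        by (simp add: sum.distrib sum_distrib_left)
      finally show ?thesis by (simp add: algebra_simps)
    qed
    have w0: "w S \<ge> 0" for S using \<mu> \<theta>0 t by (auto simp: w_def)
    have wp: "w S / p S * p S = w S" for S using pS[of S] by simp
    have e1: "(\<Sum>S\<in>UNIV. w S / p S) = 1"
    proof -
      have "(\<Sum>S\<in>UNIV. w S / p S) = 2 * (\<mu> * A + (1 - \<mu>) * t * (1 / P))"
        using wsum[of "\<lambda>S. 1 / p S"] by (simp add: A_def P_def)
      also have "\<dots> = 2 * (\<mu> * (A - y) + y)" by (simp add: y_def algebra_simps)
      finally show ?thesis using \<mu>A by simp
    qed
    have r2: "r + (\<Sum>S\<in>UNIV. w S) = 2"
      using wsum[of "\<lambda>_. 1"] by (simp add: \<theta>1 r_def algebra_simps)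
    have "r * c * (\<Sum>j\<in>UNIV. l j) + (\<Sum>S\<in>UNIV. w S * (\<Sum>j\<in>S. l j))
      = r * c * (\<Sum>j\<in>UNIV. l j) + 2 * (\<mu> * (\<Sum>j\<in>UNIV. a j * l j) + (1 - \<mu>) * t * (\<Sum>j\<in>UNIV. l j))"
      unfolding wsum \<theta>_def sum_subset_weights_marginal[OF ab1] ..
    also have "\<dots> = 2 * (1 - \<mu>) * (t + (1 - t) * c) * (\<Sum>j\<in>UNIV. l j) + 2 * \<mu> * (\<Sum>j\<in>UNIV. a j * l j)"
      by (simp add: r_def algebra_simps)
    also have "\<dots> = (\<Sum>j\<in>UNIV. (1 - \<mu>) * l j + 2 * \<mu> * (a j * l j))"
      unfolding tc sum.distrib sum_distrib_left[symmetric] mult.assoc by simp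
    also have "\<dots> \<le> (\<Sum>j\<in>UNIV. l j - \<kappa> * \<bar>l j\<bar>)"
    proof (rule sum_mono)
      fix j
      have "\<sigma> j * l j = - \<bar>l j\<bar>" by (simp add: \<sigma>_def)
      moreover have "(1 - \<mu>) * l j + 2 * \<mu> * (a j * l j) = l j + \<mu> * \<delta> * (\<sigma> j * l j)"
        by (simp add: a_def field_simps)
      ultimately have "(1 - \<mu>) * l j + 2 * \<mu> * (a j * l j) = l j - \<mu> * \<delta> * \<bar>l j\<bar>" by simp
      also have "\<dots> \<le> l j - \<kappa> * \<bar>l j\<bar>"
      proof -
        have "\<kappa> \<le> \<mu> * \<delta>" using \<mu>l \<delta> by (simp add: \<kappa>_def mult.commute[of \<mu>])
        then have "\<kappa> * \<bar>l j\<bar> \<le> \<mu> * \<delta> * \<bar>l j\<bar>" by (rule mult_right_mono) simp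
        then show ?thesis by linarith
      qed
      finally show "(1 - \<mu>) * l j + 2 * \<mu> * (a j * l j) \<le> l j - \<kappa> * \<bar>l j\<bar>" .
    qed
    finally have fin: "r * c * (\<Sum>j\<in>UNIV. l j) + (\<Sum>S\<in>UNIV. w S * (\<Sum>j\<in>S. l j)) \<le> (\<Sum>j\<in>UNIV. l j - \<kappa> * \<bar>l j\<bar>)" .
    show "\<exists>e r. (\<forall>S. e S \<ge> 0) \<and> (\<Sum>S\<in>UNIV. e S) = 1 \<and> r \<ge> 0 \<and> r + (\<Sum>S\<in>UNIV. e S * p S) = 2 \<and>
       r * c * (\<Sum>j\<in>UNIV. l j) + (\<Sum>S\<in>UNIV. e S * p S * (\<Sum>j\<in>S. l j)) \<le> (\<Sum>j\<in>UNIV. l j - \<kappa> * \<bar>l j\<bar>)"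
    proof (intro exI conjI allI)
      show "w S / p S \<ge> 0" for S using w0 pS[of S] by (simp add: less_imp_le)
      show "(\<Sum>S\<in>UNIV. w S / p S) = 1" by (rule e1)
      show "r \<ge> 0" using \<mu> t by (simp add: r_def)
      show "r + (\<Sum>S\<in>UNIV. w S / p S * p S) = 2" unfolding wp by (rule r2)
      show "r * c * (\<Sum>j\<in>UNIV. l j) + (\<Sum>S\<in>UNIV. w S / p S * p S * (\<Sum>j\<in>S. l j)) \<le> (\<Sum>j\<in>UNIV. l j - \<kappa> * \<bar>l j\<bar>)"
        unfolding wp by (rule fin)
    qed
  qed
qed

text \<open>
  Hoelder's inequality with several factors.  It is applied pointwise, in the form of the
  weighted inequality of the means for the functions \<open>w powr p i\<close> divided by the bounds for their
  integrals, so that no norms have to be formed.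
\<close>

lemma interpolation_L2:
  fixes w :: "'a \<Rightarrow> real" and p e l :: "'i \<Rightarrow> real"
  assumes I: "finite I" and [measurable]: "w \<in> borel_measurable M" and w0: "\<And>x. w x \<ge> 0"
    and sup: "AE x in M. w x \<le> exp b"
    and Lp: "\<And>i. i \<in> I \<Longrightarrow> (\<integral>\<^sup>+x. ennreal (w x powr p i) \<partial>M) \<le> ennreal (exp (l i) powr p i)"
    and e: "\<And>i. i \<in> I \<Longrightarrow> e i \<ge> 0" "sum e I = 1" and r: "r \<ge> 0" "r + (\<Sum>i\<in>I. e i * p i) = 2"
  shows "(\<integral>\<^sup>+x. ennreal ((w x)\<^sup>2) \<partial>M) \<le> ennreal (exp (r * b + (\<Sum>i\<in>I. e i * p i * l i)))"
proof -
  define K where "K = exp (r * b + (\<Sum>i\<in>I. e i * p i * l i))"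
  have pw: "(w x)\<^sup>2 \<le> K * (\<Sum>i\<in>I. e i * (exp (- p i * l i) * w x powr p i))" if wb: "w x \<le> exp b" for x
  proof (cases "w x = 0")
    case True
    then show ?thesis by (simp add: K_def)
  next
    case False
    then have wx: "w x > 0" using w0[of x] by simp
    let ?L = "ln (w x)"
    have Lb: "?L \<le> b" using wb wx by (metis ln_exp ln_le_cancel_iff exp_gt_zero)
    have "(w x)\<^sup>2 = exp (2 * ?L)" using wx by (simp add: exp_double)
    also have "2 * ?L = (r * ?L + (\<Sum>i\<in>I. e i * p i * l i)) + (\<Sum>i\<in>I. e i * (p i * (?L - l i)))"
    proof -
      have "(\<Sum>i\<in>I. e i * (p i * (?L - l i))) = (\<Sum>i\<in>I. e i * p i) * ?L - (\<Sum>i\<in>I. e i * p i * l i)"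
        by (simp add: right_diff_distrib sum_subtractf sum_distrib_right mult.assoc)
      then have "(r * ?L + (\<Sum>i\<in>I. e i * p i * l i)) + (\<Sum>i\<in>I. e i * (p i * (?L - l i))) = (r + (\<Sum>i\<in>I. e i * p i)) * ?L"
        by (simp add: algebra_simps)
      then show ?thesis using r by simp
    qed
    also have "exp \<dots> = exp (r * ?L + (\<Sum>i\<in>I. e i * p i * l i)) * (\<Prod>i\<in>I. exp (p i * (?L - l i)) powr e i)"
      unfolding exp_add by (simp add: exp_sum[OF I] powr_def)
    also have "\<dots> \<le> K * (\<Sum>i\<in>I. e i * exp (p i * (?L - l i)))"
    proof (rule mult_mono)
      show "exp (r * ?L + (\<Sum>i\<in>I. e i * p i * l i)) \<le> K"
        unfolding K_def using Lb r by (simp add: mult_left_mono)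
      show "(\<Prod>i\<in>I. exp (p i * (?L - l i)) powr e i) \<le> (\<Sum>i\<in>I. e i * exp (p i * (?L - l i)))"
        by (rule weighted_AM_GM[OF I e]) auto
    qed (auto simp: K_def intro!: prod_nonneg)
    also have "(\<Sum>i\<in>I. e i * exp (p i * (?L - l i))) = (\<Sum>i\<in>I. e i * (exp (- p i * l i) * w x powr p i))"
      using wx by (intro sum.cong refl) (simp add: powr_def algebra_simps exp_add[symmetric])
    finally show ?thesis .
  qed
  have "(\<integral>\<^sup>+x. ennreal ((w x)\<^sup>2) \<partial>M) \<le> (\<integral>\<^sup>+x. ennreal K * (\<Sum>i\<in>I. ennreal (e i * exp (- p i * l i)) * ennreal (w x powr p i)) \<partial>M)"
  proof (rule nn_integral_mono_AE)
    show "AE x in M. ennreal ((w x)\<^sup>2) \<le> ennreal K * (\<Sum>i\<in>I. ennreal (e i * exp (- p i * l i)) * ennreal (w x powr p i))"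
      using sup
    proof eventually_elim
      case (elim x)
      have "ennreal ((w x)\<^sup>2) \<le> ennreal (K * (\<Sum>i\<in>I. e i * (exp (- p i * l i) * w x powr p i)))"
        by (rule ennreal_leI[OF pw[OF elim]])
      also have "\<dots> = ennreal K * ennreal (\<Sum>i\<in>I. e i * (exp (- p i * l i) * w x powr p i))"
        by (rule ennreal_mult') (simp add: K_def)
      also have "ennreal (\<Sum>i\<in>I. e i * (exp (- p i * l i) * w x powr p i)) = (\<Sum>i\<in>I. ennreal (e i * (exp (- p i * l i) * w x powr p i)))"
        using e by (intro sum_ennreal[symmetric]) auto
      also have "\<dots> = (\<Sum>i\<in>I. ennreal (e i * exp (- p i * l i)) * ennreal (w x powr p i))"
        using e by (intro sum.cong refl) (simp add: ennreal_mult'[symmetric] ennreal_mult''[symmetric] mult.assoc)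
      finally show ?case .
    qed
  qed
  also have "\<dots> = ennreal K * (\<Sum>i\<in>I. ennreal (e i * exp (- p i * l i)) * (\<integral>\<^sup>+x. ennreal (w x powr p i) \<partial>M))"
    by (simp add: nn_integral_cmult nn_integral_sum)
  also have "\<dots> \<le> ennreal K * (\<Sum>i\<in>I. ennreal (e i * exp (- p i * l i)) * ennreal (exp (l i) powr p i))"
    by (intro mult_left_mono sum_mono Lp) auto
  also have "(\<Sum>i\<in>I. ennreal (e i * exp (- p i * l i)) * ennreal (exp (l i) powr p i)) = (\<Sum>i\<in>I. ennreal (e i))"
  proof (rule sum.cong[OF refl])
    fix i assume "i \<in> I"
    have "exp (- p i * l i) * exp (l i) powr p i = 1" by (simp add: powr_def exp_add[symmetric])
    then have "e i * exp (- p i * l i) * exp (l i) powr p i = e i" by (simp add: mult.assoc)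
    then show "ennreal (e i * exp (- p i * l i)) * ennreal (exp (l i) powr p i) = ennreal (e i)"
      by (subst ennreal_mult''[symmetric]) (simp, simp only:)
  qed
  also have "\<dots> = ennreal 1" using e by (subst sum_ennreal) auto
  finally show ?thesis unfolding K_def by simp
qed

section \<open>The mixed differences in the square mean, and the theorem\<close>

text \<open>
  All \<open>L\<^sub>p\<close> and uniform bounds are put into \<open>interpolation_L2\<close> with one common constant \<open>C\<close>.  In
  logarithmic coordinates \<open>l j = ln (h j)\<close> the interpolated bound is the exponential of a linear
  expression, which \<open>interpolation_exponents\<close> estimates.
\<close>

lemma mixed_diff_L2_le:
  fixes f :: "real ^ 'n \<Rightarrow> complex" and B :: "'n set \<Rightarrow> real ^ 'n \<Rightarrow> complex" and p :: "'n set \<Rightarrow> real"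
  assumes f: "f \<in> C0" and B0: "B {} = f" and Bm: "\<And>S. B S \<in> borel_measurable borel"
    and p: "\<And>S. p S \<ge> 1" and p1: "p UNIV > 1" and sum: "(\<Sum>S\<in>UNIV. 1 / p S) > 2 ^ (CARD('n) - 1)"
    and int: "\<And>S. integrable lborel (\<lambda>x. norm (B S x) powr p S)"
    and step: "\<And>S. S \<noteq> {} \<Longrightarrow> \<exists>j\<in>S. \<forall>d>0. AE x in lborel. 0 \<notin> {x $ j - d..x $ j} \<longrightarrow>
      B (S - {j}) x - B (S - {j}) (x - axis j d) = (\<integral>t. B S (x - axis j t) \<partial>slab d)"
  obtains C \<kappa> where "C > 0" "\<kappa> > 0"
    "\<And>h. (\<And>j. h j > 0) \<Longrightarrow> (\<integral>\<^sup>+x. ennreal ((norm (mixed_diff h UNIV f x))\<^sup>2) \<partial>lborel)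
      \<le> ennreal ((C * (\<Prod>j\<in>UNIV. exp ((ln (h j) - \<kappa> * \<bar>ln (h j)\<bar>) / 2)))\<^sup>2)"
proof -
  have cont: "continuous_on UNIV f" using f by (auto simp: C0_def)
  obtain M where M: "\<And>x. norm (f x) \<le> M" using C0_bounded[OF f] by blast
  obtain \<kappa> c where \<kappa>: "\<kappa> > 0" and c: "0 \<le> c" "c \<le> 1 - 1 / p UNIV"
    and ex: "\<And>l :: 'n \<Rightarrow> real. \<exists>e r. (\<forall>S. e S \<ge> 0) \<and> (\<Sum>S\<in>UNIV. e S) = 1 \<and> r \<ge> 0 \<and> r + (\<Sum>S\<in>UNIV. e S * p S) = 2 \<and>
       r * c * (\<Sum>j\<in>UNIV. l j) + (\<Sum>S\<in>UNIV. e S * p S * (\<Sum>j\<in>S. l j)) \<le> (\<Sum>j\<in>UNIV. l j - \<kappa> * \<bar>l j\<bar>)"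
    using interpolation_exponents[OF p p1 sum] by blast
  define I where "I S = (LBINT x. norm (B S x) powr p S)" for S
  have I0: "I S \<ge> 0" for S unfolding I_def by (simp add: integral_nonneg_AE)
  define K where "K S = (2 * 2 powr p S) ^ card (- S) * I S" for S
  have K0: "K S \<ge> 0" for S unfolding K_def using I0 by simp
  define C where "C = 1 + \<bar>2 ^ CARD('n) * M\<bar> + (\<Sum>S\<in>UNIV. K S powr (1 / p S)) + I UNIV powr (1 / p UNIV)"
  have sumK: "(\<Sum>S\<in>UNIV. K S powr (1 / p S)) \<ge> 0" by (intro sum_nonneg) simp
  have C1: "C \<ge> 1" unfolding C_def using sumK by (simp add: add_increasing)
  have CM: "2 ^ CARD('n) * M \<le> C" unfolding C_def
    using sumK abs_ge_self[of "2 ^ CARD('n) * M"] powr_ge_zero[of "I UNIV" "1 / p UNIV"] by linarith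
  have CI: "I UNIV powr (1 / p UNIV) \<le> C" unfolding C_def using sumK by simp
  have CK: "K S \<le> C powr p S" for S
  proof -
    have pS: "p S > 0" using p[of S] by linarith
    have "K S powr (1 / p S) \<le> (\<Sum>S\<in>UNIV. K S powr (1 / p S))" by (intro member_le_sum) auto
    then have "K S powr (1 / p S) \<le> C" unfolding C_def by (simp add: add_increasing2)
    then have "(K S powr (1 / p S)) powr p S \<le> C powr p S" using pS by (intro powr_mono2) auto
    then show ?thesis using pS K0 by (simp add: powr_powr)
  qed
  show ?thesis
  proof (rule that[of C \<kappa>])
    show "C > 0" using C1 by simp
    show "\<kappa> > 0" by fact
    fix h :: "'n \<Rightarrow> real" assume h: "\<And>j. h j > 0"
    define L where "L = ln C"
    have eL: "exp L = C" using C1 by (simp add: L_def)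
    define l where "l j = ln (h j)" for j
    have el: "exp (l j) = h j" for j using h by (simp add: l_def)
    have elS: "exp (\<Sum>j\<in>S. l j) = (\<Prod>j\<in>S. h j)" for S by (simp add: exp_sum el)
    have rep: "AE x in lborel. mixed_diff h S f x = (\<integral>\<omega>. B S (x - corner \<omega> S) \<partial>slabs h S)" for S
      by (rule mixed_difference_integral[where p = p, OF cont B0 Bm p int step h])
    let ?w = "\<lambda>x. norm (mixed_diff h UNIV f x)"
    have [measurable]: "mixed_diff h UNIV f \<in> borel_measurable borel"
      using continuous_mixed_diff[OF cont] by (rule borel_measurable_continuous_onI)
    have Lp: "(\<integral>\<^sup>+x. ennreal (?w x powr p S) \<partial>lborel) \<le> ennreal (exp (L + (\<Sum>j\<in>S. l j)) powr p S)" for S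
    proof -
      have "(\<integral>\<^sup>+x. ennreal (?w x powr p S) \<partial>lborel)
         \<le> ennreal ((2 * 2 powr p S) ^ card (- S)) * (\<integral>\<^sup>+x. ennreal (norm (mixed_diff h S f x) powr p S) \<partial>lborel)"
        using mixed_diff_Lp_le_partial[OF cont p, of S "- S" h S] by simp
      also have "\<dots> \<le> ennreal ((2 * 2 powr p S) ^ card (- S)) * ennreal ((\<Prod>j\<in>S. h j) powr p S * I S)"
        unfolding I_def by (intro mult_left_mono mixed_diff_Lp_le_derivative[OF rep Bm p int h]) simp
      also have "\<dots> = ennreal (K S * (\<Prod>j\<in>S. h j) powr p S)"
        unfolding K_def by (subst ennreal_mult'[symmetric]) (simp_all add: mult_ac)
      also have "\<dots> \<le> ennreal (C powr p S * (\<Prod>j\<in>S. h j) powr p S)"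
        by (intro ennreal_leI mult_right_mono CK) simp
      also have "C powr p S * (\<Prod>j\<in>S. h j) powr p S = exp (L + (\<Sum>j\<in>S. l j)) powr p S"
        using C1 h by (simp add: exp_add eL elS powr_mult prod_nonneg less_imp_le)
      finally show ?thesis .
    qed
    define \<Lambda> where "\<Lambda> = (\<Sum>j\<in>UNIV. l j)"
    \<comment> \<open>of the two uniform bounds the first serves for large boxes, the second for small ones\<close>
    have sup: "AE x in lborel. ?w x \<le> exp (L + c * \<Lambda>)"
    proof (cases "\<Lambda> \<ge> 0")
      case True
      show ?thesis
      proof (rule AE_I2)
        fix x
        have "?w x \<le> C" using norm_mixed_diff_le[OF M, where S = UNIV and h = h] CM by (meson order_trans)
        also have "\<dots> \<le> exp (L + c * \<Lambda>)" using True c eL[symmetric] by simp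
        finally show "?w x \<le> exp (L + c * \<Lambda>)" .
      qed
    next
      case False
      let ?P = "p UNIV"
      have "AE x in lborel. ?w x powr ?P \<le> (\<Prod>j\<in>UNIV. h j) powr (?P - 1) * I UNIV"
        unfolding I_def by (rule mixed_diff_sup_le[OF rep Bm p int h])
      then show ?thesis
      proof eventually_elim
        case (elim x)
        have "?w x = (?w x powr ?P) powr (1 / ?P)" using p1 by (simp add: powr_powr)
        also have "\<dots> \<le> ((\<Prod>j\<in>UNIV. h j) powr (?P - 1) * I UNIV) powr (1 / ?P)"
          using elim p1 by (intro powr_mono2) auto
        also have "\<dots> = exp ((1 - 1 / ?P) * \<Lambda>) * I UNIV powr (1 / ?P)"
        proof -
          have "\<Lambda> * (?P - 1) / ?P = \<Lambda> * (1 - 1 / ?P)" using p1 by (simp add: field_simps)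
          then show ?thesis
            unfolding elS[symmetric] \<Lambda>_def[symmetric] using I0 p1
            by (simp add: powr_mult powr_powr exp_powr_real mult.commute)
        qed
        also have "\<dots> \<le> exp (c * \<Lambda>) * C"
        proof (intro mult_mono CI)
          show "exp ((1 - 1 / ?P) * \<Lambda>) \<le> exp (c * \<Lambda>)"
            using False c by (simp add: mult_right_mono_neg)
        qed auto
        finally show ?case by (simp add: exp_add eL mult.commute)
      qed
    qed
    obtain e r where e: "\<And>S. e S \<ge> 0" "(\<Sum>S\<in>UNIV. e S) = 1" and r: "r \<ge> 0" "r + (\<Sum>S\<in>UNIV. e S * p S) = 2"
      and er: "r * c * \<Lambda> + (\<Sum>S\<in>UNIV. e S * p S * (\<Sum>j\<in>S. l j)) \<le> (\<Sum>j\<in>UNIV. l j - \<kappa> * \<bar>l j\<bar>)"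
      using ex[of l] unfolding \<Lambda>_def by blast
    have "(\<integral>\<^sup>+x. ennreal ((?w x)\<^sup>2) \<partial>lborel) \<le> ennreal (exp (r * (L + c * \<Lambda>) + (\<Sum>S\<in>UNIV. e S * p S * (L + (\<Sum>j\<in>S. l j)))))"
      by (rule interpolation_L2[OF _ _ _ sup Lp e r]) simp_all
    also have "r * (L + c * \<Lambda>) + (\<Sum>S\<in>UNIV. e S * p S * (L + (\<Sum>j\<in>S. l j)))
       = (r + (\<Sum>S\<in>UNIV. e S * p S)) * L + (r * c * \<Lambda> + (\<Sum>S\<in>UNIV. e S * p S * (\<Sum>j\<in>S. l j)))"
      by (simp add: distrib_left distrib_right sum.distrib sum_distrib_right)
    also have "ennreal (exp \<dots>) \<le> ennreal (exp (2 * L + (\<Sum>j\<in>UNIV. l j - \<kappa> * \<bar>l j\<bar>)))"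
      using er r by (intro ennreal_leI) simp
    also have "exp (2 * L + (\<Sum>j\<in>UNIV. l j - \<kappa> * \<bar>l j\<bar>)) = (C * (\<Prod>j\<in>UNIV. exp ((l j - \<kappa> * \<bar>l j\<bar>) / 2)))\<^sup>2"
    proof -
      have "2 * L + (\<Sum>j\<in>UNIV. l j - \<kappa> * \<bar>l j\<bar>) = 2 * (L + (\<Sum>j\<in>UNIV. (l j - \<kappa> * \<bar>l j\<bar>) / 2))"
        by (simp add: sum_divide_distrib[symmetric])
      then show ?thesis by (simp only: exp_double exp_add exp_sum finite eL)
    qed
    finally show "(\<integral>\<^sup>+x. ennreal ((?w x)\<^sup>2) \<partial>lborel)
      \<le> ennreal ((C * (\<Prod>j\<in>UNIV. exp ((ln (h j) - \<kappa> * \<bar>ln (h j)\<bar>) / 2)))\<^sup>2)"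
      unfolding l_def .
  qed
qed

theorem theorem2p3:
  fixes f :: "real ^ 'n \<Rightarrow> complex"
    and D :: "'n set \<Rightarrow> real ^ 'n \<Rightarrow> complex"
    and p :: "'n set \<Rightarrow> real"
  assumes "f \<in> C0"
    and "mixed_partial_derivatives f D"
    and "\<And>\<eta>. \<eta> \<noteq> UNIV \<Longrightarrow> locally_ac_each_variable (D \<eta>)"
    and "1 \<le> p {}" and "f \<in> Lp (p {})"
    and "\<And>\<eta>. \<eta> \<noteq> {} \<Longrightarrow> 1 < p \<eta>" and "\<And>\<eta>. \<eta> \<noteq> {} \<Longrightarrow> D \<eta> \<in> Lp (p \<eta>)"
    and "(\<Sum>\<eta>\<in>UNIV. 1 / p \<eta>) > 2 ^ (CARD('n) - 1)"
    and "(\<Sum>\<eta> | \<eta> \<noteq> {}. 1 / p \<eta>) \<le> 2 ^ (CARD('n) - 1)"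
  shows "f \<in> Wiener_algebra"
proof -
  have cont: "continuous_on UNIV f" using assms(1) by (auto simp: C0_def)
  have [measurable]: "f \<in> borel_measurable borel" using cont by (rule borel_measurable_continuous_onI)
  have D0: "D {} = f" using assms(2) by (simp add: mixed_partial_derivatives_def)
  have p: "p \<eta> \<ge> 1" for \<eta> using assms(4) assms(6)[of \<eta>] by (cases "\<eta> = {}") auto
  have "\<forall>\<eta>. \<exists>b. b \<in> borel_measurable borel \<and> (AE x in lborel. D \<eta> x = b x) \<and>
      integrable lborel (\<lambda>x. norm (b x) powr p \<eta>) \<and> (\<eta> = {} \<longrightarrow> b = f)"
  proof
    fix \<eta>
    show "\<exists>b. b \<in> borel_measurable borel \<and> (AE x in lborel. D \<eta> x = b x) \<and>
      integrable lborel (\<lambda>x. norm (b x) powr p \<eta>) \<and> (\<eta> = {} \<longrightarrow> b = f)"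
    proof (cases "\<eta> = {}")
      case True
      have m: "(\<lambda>x. norm (f x) powr p {}) \<in> borel_measurable lborel" by measurable
      have "integrable lborel (\<lambda>x. norm (f x) powr p {})"
        using assms(5) integrable_completion[OF m] by (simp add: Lp_def)
      then show ?thesis using True D0 by (intro exI[of _ f]) auto
    next
      case False
      obtain b where "b \<in> borel_measurable borel" "AE x in lborel. D \<eta> x = b x"
        "integrable lborel (\<lambda>x. norm (b x) powr p \<eta>)"
        using Lp_borel_representative[OF assms(7)[OF False]] by blast
      then show ?thesis using False by blast
    qed
  qed
  then obtain B where B: "\<forall>\<eta>. B \<eta> \<in> borel_measurable borel \<and> (AE x in lborel. D \<eta> x = B \<eta> x) \<and>
      integrable lborel (\<lambda>x. norm (B \<eta> x) powr p \<eta>) \<and> (\<eta> = {} \<longrightarrow> B \<eta> = f)"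
    by (rule choice[THEN exE])
  have Bm: "B \<eta> \<in> borel_measurable borel" for \<eta>
    using spec[OF B, of \<eta>] by (rule conjunct1)
  have BD: "AE x in lborel. D \<eta> x = B \<eta> x" for \<eta>
    by (rule conjunct1[OF conjunct2[OF spec[OF B, of \<eta>]]])
  have Bi: "integrable lborel (\<lambda>x. norm (B \<eta> x) powr p \<eta>)" for \<eta>
    by (rule conjunct1[OF conjunct2[OF conjunct2[OF spec[OF B, of \<eta>]]]])
  have B0: "B {} = f" using spec[OF B, of "{}"] by simp
  have step: "\<exists>j\<in>S. \<forall>d>0. AE x in lborel. 0 \<notin> {x $ j - d..x $ j} \<longrightarrow>
      B (S - {j}) x - B (S - {j}) (x - axis j d) = (\<integral>t. B S (x - axis j t) \<partial>slab d)" if S: "S \<noteq> {}" for S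
  proof -
    have "\<exists>j\<in>S. AE x in lborel. has_partial_derivative_at (D (S - {j})) j (D S x) x"
    proof (cases "S = UNIV")
      case True
      then show ?thesis using assms(2) by (auto simp: mixed_partial_derivatives_def AE_completion_iff)
    next
      case False
      then have "\<exists>j\<in>S. \<forall>x\<in>off_axes. has_partial_derivative_at (D (S - {j})) j (D S x) x"
        using assms(2) S by (simp add: mixed_partial_derivatives_def)
      then obtain j where j: "j \<in> S" "\<And>x. x \<in> off_axes \<Longrightarrow> has_partial_derivative_at (D (S - {j})) j (D S x) x"
        by blast
      have "AE x in lborel. has_partial_derivative_at (D (S - {j})) j (D S x) x"
        using AE_off_axes by eventually_elim (rule j(2))
      then show ?thesis using j(1) by blast
    qed
    then obtain j where j: "j \<in> S" and der: "AE x in lborel. has_partial_derivative_at (D (S - {j})) j (D S x) x"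
      by blast
    have "S - {j} \<noteq> UNIV" by auto
    from difference_eq_integral_of_derivative[OF assms(3)[OF this] der BD BD Bm p Bi] j
    show ?thesis by blast
  qed
  have p1: "p UNIV > 1" by (rule assms(6)) simp
  obtain C \<kappa> where C: "C > 0" and \<kappa>: "\<kappa> > 0"
    and bd: "\<And>h. (\<And>j. h j > 0) \<Longrightarrow> (\<integral>\<^sup>+x. ennreal ((norm (mixed_diff h UNIV f x))\<^sup>2) \<partial>lborel)
      \<le> ennreal ((C * (\<Prod>j\<in>UNIV. exp ((ln (h j) - \<kappa> * \<bar>ln (h j)\<bar>) / 2)))\<^sup>2)"
    using mixed_diff_L2_le[OF assms(1) B0 Bm p p1 assms(8) Bi step] by blast
  have mm[measurable]: "mixed_diff h UNIV f \<in> borel_measurable borel" for h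
    using continuous_mixed_diff[OF cont] by (rule borel_measurable_continuous_onI)
  have int: "integrable lborel (\<lambda>x. (norm (mixed_diff h UNIV f x))\<^sup>2)" if h: "\<And>j. h j > 0" for h
    using bd[of h, OF h] by (intro integrableI_bounded) (auto intro: le_less_trans)
  show ?thesis
  proof (rule Bernstein_criterion[OF assms(1) _ _ int])
    \<comment> \<open>for \<open>h j = 2 powr s j\<close> the gain \<open>exp (- \<kappa> * \<bar>ln (h j)\<bar> / 2)\<close> is the power \<open>nat \<bar>s j\<bar>\<close> of this number\<close>
    show "0 \<le> exp (- \<kappa> * ln 2 / 2)" "exp (- \<kappa> * ln 2 / 2) < 1" using \<kappa> by auto
    fix s :: "'n \<Rightarrow> int"
    define h where "h j = 2 powr s j" for j
    have h: "h j > 0" for j by (simp add: h_def)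
    let ?R = "C * (\<Prod>j\<in>UNIV. exp ((ln (h j) - \<kappa> * \<bar>ln (h j)\<bar>) / 2))"
    have R0: "?R \<ge> 0" using C by (intro mult_nonneg_nonneg prod_nonneg) auto
    have "(LBINT x. (norm (mixed_diff h UNIV f x))\<^sup>2) \<le> ?R\<^sup>2"
      using bd[of h, OF h] by (subst (asm) nn_integral_eq_integral[OF int[of h, OF h]]) auto
    then have "sqrt (LBINT x. (norm (mixed_diff h UNIV f x))\<^sup>2) \<le> sqrt (?R\<^sup>2)"
      by (rule real_sqrt_le_mono)
    also have "sqrt (?R\<^sup>2) = ?R" using R0 by (simp only: real_sqrt_abs abs_of_nonneg)
    also have "?R = C * (\<Prod>j\<in>UNIV. sqrt (2 powr s j) * exp (- \<kappa> * ln 2 / 2) ^ nat \<bar>s j\<bar>)"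
    proof (intro arg_cong2[where f = "(*)"] refl prod.cong)
      fix j
      have lnh: "ln (h j) = s j * ln 2" by (simp add: h_def ln_powr)
      have "sqrt (2 powr s j) = exp (s j * ln 2 / 2)"
        by (intro real_sqrt_unique) (simp_all add: powr_def flip: exp_double)
      then show "exp ((ln (h j) - \<kappa> * \<bar>ln (h j)\<bar>) / 2) = sqrt (2 powr s j) * exp (- \<kappa> * ln 2 / 2) ^ nat \<bar>s j\<bar>"
        unfolding lnh exp_of_nat_mult[symmetric]
        by (simp add: exp_add[symmetric] abs_mult field_simps)
    qed
    finally show "sqrt (LBINT x. (norm (mixed_diff (\<lambda>j. 2 powr s j) UNIV f x))\<^sup>2)
      \<le> C * (\<Prod>j\<in>UNIV. sqrt (2 powr s j) * exp (- \<kappa> * ln 2 / 2) ^ nat \<bar>s j\<bar>)"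
      unfolding h_def .
  qed
qed

end
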